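(* Let $M^{n}$ ($n\geq 4$) be a Riemannian manifold with nonempty boundary $\partial M$. Assume that $M$ contains a two-sided compact properly immersed stable minimal free boundary hypersurface $\Sigma^{n-1}$, with induced metric $g$. (i) Suppose that $M$ has mean convex boundary and $\inf R^M<0$. If $\sigma^{1,0}(\Sigma,\partial\Sigma)<0$, then $$vol(\Sigma)^{\frac{2}{n-1}}\geq \frac{Q_g^{1,0}(\Sigma,\partial\Sigma)}{\inf R^M}\geq\frac{\sigma^{1,0}(\Sigma,\partial\Sigma)}{\inf R^M}.$$ (ii) Suppose that $M$ has nonnegative scalar curvature and $\inf H^{\partial M}<0$. If $\sigma^{0,1}(\Sigma,\partial\Sigma)<0$, then $$Area(\partial\Sigma)^{\frac{1}{n-2}}\geq \frac12\,\frac{Q_g^{0,1}(\Sigma,\partial\Sigma)}{\inf H^{\partial M}}\geq\frac12\,\frac{\sigma^{0,1}(\Sigma,\partial\Sigma)}{\inf H^{\partial M}}.$$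
   Context: Curvatures of $M$: $R^M$ is the scalar curvature of $M$, $Ric$ its Ricci curvature; $H^{\partial M}$ is the mean curvature of $\partial M$, i.e. the trace of $\Pi(X,Y)=\langle\nabla_X Z,Y\rangle$ where $Z$ is the outward unit normal of $\partial M$ (so the unit ball of $\mathbb{R}^n$ has $H^{\partial M}=n-1$). $M$ has mean convex boundary if $H^{\partial M}\ge 0$ everywhere. The infimum $\inf R^M$ is over $M$, and $\inf H^{\partial M}$ is over $\partial M$; in (i) $\inf R^M$ and in (ii) $\inf H^{\partial M}$ is assumed to be finite. Hypersurfaces: $\Sigma$ is a compact $(n-1)$-manifold with nonempty boundary, and it is properly immersed by $\mathfrak f:\Sigma\to M$ if $\mathfrak f$ is an immersion and $\mathfrak f(\Sigma)\cap\partial M=\mathfrak f(\partial\Sigma)$. It is two-sided if it carries a globally defined smooth unit normal field $N$; it is free boundary if it meets $\partial M$ orthogonally along $\partial\Sigma$. Minimal means zero mean curvature. With $h^\Sigma$ the second fundamental form of $\Sigma$, a two-sided minimal free boundary hypersurface is stable if for all $\varphi\in C^\infty(\Sigma)$ $$\int_\Sigma\big(\|\nabla\varphi\|_g^2-(Ric(N,N)+\|h^\Sigma\|^2)\varphi^2\big)d\sigma-\int_{\partial\Sigma}\Pi(N,N)\varphi^2d\sigma_{\partial\Sigma}\ge0 .$$ $vol(\Sigma)$ is the $(n-1)$-dimensional volume of $\Sigma$ and $Area(\partial\Sigma)$ the $(n-2)$-dimensional volume of $\partial\Sigma$, both in the induced metric. Yamabe constants and invariants: for a Riemannian metric $g$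 on $\Sigma^{n-1}$ let $R_g$ be its scalar curvature and $\kappa_g$ the mean curvature (trace, with respect to the outward unit normal $\nu$, $\kappa_g=\sum_i\langle\nabla_{e_i}\nu,e_i\rangle$) of $\partial\Sigma$ in $(\Sigma,g)$. For smooth $\varphi>0$ on $\Sigma$ put $$E_g(\varphi)=\int_\Sigma\Big(\tfrac{4(n-2)}{n-3}\|\nabla\varphi\|_g^2+R_g\varphi^2\Big)d\sigma+2\int_{\partial\Sigma}\kappa_g\varphi^2d\sigma_{\partial\Sigma},$$ $$Q^{1,0}_g(\varphi)=\frac{E_g(\varphi)}{\big(\int_\Sigma\varphi^{\frac{2(n-1)}{n-3}}d\sigma\big)^{\frac{n-3}{n-1}}},\qquad Q^{0,1}_g(\varphi)=\frac{E_g(\varphi)}{\big(\int_{\partial\Sigma}\varphi^{\frac{2(n-2)}{n-3}}d\sigma_{\partial\Sigma}\big)^{\frac{n-3}{n-2}}}.$$ For $(a,b)\in\{(1,0),(0,1)\}$ the Yamabe constant is $Q^{a,b}_g(\Sigma,\partial\Sigma)=\inf_{\varphi\in C^\infty(\Sigma),\,\varphi>0}Q_g^{a,b}(\varphi)$ (a conformal invariant, with values in $[-\infty,\infty)$), and the Yamabe invariant is $\sigma^{a,b}(\Sigma,\partial\Sigma)=\sup_{[g]}Q_g^{a,b}(\Sigma,\partial\Sigma)$, the supremum over all conformal classes of Riemannian metrics on $\Sigma$. *)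

theory Defs
  imports "HOL-Analysis.Analysis"
begin

section \<open>Smooth manifolds with boundary\<close>

primrec Ck_on :: "nat \<Rightarrow> 'e::euclidean_space set \<Rightarrow> ('e \<Rightarrow> 'v::real_normed_vector) \<Rightarrow> bool" where
  "Ck_on 0 U F \<longleftrightarrow> continuous_on U F"
| "Ck_on (Suc k) U F \<longleftrightarrow>
     F differentiable_on U \<and> (\<forall>v. Ck_on k U (\<lambda>x. frechet_derivative F (at x) v))"

text \<open>\<^const>\<open>Ck_on\<close> is meant for open sets. On an arbitrary set (here: a relatively open
  subset of a half-space) smoothness means the existence of smooth local extensions.\<close>

definition smooth_on :: "'e::euclidean_space set \<Rightarrow> ('e \<Rightarrow> 'v::real_normed_vector) \<Rightarrow> bool" where
  "smooth_on S F \<longleftrightarrow>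
     (\<forall>x\<in>S. \<exists>W F'. open W \<and> x \<in> W \<and> (\<forall>k. Ck_on k W F') \<and> (\<forall>y\<in>W \<inter> S. F' y = F y))"

text \<open>A manifold is the whole type \<open>'p\<close>, with a (not necessarily maximal) atlas.
  The model is the half-space of \<open>'a \<times> real\<close> where the last coordinate is nonnegative, so the
  dimension of the manifold is \<open>DIM('a \<times> real)\<close>, and its boundary is modelled on \<open>'a\<close>.
  A chart is a pair of a domain and a coordinate map.\<close>

type_synonym ('p, 'e) chart = "'p set \<times> ('p \<Rightarrow> 'e)"

definition half_space :: "('a::euclidean_space \<times> real) set" where
  "half_space = {x. 0 \<le> snd x}"

abbreviation cdom :: "('p, 'e) chart \<Rightarrow> 'p set" where "cdom \<equiv> fst"
abbreviation cmap :: "('p, 'e) chart \<Rightarrow> 'p \<Rightarrow> 'e" where "cmap \<equiv> snd"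

definition cinv :: "('p, 'e) chart \<Rightarrow> 'e \<Rightarrow> 'p" where
  "cinv c = inv_into (cdom c) (cmap c)"

definition smooth_fun ::
  "('p, 'e::euclidean_space) chart set \<Rightarrow> 'p set \<Rightarrow> ('p \<Rightarrow> 'v::real_normed_vector) \<Rightarrow> bool" where
  "smooth_fun A W F \<longleftrightarrow> (\<forall>c\<in>A. smooth_on (cmap c ` (cdom c \<inter> W)) (F \<circ> cinv c))"

definition smooth_atlas ::
  "('p::{t2_space,second_countable_topology}, 'a::euclidean_space \<times> real) chart set \<Rightarrow> bool" where
  "smooth_atlas A \<longleftrightarrow>
     (\<Union>c\<in>A. cdom c) = UNIV \<and>
     (\<forall>c\<in>A. open (cdom c) \<and>
        openin (top_of_set half_space) (cmap c ` cdom c) \<and>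
        homeomorphism (cdom c) (cmap c ` cdom c) (cmap c) (cinv c)) \<and>
     (\<forall>d\<in>A. smooth_fun A (cdom d) (cmap d))"

definition bdry :: "('p, 'a \<times> real) chart set \<Rightarrow> 'p set" where
  "bdry A = {p. \<exists>c\<in>A. p \<in> cdom c \<and> snd (cmap c p) = 0}"

text \<open>\<open>cderiv c F p v\<close> is the derivative of \<open>F\<close> at \<open>p\<close> in the direction with components \<open>v\<close> in the
  chart \<open>c\<close> (one-sided at boundary points). It only depends on \<open>F\<close> near \<open>p\<close>.\<close>

definition cderiv ::
  "('p, 'e::euclidean_space) chart \<Rightarrow> ('p \<Rightarrow> 'v::real_normed_vector) \<Rightarrow> 'p \<Rightarrow> 'e \<Rightarrow> 'v" where
  "cderiv c F p v = frechet_derivative (F \<circ> cinv c) (at (cmap c p) within cmap c ` cdom c) v"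

text \<open>Scalar quantities below are computed in some chart around the point; they do not depend on
  which one.\<close>

definition chart_at :: "('p, 'e) chart set \<Rightarrow> 'p \<Rightarrow> ('p, 'e) chart" where
  "chart_at A p = (SOME c. c \<in> A \<and> p \<in> cdom c)"


section \<open>Riemannian metrics and curvature\<close>

text \<open>Tensors are given by their components in the charts of the atlas together with the
  transformation rule: \<open>G c p v w\<close> is the inner product at \<open>p\<close> of the tangent vectors whose
  components in the chart \<open>c\<close> are \<open>v\<close> and \<open>w\<close>. The value is irrelevant unless \<open>p \<in> cdom c\<close>.\<close>

type_synonym ('p, 'e) metric = "('p, 'e) chart \<Rightarrow> 'p \<Rightarrow> 'e \<Rightarrow> 'e \<Rightarrow> real"

definition riemannian_metric ::
  "('p, 'e::euclidean_space) chart set \<Rightarrow> ('p, 'e) metric \<Rightarrow> bool" where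
  "riemannian_metric A G \<longleftrightarrow>
     (\<forall>c\<in>A. \<forall>p\<in>cdom c. bilinear (G c p) \<and>
        (\<forall>v w. G c p v w = G c p w v) \<and> (\<forall>v. v \<noteq> 0 \<longrightarrow> 0 < G c p v v)) \<and>
     (\<forall>c\<in>A. \<forall>v w. smooth_fun A (cdom c) (\<lambda>p. G c p v w)) \<and>
     (\<forall>c\<in>A. \<forall>d\<in>A. \<forall>p\<in>cdom c \<inter> cdom d. \<forall>v w.
        G c p v w = G d p (cderiv c (cmap d) p v) (cderiv c (cmap d) p w))"

definition onb :: "('e::real_vector \<Rightarrow> 'e \<Rightarrow> real) \<Rightarrow> 'e set \<Rightarrow> 'e set" where
  "onb b W = (SOME E. E \<subseteq> W \<and> span E = W \<and> (\<forall>e\<in>E. \<forall>e'\<in>E. b e e' = (if e = e' then 1 else 0)))"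

text \<open>\<open>christoffel G c p v w\<close> is \<open>\<nabla>\<^sub>V W\<close> at \<open>p\<close> for the Levi-Civita connection and the vector fields
  \<open>V\<close>, \<open>W\<close> with constant components \<open>v\<close>, \<open>w\<close> in the chart \<open>c\<close> (Koszul formula).\<close>

definition christoffel :: "('p, 'e::euclidean_space) metric \<Rightarrow> ('p, 'e) chart \<Rightarrow> 'p \<Rightarrow> 'e \<Rightarrow> 'e \<Rightarrow> 'e" where
  "christoffel G c p v w =
     (THE z. \<forall>u. 2 * G c p z u =
        cderiv c (\<lambda>q. G c q w u) p v + cderiv c (\<lambda>q. G c q v u) p w - cderiv c (\<lambda>q. G c q v w) p u)"

text \<open>\<open>R(u,v)w = \<nabla>\<^sub>u\<nabla>\<^sub>v w - \<nabla>\<^sub>v\<nabla>\<^sub>u w\<close> for fields with constant components.\<close>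

definition riemann ::
  "('p, 'e::euclidean_space) metric \<Rightarrow> ('p, 'e) chart \<Rightarrow> 'p \<Rightarrow> 'e \<Rightarrow> 'e \<Rightarrow> 'e \<Rightarrow> 'e" where
  "riemann G c p u v w =
     cderiv c (\<lambda>q. christoffel G c q v w) p u + christoffel G c p u (christoffel G c p v w)
     - cderiv c (\<lambda>q. christoffel G c q u w) p v - christoffel G c p v (christoffel G c p u w)"

definition ricci ::
  "('p, 'e::euclidean_space) metric \<Rightarrow> ('p, 'e) chart \<Rightarrow> 'p \<Rightarrow> 'e \<Rightarrow> 'e \<Rightarrow> real" where
  "ricci G c p v w = (\<Sum>e\<in>onb (G c p) UNIV. G c p (riemann G c p e v w) e)"

definition scalar_curvature ::
  "('p, 'e::euclidean_space) chart set \<Rightarrow> ('p, 'e) metric \<Rightarrow> 'p \<Rightarrow> real" where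
  "scalar_curvature A G p =
     (let c = chart_at A p in \<Sum>e\<in>onb (G c p) UNIV. ricci G c p e e)"

text \<open>The unit normal, pointing in the direction of decreasing last coordinate, of the level
  set of the last coordinate through \<open>p\<close>. On the boundary this is the outward unit normal. Its
  derivatives in directions tangent to the boundary only depend on its values on the boundary.\<close>

definition outward_normal ::
  "('p, 'a::euclidean_space \<times> real) metric \<Rightarrow> ('p, 'a \<times> real) chart \<Rightarrow> 'p \<Rightarrow> 'a \<times> real" where
  "outward_normal G c p =
     (THE z. snd z < 0 \<and> G c p z z = 1 \<and> (\<forall>v. snd v = 0 \<longrightarrow> G c p z v = 0))"

text \<open>Second fundamental form \<open>\<langle>\<nabla>\<^sub>v Z, w\<rangle>\<close> of the boundary; for \<open>v\<close>, \<open>w\<close> tangent to the boundary,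
  i.e. with last component zero in a chart.\<close>

definition bdry_sff ::
  "('p, 'a::euclidean_space \<times> real) metric \<Rightarrow> ('p, 'a \<times> real) chart \<Rightarrow> 'p
    \<Rightarrow> 'a \<times> real \<Rightarrow> 'a \<times> real \<Rightarrow> real" where
  "bdry_sff G c p v w =
     G c p (cderiv c (outward_normal G c) p v + christoffel G c p v (outward_normal G c p)) w"

definition bdry_mean_curvature ::
  "('p, 'a::euclidean_space \<times> real) chart set \<Rightarrow> ('p, 'a \<times> real) metric \<Rightarrow> 'p \<Rightarrow> real" where
  "bdry_mean_curvature A G p =
     (let c = chart_at A p in \<Sum>e\<in>onb (G c p) {v. snd v = 0}. bdry_sff G c p e e)"

definition grad ::
  "('p, 'e::euclidean_space) metric \<Rightarrow> ('p, 'e) chart \<Rightarrow> ('p \<Rightarrow> real) \<Rightarrow> 'p \<Rightarrow> 'e" where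
  "grad G c \<phi> p = (THE z. \<forall>u. G c p z u = cderiv c \<phi> p u)"

definition grad_norm_sq ::
  "('p, 'e::euclidean_space) chart set \<Rightarrow> ('p, 'e) metric \<Rightarrow> ('p \<Rightarrow> real) \<Rightarrow> 'p \<Rightarrow> real" where
  "grad_norm_sq A G \<phi> p = (let c = chart_at A p in G c p (grad G c \<phi> p) (grad G c \<phi> p))"


section \<open>Volume and boundary volume\<close>

definition gram_det :: "('e \<Rightarrow> 'e \<Rightarrow> real) \<Rightarrow> 'e set \<Rightarrow> real" where
  "gram_det b B = (\<Sum>\<pi> | \<pi> permutes B. of_int (sign \<pi>) * (\<Prod>i\<in>B. b i (\<pi> i)))"

definition chart_volume ::
  "('p, 'e::euclidean_space) metric \<Rightarrow> ('p, 'e) chart \<Rightarrow> 'p set \<Rightarrow> ennreal" where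
  "chart_volume G c B =
     (\<integral>\<^sup>+x\<in>cmap c ` B. ennreal (sqrt (gram_det (G c (cinv c x)) Basis)) \<partial>lborel)"

definition chart_bdry_volume ::
  "('p, 'a::euclidean_space \<times> real) metric \<Rightarrow> ('p, 'a \<times> real) chart \<Rightarrow> 'p set \<Rightarrow> ennreal" where
  "chart_bdry_volume G c B =
     (\<integral>\<^sup>+y\<in>{y. (y, 0) \<in> cmap c ` B}.
        ennreal (sqrt (gram_det (G c (cinv c (y, 0))) ((\<lambda>b. (b, 0)) ` Basis))) \<partial>lborel)"

text \<open>The Borel measure that agrees with \<open>m c\<close> on the Borel subsets of \<open>cdom c\<close>, for every chart
  \<open>c\<close>. It is written as an infimum over countable coverings by pieces contained in charts;
  if, as for the two volumes above, the \<open>m c\<close> are measures that agree on the overlaps of charts, then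
  any partition attains the infimum.\<close>

definition glue_measure ::
  "('p::topological_space, 'e) chart set \<Rightarrow> (('p, 'e) chart \<Rightarrow> 'p set \<Rightarrow> ennreal) \<Rightarrow> 'p measure" where
  "glue_measure A m = measure_of UNIV (sets borel)
     (\<lambda>E. INF (c, B) \<in> {(c, B). (\<forall>k::nat. c k \<in> A \<and> B k \<in> sets borel \<and> B k \<subseteq> cdom (c k)) \<and>
                              E \<subseteq> (\<Union>k. B k)}.
            \<Sum>k. m (c k) (B k))"

definition volume_measure ::
  "('p::topological_space, 'e::euclidean_space) chart set \<Rightarrow> ('p, 'e) metric \<Rightarrow> 'p measure" where
  "volume_measure A G = glue_measure A (chart_volume G)"

text \<open>A measure on the whole manifold, concentrated on the boundary. Integrals are taken over the
  set \<^const>\<open>bdry\<close> explicitly, since boundary curvatures are only meaningful there.\<close>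

definition bdry_measure ::
  "('p::topological_space, 'a::euclidean_space \<times> real) chart set \<Rightarrow> ('p, 'a \<times> real) metric
    \<Rightarrow> 'p measure" where
  "bdry_measure A G = glue_measure A (chart_bdry_volume G)"


section \<open>Immersed hypersurfaces\<close>

text \<open>Throughout, \<open>S\<close> is the atlas of the hypersurface, \<open>A\<close> and \<open>G\<close> are atlas and metric of the
  ambient manifold, and \<open>f\<close> is the immersion.\<close>

definition immersion ::
  "('q::topological_space, 'b::euclidean_space) chart set
    \<Rightarrow> ('p::topological_space, 'a::euclidean_space) chart set \<Rightarrow> ('q \<Rightarrow> 'p) \<Rightarrow> bool" where
  "immersion S A f \<longleftrightarrow>
     continuous_on UNIV f \<and>
     (\<forall>d\<in>A. smooth_fun S (f -` cdom d) (cmap d \<circ> f)) \<and>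
     (\<forall>c\<in>S. \<forall>d\<in>A. \<forall>p\<in>cdom c \<inter> f -` cdom d. inj (cderiv c (cmap d \<circ> f) p))"

definition properly_immersed ::
  "('q::topological_space, 'b::euclidean_space \<times> real) chart set
    \<Rightarrow> ('p::topological_space, 'a::euclidean_space \<times> real) chart set \<Rightarrow> ('q \<Rightarrow> 'p) \<Rightarrow> bool" where
  "properly_immersed S A f \<longleftrightarrow> immersion S A f \<and> range f \<inter> bdry A = f ` bdry S"

definition induced_metric ::
  "('q, 'b::euclidean_space) chart set \<Rightarrow> ('p, 'a::euclidean_space) chart set
    \<Rightarrow> ('p, 'a) metric \<Rightarrow> ('q \<Rightarrow> 'p) \<Rightarrow> ('q, 'b) metric \<Rightarrow> bool" where
  "induced_metric S A G f g \<longleftrightarrow>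
     (\<forall>c\<in>S. \<forall>d\<in>A. \<forall>p\<in>cdom c \<inter> f -` cdom d. \<forall>v w.
        g c p v w = G d (f p) (cderiv c (cmap d \<circ> f) p v) (cderiv c (cmap d \<circ> f) p w))"

text \<open>A global smooth unit normal field; \<open>N d p\<close> are the components in the ambient chart \<open>d\<close> of
  its value at \<open>p\<close>, a tangent vector of the ambient manifold at \<open>f p\<close>.\<close>

definition unit_normal_field ::
  "('q, 'b::euclidean_space) chart set \<Rightarrow> ('p, 'a::euclidean_space) chart set
    \<Rightarrow> ('p, 'a) metric \<Rightarrow> ('q \<Rightarrow> 'p) \<Rightarrow> (('p, 'a) chart \<Rightarrow> 'q \<Rightarrow> 'a) \<Rightarrow> bool" where
  "unit_normal_field S A G f N \<longleftrightarrow>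
     (\<forall>d\<in>A. smooth_fun S (f -` cdom d) (N d)) \<and>
     (\<forall>d\<in>A. \<forall>d'\<in>A. \<forall>p\<in>f -` (cdom d \<inter> cdom d'). N d' p = cderiv d (cmap d') (f p) (N d p)) \<and>
     (\<forall>d\<in>A. \<forall>p\<in>f -` cdom d. G d (f p) (N d p) (N d p) = 1) \<and>
     (\<forall>c\<in>S. \<forall>d\<in>A. \<forall>p\<in>cdom c \<inter> f -` cdom d. \<forall>v.
        G d (f p) (N d p) (cderiv c (cmap d \<circ> f) p v) = 0)"

text \<open>\<open>h(v,w) = \<langle>\<nabla>\<^sub>v N, w\<rangle>\<close>, the connection being pulled back along \<open>f\<close>.\<close>

definition sff ::
  "('p, 'a::euclidean_space) metric \<Rightarrow> ('q \<Rightarrow> 'p) \<Rightarrow> (('p, 'a) chart \<Rightarrow> 'q \<Rightarrow> 'a)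
    \<Rightarrow> ('q, 'b::euclidean_space) chart \<Rightarrow> ('p, 'a) chart \<Rightarrow> 'q \<Rightarrow> 'b \<Rightarrow> 'b \<Rightarrow> real" where
  "sff G f N c d p v w =
     G d (f p)
       (cderiv c (N d) p v + christoffel G d (f p) (cderiv c (cmap d \<circ> f) p v) (N d p))
       (cderiv c (cmap d \<circ> f) p w)"

definition mean_curvature ::
  "('q, 'b::euclidean_space) chart set \<Rightarrow> ('p, 'a::euclidean_space) chart set
    \<Rightarrow> ('p, 'a) metric \<Rightarrow> ('q \<Rightarrow> 'p) \<Rightarrow> ('q, 'b) metric \<Rightarrow> (('p, 'a) chart \<Rightarrow> 'q \<Rightarrow> 'a) \<Rightarrow> 'q \<Rightarrow> real" where
  "mean_curvature S A G f g N p =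
     (let c = chart_at S p; d = chart_at A (f p)
      in \<Sum>e\<in>onb (g c p) UNIV. sff G f N c d p e e)"

definition sff_norm_sq ::
  "('q, 'b::euclidean_space) chart set \<Rightarrow> ('p, 'a::euclidean_space) chart set
    \<Rightarrow> ('p, 'a) metric \<Rightarrow> ('q \<Rightarrow> 'p) \<Rightarrow> ('q, 'b) metric \<Rightarrow> (('p, 'a) chart \<Rightarrow> 'q \<Rightarrow> 'a) \<Rightarrow> 'q \<Rightarrow> real" where
  "sff_norm_sq S A G f g N p =
     (let c = chart_at S p; d = chart_at A (f p); E = onb (g c p) UNIV
      in \<Sum>e\<in>E. \<Sum>e'\<in>E. (sff G f N c d p e e')\<^sup>2)"

definition ricci_normal ::
  "('p, 'a::euclidean_space) chart set \<Rightarrow> ('p, 'a) metric \<Rightarrow> ('q \<Rightarrow> 'p)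
    \<Rightarrow> (('p, 'a) chart \<Rightarrow> 'q \<Rightarrow> 'a) \<Rightarrow> 'q \<Rightarrow> real" where
  "ricci_normal A G f N p = (let d = chart_at A (f p) in ricci G d (f p) (N d p) (N d p))"

definition bdry_sff_normal ::
  "('p, 'a::euclidean_space \<times> real) chart set \<Rightarrow> ('p, 'a \<times> real) metric \<Rightarrow> ('q \<Rightarrow> 'p)
    \<Rightarrow> (('p, 'a \<times> real) chart \<Rightarrow> 'q \<Rightarrow> 'a \<times> real) \<Rightarrow> 'q \<Rightarrow> real" where
  "bdry_sff_normal A G f N p = (let d = chart_at A (f p) in bdry_sff G d (f p) (N d p) (N d p))"

definition minimal ::
  "('q, 'b::euclidean_space) chart set \<Rightarrow> ('p, 'a::euclidean_space) chart set
    \<Rightarrow> ('p, 'a) metric \<Rightarrow> ('q \<Rightarrow> 'p) \<Rightarrow> ('q, 'b) metric \<Rightarrow> (('p, 'a) chart \<Rightarrow> 'q \<Rightarrow> 'a) \<Rightarrow> bool" where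
  "minimal S A G f g N \<longleftrightarrow> (\<forall>p. mean_curvature S A G f g N p = 0)"

text \<open>Orthogonality of two hypersurfaces, expressed by their unit normals.\<close>

definition free_boundary ::
  "('q, 'b::euclidean_space \<times> real) chart set \<Rightarrow> ('p, 'a::euclidean_space \<times> real) chart set
    \<Rightarrow> ('p, 'a \<times> real) metric \<Rightarrow> ('q \<Rightarrow> 'p) \<Rightarrow> (('p, 'a \<times> real) chart \<Rightarrow> 'q \<Rightarrow> 'a \<times> real) \<Rightarrow> bool" where
  "free_boundary S A G f N \<longleftrightarrow>
     (\<forall>p\<in>bdry S. \<forall>d\<in>A. f p \<in> cdom d \<longrightarrow> G d (f p) (N d p) (outward_normal G d (f p)) = 0)"

definition stable_hypersurface ::
  "('q::topological_space, 'b::euclidean_space \<times> real) chart set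
    \<Rightarrow> ('p, 'a::euclidean_space \<times> real) chart set \<Rightarrow> ('p, 'a \<times> real) metric \<Rightarrow> ('q \<Rightarrow> 'p)
    \<Rightarrow> ('q, 'b \<times> real) metric \<Rightarrow> (('p, 'a \<times> real) chart \<Rightarrow> 'q \<Rightarrow> 'a \<times> real) \<Rightarrow> bool" where
  "stable_hypersurface S A G f g N \<longleftrightarrow>
     (\<forall>\<phi>. smooth_fun S UNIV \<phi> \<longrightarrow>
        (LINT p|volume_measure S g.
           grad_norm_sq S g \<phi> p - (ricci_normal A G f N p + sff_norm_sq S A G f g N p) * (\<phi> p)\<^sup>2)
        - (LINT p:bdry S|bdry_measure S g. bdry_sff_normal A G f N p * (\<phi> p)\<^sup>2) \<ge> 0)"


section \<open>Yamabe constants and invariants\<close>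

text \<open>The parameter \<open>n\<close> is the dimension of the ambient manifold, i.e. one more than the
  dimension of the manifold with atlas \<open>S\<close>.\<close>

definition yamabe_energy ::
  "nat \<Rightarrow> ('q::topological_space, 'b::euclidean_space \<times> real) chart set
    \<Rightarrow> ('q, 'b \<times> real) metric \<Rightarrow> ('q \<Rightarrow> real) \<Rightarrow> real" where
  "yamabe_energy n S g \<phi> =
     (LINT p|volume_measure S g.
        4 * (real n - 2) / (real n - 3) * grad_norm_sq S g \<phi> p + scalar_curvature S g p * (\<phi> p)\<^sup>2)
     + 2 * (LINT p:bdry S|bdry_measure S g. bdry_mean_curvature S g p * (\<phi> p)\<^sup>2)"

definition yamabe_quotient_10 ::
  "nat \<Rightarrow> ('q::topological_space, 'b::euclidean_space \<times> real) chart set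
    \<Rightarrow> ('q, 'b \<times> real) metric \<Rightarrow> ('q \<Rightarrow> real) \<Rightarrow> real" where
  "yamabe_quotient_10 n S g \<phi> =
     yamabe_energy n S g \<phi> /
     (LINT p|volume_measure S g. \<phi> p powr (2 * (real n - 1) / (real n - 3)))
       powr ((real n - 3) / (real n - 1))"

definition yamabe_quotient_01 ::
  "nat \<Rightarrow> ('q::topological_space, 'b::euclidean_space \<times> real) chart set
    \<Rightarrow> ('q, 'b \<times> real) metric \<Rightarrow> ('q \<Rightarrow> real) \<Rightarrow> real" where
  "yamabe_quotient_01 n S g \<phi> =
     yamabe_energy n S g \<phi> /
     (LINT p:bdry S|bdry_measure S g. \<phi> p powr (2 * (real n - 2) / (real n - 3)))
       powr ((real n - 3) / (real n - 2))"

definition yamabe_constant_10 ::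
  "nat \<Rightarrow> ('q::topological_space, 'b::euclidean_space \<times> real) chart set
    \<Rightarrow> ('q, 'b \<times> real) metric \<Rightarrow> ereal" where
  "yamabe_constant_10 n S g =
     (INF \<phi> \<in> {\<phi>. smooth_fun S UNIV \<phi> \<and> (\<forall>p. 0 < \<phi> p)}. ereal (yamabe_quotient_10 n S g \<phi>))"

definition yamabe_constant_01 ::
  "nat \<Rightarrow> ('q::topological_space, 'b::euclidean_space \<times> real) chart set
    \<Rightarrow> ('q, 'b \<times> real) metric \<Rightarrow> ereal" where
  "yamabe_constant_01 n S g =
     (INF \<phi> \<in> {\<phi>. smooth_fun S UNIV \<phi> \<and> (\<forall>p. 0 < \<phi> p)}. ereal (yamabe_quotient_01 n S g \<phi>))"

text \<open>The Yamabe constants only depend on the conformal class of the metric, so the supremum over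
  all conformal classes is the supremum over all metrics.\<close>

definition yamabe_invariant_10 ::
  "nat \<Rightarrow> ('q::topological_space, 'b::euclidean_space \<times> real) chart set \<Rightarrow> ereal" where
  "yamabe_invariant_10 n S = (SUP g \<in> {g. riemannian_metric S g}. yamabe_constant_10 n S g)"

definition yamabe_invariant_01 ::
  "nat \<Rightarrow> ('q::topological_space, 'b::euclidean_space \<times> real) chart set \<Rightarrow> ereal" where
  "yamabe_invariant_01 n S = (SUP g \<in> {g. riemannian_metric S g}. yamabe_constant_01 n S g)"

end

theory Submission
  imports Defs
begin

text \<open>Insert a positive function \<open>\<phi>\<close> into the stability inequality. The traced Gauss equation of a minimal
  hypersurface, \<open>R\<^sup>M = R\<^sub>g + |h|\<^sup>2 + 2 Ric(N,N)\<close>, and the splitting \<open>H = \<kappa>\<^sub>g + \<Pi>(N,N)\<close> of the boundary mean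
  curvature along a free boundary turn twice that inequality into
  \<open>E\<^sub>g(\<phi>) \<ge> \<integral> R\<^sup>M \<phi>\<^sup>2 + 2 \<integral>\<^sub>\<partial> H \<phi>\<^sup>2\<close>. The curvature bound and Hoelder's inequality finish the proof.
  All curvatures are computed in charts; that they do not depend on the chart, hence are continuous,
  is the Gauss equation of the identity map, read as an immersion of codimension zero.\<close>

section \<open>Calculus of smooth functions\<close>

text \<open>The factor two comes from \<open>2 Ric(N,N) = R^M - R_g - |h|^2\<close>: after doubling,
  the curvature term of the stability inequality consists of scalar curvatures and a term
  \<open>-|h|^2 \<phi>^2\<close>, which may be discarded. The gradient then has the coefficient 2,
  below the Yamabe coefficient \<open>4(n-2)/(n-3)\<close>. The obstacle is regularity. A Bochner
  integral of a non-integrable function is 0 by convention, so splitting or comparing integrals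
  requires every curvature term to be integrable. Compactness reduces this to continuity, but the
  terms are defined through \<open>THE\<close>, \<open>onb\<close> and \<open>chart_at\<close>,
  which are choices without any regularity. Each is eliminated separately: \<open>THE\<close> by
  Riesz representation, \<open>onb\<close> by independence of traces from the orthonormal basis
  combined with smooth frames, \<open>chart_at\<close> by invariance under transition maps. Of the
  two volumes, the estimates use that they are Borel measures of finite total mass.\<close>

lemma Ck_on_subset: "Ck_on k U F \<Longrightarrow> V \<subseteq> U \<Longrightarrow> Ck_on k V F"
proof (induction k arbitrary: F)
  case 0 then show ?case by (auto intro: continuous_on_subset)
next
  case (Suc k) then show ?case by (auto intro: differentiable_on_subset)
qed

lemma Ck_on_has_derivative:
  assumes "open U" "Ck_on (Suc k) U F" "x \<in> U"
  shows "(F has_derivative frechet_derivative F (at x)) (at x)"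
  using assms by (simp add: differentiable_on_eq_differentiable_at frechet_derivative_works)

lemma Ck_on_cong:
  assumes "open U"
  shows "Ck_on k U F \<Longrightarrow> (\<And>x. x \<in> U \<Longrightarrow> F x = G x) \<Longrightarrow> Ck_on k U G"
proof (induction k arbitrary: F G)
  case 0 then show ?case by (auto cong: continuous_on_cong)
next
  case (Suc k)
  have G: "(G has_derivative frechet_derivative F (at x)) (at x)" if "x \<in> U" for x
    using Ck_on_has_derivative[OF assms Suc.prems(1) that] Suc.prems(2) assms that
    by (metis has_derivative_transform_within_open)
  have "frechet_derivative F (at x) v = frechet_derivative G (at x) v" if "x \<in> U" for x v
    using frechet_derivative_at[OF G[OF that]] by simp
  then have "Ck_on k U (\<lambda>x. frechet_derivative G (at x) v)" for v
    using Suc.IH[of "\<lambda>x. frechet_derivative F (at x) v"] Suc.prems by simp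
  moreover have "G differentiable_on U"
    using G by (auto simp: differentiable_on_def differentiable_def intro: has_derivative_at_withinI)
  ultimately show ?case by simp
qed

text \<open>Derivatives on open sets are unique, so any explicit formula \<open>F'\<close> may stand
  in for \<open>frechet_derivative\<close>. The closure properties below thus reduce to writing down
  a derivative and applying the induction hypothesis to its components.\<close>

lemma Ck_on_SucI:
  assumes "open U" "\<And>x. x \<in> U \<Longrightarrow> (F has_derivative F' x) (at x)"
    and "\<And>v. Ck_on k U (\<lambda>x. F' x v)"
  shows "Ck_on (Suc k) U F"
proof -
  have eq: "F' x v = frechet_derivative F (at x) v" if "x \<in> U" for x v
    using frechet_derivative_at[OF assms(2)[OF that]] by simp
  have "Ck_on k U (\<lambda>x. frechet_derivative F (at x) v)" for v
    by (rule Ck_on_cong[OF assms(1) assms(3)]) (simp add: eq)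
  moreover have "F differentiable_on U"
    using assms(2) by (auto simp: differentiable_on_def differentiable_def intro: has_derivative_at_withinI)
  ultimately show ?thesis by simp
qed

lemma Ck_on_Suc_weaken: "open U \<Longrightarrow> Ck_on (Suc k) U F \<Longrightarrow> Ck_on k U F"
proof (induction k arbitrary: F)
  case 0 then show ?case by (auto intro: differentiable_imp_continuous_on)
next
  case (Suc k)
  then show ?case by auto
qed

lemma Ck_on_const: "Ck_on k U (\<lambda>x. c)"
  by (induction k arbitrary: c) auto

lemma Ck_on_bounded_linear_compose:
  assumes "open U" "bounded_linear L"
  shows "Ck_on k U F \<Longrightarrow> Ck_on k U (\<lambda>x. L (F x))"
proof (induction k arbitrary: F)
  case 0 then show ?case by (auto intro: bounded_linear.continuous_on[OF assms(2)])
next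
  case (Suc k)
  have "((\<lambda>x. L (F x)) has_derivative (\<lambda>v. L (frechet_derivative F (at x) v))) (at x)" if "x \<in> U" for x
    by (rule bounded_linear.has_derivative[OF assms(2) Ck_on_has_derivative[OF assms(1) Suc.prems that]])
  then show ?case
    using Suc by (intro Ck_on_SucI[OF assms(1)]) (auto simp: assms(1))
qed

lemma Ck_on_add:
  assumes "open U"
  shows "Ck_on k U F \<Longrightarrow> Ck_on k U G \<Longrightarrow> Ck_on k U (\<lambda>x. F x + G x)"
proof (induction k arbitrary: F G)
  case 0 then show ?case by (auto intro: continuous_on_add)
next
  case (Suc k)
  have "((\<lambda>x. F x + G x) has_derivative
      (\<lambda>v. frechet_derivative F (at x) v + frechet_derivative G (at x) v)) (at x)" if "x \<in> U" for x
    by (intro has_derivative_add Ck_on_has_derivative[OF assms _ that]) (fact Suc.prems)+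
  then show ?case
    using Suc by (intro Ck_on_SucI[OF assms]) (auto simp: assms(1))
qed

lemma Ck_on_sum:
  assumes "open U" "\<And>i. i \<in> I \<Longrightarrow> Ck_on k U (F i)"
  shows "Ck_on k U (\<lambda>x. \<Sum>i\<in>I. F i x)"
  using assms(2) by (induction I rule: infinite_finite_induct) (auto simp: Ck_on_const Ck_on_add assms(1))

lemma Ck_on_bounded_bilinear:
  assumes "open U" "bounded_bilinear B"
  shows "Ck_on k U F \<Longrightarrow> Ck_on k U G \<Longrightarrow> Ck_on k U (\<lambda>x. B (F x) (G x))"
proof (induction k arbitrary: F G)
  case 0 then show ?case by (auto intro: bounded_bilinear.continuous_on[OF assms(2)])
next
  case (Suc k)
  have "((\<lambda>x. B (F x) (G x)) has_derivative
      (\<lambda>v. B (F x) (frechet_derivative G (at x) v) + B (frechet_derivative F (at x) v) (G x))) (at x)"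
    if "x \<in> U" for x
    by (rule bounded_bilinear.FDERIV[OF assms(2)])
      (auto intro: Ck_on_has_derivative[OF assms(1) _ that] Suc.prems)
  then show ?case
    using Suc Suc.prems[THEN Ck_on_Suc_weaken[OF assms(1)]]
    by (intro Ck_on_SucI[OF assms(1)]) (auto simp: assms(1) intro!: Ck_on_add)
qed

text \<open>\<open>Ck_on\<close> speaks about derivatives in a fixed direction, but the chain rule
  produces the outer derivative in the moving direction \<open>?G x v\<close>. Expanding this
  direction in \<open>Basis\<close> leaves scalar coefficients times derivatives in fixed
  directions, to which the induction hypothesis applies.\<close>

lemma Ck_on_compose:
  fixes G :: "'e::euclidean_space \<Rightarrow> 'f::euclidean_space"
  assumes "open U" "open V" "\<And>x. x \<in> U \<Longrightarrow> G x \<in> V"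
  shows "Ck_on k V F \<Longrightarrow> Ck_on k U G \<Longrightarrow> Ck_on k U (\<lambda>x. F (G x))"
proof (induction k arbitrary: F)
  case 0 then show ?case using assms(3) by (auto intro!: continuous_on_compose2[of V F])
next
  case (Suc k)
  let ?F = "\<lambda>x. frechet_derivative F (at x)"
  let ?G = "\<lambda>x. frechet_derivative G (at x)"
  have der: "((\<lambda>x. F (G x)) has_derivative (\<lambda>v. \<Sum>b\<in>Basis. (?G x v \<bullet> b) *\<^sub>R ?F (G x) b)) (at x)"
    if "x \<in> U" for x
  proof -
    have F: "(F has_derivative ?F (G x)) (at (G x))"
      using Ck_on_has_derivative[OF assms(2) Suc.prems(1)] assms(3) that by auto
    have "(F \<circ> G has_derivative ?F (G x) \<circ> ?G x) (at x)"
      by (rule diff_chain_at[OF Ck_on_has_derivative[OF assms(1) Suc.prems(2) that] F])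
    moreover have "?F (G x) (?G x v) = (\<Sum>b\<in>Basis. (?G x v \<bullet> b) *\<^sub>R ?F (G x) b)" for v
    proof -
      have "linear (?F (G x))" using F by (rule has_derivative_linear)
      then show ?thesis
        by (subst euclidean_representation[of "?G x v", symmetric])
          (simp add: linear_sum linear_cmul del: euclidean_representation)
    qed
    ultimately show ?thesis by (simp add: o_def)
  qed
  have *: "Ck_on k U (\<lambda>x. (?G x v \<bullet> b) *\<^sub>R ?F (G x) b)" for v b
    using Suc.prems Ck_on_Suc_weaken[OF assms(1)]
    by (intro Ck_on_bounded_bilinear[OF assms(1) bounded_bilinear_scaleR]
        Ck_on_bounded_linear_compose[OF assms(1) bounded_linear_inner_left] Suc.IH) auto
  show ?case
    by (rule Ck_on_SucI[OF assms(1) der])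
      (auto intro!: Ck_on_sum[OF assms(1)] * simp: assms(1))
qed

text \<open>A bootstrap: the derivative of the reciprocal is a product of the reciprocal itself and
  the derivative of \<open>F\<close>, so regularity of order \<open>k\<close> of the reciprocal
  yields order \<open>Suc k\<close>. The square root below works in the same way.\<close>

lemma Ck_on_inverse:
  fixes F :: "'e::euclidean_space \<Rightarrow> real"
  assumes "open U" "\<And>x. x \<in> U \<Longrightarrow> F x \<noteq> 0"
  shows "Ck_on k U F \<Longrightarrow> Ck_on k U (\<lambda>x. inverse (F x))"
proof (induction k)
  case 0 then show ?case using assms(2) by (auto intro!: continuous_on_inverse)
next
  case (Suc k)
  have IH: "Ck_on k U (\<lambda>x. inverse (F x))" using Suc Ck_on_Suc_weaken[OF assms(1)] by blast
  have der: "((\<lambda>x. inverse (F x)) has_derivative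
      (\<lambda>v. - (inverse (F x) * frechet_derivative F (at x) v * inverse (F x)))) (at x)"
    if "x \<in> U" for x
    by (rule Deriv.has_derivative_inverse[OF assms(2)[OF that] Ck_on_has_derivative[OF assms(1) Suc.prems that]])
  have "Ck_on k U (\<lambda>x. frechet_derivative F (at x) v)" for v
    using Suc.prems by simp
  then have "Ck_on k U (\<lambda>x. inverse (F x) * frechet_derivative F (at x) v * inverse (F x))" for v
    by (intro Ck_on_bounded_bilinear[OF assms(1) bounded_bilinear_mult] IH)
  then have "Ck_on k U (\<lambda>x. - (inverse (F x) * frechet_derivative F (at x) v * inverse (F x)))" for v
    by (rule Ck_on_bounded_linear_compose[OF assms(1) bounded_linear_minus[OF bounded_linear_ident]])
  from Ck_on_SucI[OF assms(1) der this] show ?case .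
qed

lemma Ck_on_sqrt:
  fixes F :: "'e::euclidean_space \<Rightarrow> real"
  assumes "open U" "\<And>x. x \<in> U \<Longrightarrow> F x > 0"
  shows "Ck_on k U F \<Longrightarrow> Ck_on k U (\<lambda>x. sqrt (F x))"
proof (induction k)
  case 0 then show ?case by (auto intro!: continuous_on_real_sqrt)
next
  case (Suc k)
  have IH: "Ck_on k U (\<lambda>x. sqrt (F x))" using Suc Ck_on_Suc_weaken[OF assms(1)] by blast
  have ne: "sqrt (F x) \<noteq> 0" if "x \<in> U" for x using assms(2)[OF that] by simp
  have der: "((\<lambda>x. sqrt (F x)) has_derivative
      (\<lambda>v. frechet_derivative F (at x) v * (inverse (sqrt (F x)) * (1/2)))) (at x)"
    if "x \<in> U" for x
    using has_derivative_real_sqrt[OF assms(2)[OF that] Ck_on_has_derivative[OF assms(1) Suc.prems that]]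
    by (simp add: field_simps)
  have "Ck_on k U (\<lambda>x. inverse (sqrt (F x)))"
    by (rule Ck_on_inverse[OF assms(1) ne IH])
  then have *: "Ck_on k U (\<lambda>x. inverse (sqrt (F x)) * (1/2))"
    by (rule Ck_on_bounded_bilinear[OF assms(1) bounded_bilinear_mult _ Ck_on_const])
  have "Ck_on k U (\<lambda>x. frechet_derivative F (at x) v)" for v
    using Suc.prems by simp
  then have "Ck_on k U (\<lambda>x. frechet_derivative F (at x) v * (inverse (sqrt (F x)) * (1/2)))" for v
    by (rule Ck_on_bounded_bilinear[OF assms(1) bounded_bilinear_mult _ *])
  from Ck_on_SucI[OF assms(1) der this] show ?case .
qed

text \<open>By the mean value theorem the second difference of \<open>F\<close> over a small
  parallelogram is a mixed derivative at some point of it, in either order of differentiation.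
  Continuity of both mixed derivatives then forces equality at \<open>x\<close>. Real values are
  taken because of the mean value theorem; the vector-valued case follows by components.\<close>

lemma Schwarz_symmetry_real:
  fixes F :: "'e::euclidean_space \<Rightarrow> real"
  assumes U: "open U" "x \<in> U" and F: "Ck_on 2 U F"
  shows "frechet_derivative (\<lambda>y. frechet_derivative F (at y) v) (at x) u =
    frechet_derivative (\<lambda>y. frechet_derivative F (at y) u) (at x) v"
proof -
  define D where "D v G y = frechet_derivative G (at y) v" for v :: 'e and G :: "'e \<Rightarrow> real" and y
  have F2: "Ck_on (Suc (Suc 0)) U F" using F by (simp add: numeral_2_eq_2)
  then have F1: "Ck_on (Suc 0) U (D v F)" for v by (simp add: D_def[abs_def])
  have cont: "continuous_on U (D u (D v F))" for u v
    using F1[of v] by (simp add: D_def[abs_def])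
  have line: "((\<lambda>s. G (a + s *\<^sub>R w)) has_real_derivative D w G (a + s *\<^sub>R w)) (at s)"
    if "Ck_on (Suc 0) U G" "a + s *\<^sub>R w \<in> U" for G a w s
  proof -
    have "((\<lambda>s. a + s *\<^sub>R w) has_derivative (\<lambda>h. h *\<^sub>R w)) (at s)"
      by (auto intro!: derivative_eq_intros)
    from diff_chain_at[OF this Ck_on_has_derivative[OF U(1) that]]
    have "((\<lambda>s. G (a + s *\<^sub>R w)) has_derivative
        (\<lambda>h. frechet_derivative G (at (a + s *\<^sub>R w)) (h *\<^sub>R w))) (at s)"
      by (simp add: o_def)
    moreover have "(\<lambda>h. frechet_derivative G (at (a + s *\<^sub>R w)) (h *\<^sub>R w)) = (*) (D w G (a + s *\<^sub>R w))"
    proof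
      fix h
      have "frechet_derivative G (at (a + s *\<^sub>R w)) (h *\<^sub>R w) = h *\<^sub>R D w G (a + s *\<^sub>R w)"
        unfolding D_def
        by (rule linear_cmul[OF has_derivative_linear[OF Ck_on_has_derivative[OF U(1) that]]])
      then show "frechet_derivative G (at (a + s *\<^sub>R w)) (h *\<^sub>R w) = D w G (a + s *\<^sub>R w) * h"
        by (simp only: real_scaleR_def mult.commute)
    qed
    ultimately show ?thesis unfolding has_field_derivative_def by (simp only:)
  qed
  obtain r where r: "r > 0" "ball x r \<subseteq> U" using U open_contains_ball by blast
  \<comment> \<open>\<open>h * c\<close> bounds every displacement within the parallelogram of side
    parameter \<open>h\<close>; the summand 1 makes the bound strict and \<open>c\<close>
    positive.\<close>
  define c where "c = norm u + norm v + 1"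
  have c: "c > 0" by (simp add: c_def add_nonneg_pos)
  have near: "norm (s *\<^sub>R u + t *\<^sub>R v) < h * c" if "0 \<le> s" "s \<le> h" "0 \<le> t" "t \<le> h" "h > 0" for s t h
  proof -
    have "norm (s *\<^sub>R u + t *\<^sub>R v) \<le> s * norm u + t * norm v"
      using that norm_triangle_ineq[of "s *\<^sub>R u" "t *\<^sub>R v"] by simp
    also have "\<dots> \<le> h * norm u + h * norm v" using that by (intro add_mono mult_right_mono) auto
    also have "\<dots> < h * c" using that by (simp add: c_def algebra_simps)
    finally show ?thesis .
  qed
  \<comment> \<open>The mean value theorem is used along \<open>u\<close> for the difference
    \<open>g\<close> of two translates, then along \<open>v\<close> for the derivative obtained. The
    claim is stated for arbitrary \<open>u\<close> and \<open>v\<close> so that they can be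
    exchanged later.\<close>
  have square: "\<exists>s t. 0 \<le> s \<and> s \<le> h \<and> 0 \<le> t \<and> t \<le> h \<and>
      F (x + h *\<^sub>R u + h *\<^sub>R v) - F (x + h *\<^sub>R u) - F (x + h *\<^sub>R v) + F x
        = h * h * D v (D u F) (x + s *\<^sub>R u + t *\<^sub>R v)"
    if h: "h > 0" and inU: "\<And>s t. 0 \<le> s \<Longrightarrow> s \<le> h \<Longrightarrow> 0 \<le> t \<Longrightarrow> t \<le> h \<Longrightarrow> x + s *\<^sub>R u + t *\<^sub>R v \<in> U"
    for h u v
  proof -
    have F1': "Ck_on (Suc 0) U F" using Ck_on_Suc_weaken[OF U(1) F2] .
    define g where "g s = F (x + h *\<^sub>R v + s *\<^sub>R u) - F (x + s *\<^sub>R u)" for s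
    have "(g has_real_derivative D u F (x + h *\<^sub>R v + s *\<^sub>R u) - D u F (x + s *\<^sub>R u)) (at s)"
      if "0 \<le> s" "s \<le> h" for s
      unfolding g_def
    proof (rule DERIV_diff)
      have "x + h *\<^sub>R v + s *\<^sub>R u \<in> U" using inU[of s h] that h by (simp add: add_ac)
      from line[OF F1' this]
      show "((\<lambda>s. F (x + h *\<^sub>R v + s *\<^sub>R u)) has_real_derivative D u F (x + h *\<^sub>R v + s *\<^sub>R u)) (at s)" .
      have "x + s *\<^sub>R u \<in> U" using inU[of s 0] that h by simp
      from line[OF F1' this]
      show "((\<lambda>s. F (x + s *\<^sub>R u)) has_real_derivative D u F (x + s *\<^sub>R u)) (at s)" .
    qed
    from MVT2[OF h this] obtain s where s: "0 < s" "s < h"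
      "g h - g 0 = h * (D u F (x + h *\<^sub>R v + s *\<^sub>R u) - D u F (x + s *\<^sub>R u))"
      by auto
    have F1'': "Ck_on (Suc 0) U (D u F)" using F2 by (simp add: D_def[abs_def])
    have "((\<lambda>t. D u F (x + s *\<^sub>R u + t *\<^sub>R v)) has_real_derivative
        D v (D u F) (x + s *\<^sub>R u + t *\<^sub>R v)) (at t)" if "0 \<le> t" "t \<le> h" for t
      by (rule line[OF F1'']) (use inU[of s t] that s in auto)
    from MVT2[OF h this] obtain t where t: "0 < t" "t < h"
      "D u F (x + s *\<^sub>R u + h *\<^sub>R v) - D u F (x + s *\<^sub>R u) = h * D v (D u F) (x + s *\<^sub>R u + t *\<^sub>R v)"
      by auto
    have "F (x + h *\<^sub>R u + h *\<^sub>R v) - F (x + h *\<^sub>R u) - F (x + h *\<^sub>R v) + F x = g h - g 0"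
      by (simp add: g_def algebra_simps)
    also have "\<dots> = h * h * D v (D u F) (x + s *\<^sub>R u + t *\<^sub>R v)"
      using s(3) t(3) by (simp add: algebra_simps)
    finally show ?thesis using s t by (intro exI[of _ s] exI[of _ t]) auto
  qed
  have "D u (D v F) x = D v (D u F) x"
  proof (rule ccontr)
    assume ne: "D u (D v F) x \<noteq> D v (D u F) x"
    \<comment> \<open>Half the gap, so that two errors below \<open>e\<close> cannot bridge
      it.\<close>
    define e where "e = \<bar>D u (D v F) x - D v (D u F) x\<bar> / 2"
    have e: "e > 0" using ne by (simp add: e_def)
    obtain d1 where d1: "d1 > 0" "\<And>y. y \<in> U \<Longrightarrow> dist y x < d1 \<Longrightarrow> dist (D u (D v F) y) (D u (D v F) x) < e"
      using cont U(2) e unfolding continuous_on_iff by meson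
    obtain d2 where d2: "d2 > 0" "\<And>y. y \<in> U \<Longrightarrow> dist y x < d2 \<Longrightarrow> dist (D v (D u F) y) (D v (D u F) x) < e"
      using cont U(2) e unfolding continuous_on_iff by meson
    \<comment> \<open>Small enough for the parallelogram to stay in the ball inside \<open>U\<close>
      and within both continuity radii.\<close>
    define h where "h = min r (min d1 d2) / c"
    have h: "h > 0" "h * c \<le> r" "h * c \<le> d1" "h * c \<le> d2"
      using c r d1 d2 by (auto simp: h_def)
    have inU: "x + s *\<^sub>R u + t *\<^sub>R v \<in> U" if "0 \<le> s" "s \<le> h" "0 \<le> t" "t \<le> h" for s t
      using near[OF that h(1)] h r by (intro subsetD[OF r(2)]) (auto simp: dist_norm norm_minus_commute algebra_simps)
    obtain s t where st: "0 \<le> s" "s \<le> h" "0 \<le> t" "t \<le> h"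
      "F (x + h *\<^sub>R u + h *\<^sub>R v) - F (x + h *\<^sub>R u) - F (x + h *\<^sub>R v) + F x
        = h * h * D v (D u F) (x + s *\<^sub>R u + t *\<^sub>R v)"
      using square[OF h(1) inU] by blast
    obtain s' t' where st': "0 \<le> s'" "s' \<le> h" "0 \<le> t'" "t' \<le> h"
      "F (x + h *\<^sub>R v + h *\<^sub>R u) - F (x + h *\<^sub>R v) - F (x + h *\<^sub>R u) + F x
        = h * h * D u (D v F) (x + s' *\<^sub>R v + t' *\<^sub>R u)"
    proof -
      have inU': "x + s *\<^sub>R v + t *\<^sub>R u \<in> U" if "0 \<le> s" "s \<le> h" "0 \<le> t" "t \<le> h" for s t
        using inU[OF that(3,4,1,2)] by (simp add: add_ac)
      show ?thesis using square[OF h(1) inU'] that by blast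
    qed
    have eq: "D v (D u F) (x + s *\<^sub>R u + t *\<^sub>R v) = D u (D v F) (x + t' *\<^sub>R u + s' *\<^sub>R v)"
    proof -
      have "h * h * D v (D u F) (x + s *\<^sub>R u + t *\<^sub>R v) = h * h * D u (D v F) (x + s' *\<^sub>R v + t' *\<^sub>R u)"
        unfolding st(5)[symmetric] st'(5)[symmetric] by (simp add: algebra_simps)
      then show ?thesis using h(1) by (simp add: ac_simps)
    qed
    have "dist (D v (D u F) (x + s *\<^sub>R u + t *\<^sub>R v)) (D v (D u F) x) < e"
      using near[OF st(1-4) h(1)] h by (intro d2 inU st) (simp add: dist_norm algebra_simps)
    moreover have "dist (D u (D v F) (x + t' *\<^sub>R u + s' *\<^sub>R v)) (D u (D v F) x) < e"
      using near[OF st'(3,4,1,2) h(1)] h by (intro d1 inU st') (simp add: dist_norm algebra_simps)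
    ultimately have "dist (D u (D v F) x) (D v (D u F) x) < e + e"
      unfolding eq by (metis add.commute dist_commute dist_triangle_less_add)
    then show False by (simp add: e_def dist_real_def)
  qed
  then show ?thesis by (simp add: D_def[abs_def])
qed

lemma frechet_derivative_inner_left:
  assumes "F differentiable (at x)"
  shows "frechet_derivative (\<lambda>y. F y \<bullet> b) (at x) v = frechet_derivative F (at x) v \<bullet> b"
proof -
  have "((\<lambda>y. F y \<bullet> b) has_derivative (\<lambda>v. frechet_derivative F (at x) v \<bullet> b)) (at x)"
    using assms by (intro has_derivative_inner_left) (simp add: frechet_derivative_works[symmetric])
  from frechet_derivative_at[OF this] show ?thesis by metis
qed

lemma Schwarz_symmetry:
  fixes F :: "'e::euclidean_space \<Rightarrow> 'v::euclidean_space"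
  assumes U: "open U" "x \<in> U" and F: "Ck_on 2 U F"
  shows "frechet_derivative (\<lambda>y. frechet_derivative F (at y) v) (at x) u =
    frechet_derivative (\<lambda>y. frechet_derivative F (at y) u) (at x) v"
proof (rule euclidean_eqI)
  fix b :: 'v
  have F2: "Ck_on (Suc (Suc 0)) U F" using F by (simp add: numeral_2_eq_2)
  have d: "F differentiable (at y)" if "y \<in> U" for y
    using F2 U that by (simp add: differentiable_on_eq_differentiable_at)
  have d2: "(\<lambda>y. frechet_derivative F (at y) v) differentiable (at x)" for v
    using F2 U by (simp add: differentiable_on_eq_differentiable_at)
  have *: "frechet_derivative (\<lambda>y. frechet_derivative (\<lambda>y. F y \<bullet> b) (at y) v) (at x) u
      = frechet_derivative (\<lambda>y. frechet_derivative F (at y) v) (at x) u \<bullet> b" for u v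
  proof -
    have "(\<lambda>y. frechet_derivative F (at y) v \<bullet> b) differentiable (at x)"
      by (rule differentiable_inner[OF d2 differentiable_const])
    then have "frechet_derivative (\<lambda>y. frechet_derivative F (at y) v \<bullet> b) (at x)
      = frechet_derivative (\<lambda>y. frechet_derivative (\<lambda>y. F y \<bullet> b) (at y) v) (at x)"
      by (rule frechet_derivative_transform_within_open[OF _ U]) (simp add: frechet_derivative_inner_left d)
    then show ?thesis using frechet_derivative_inner_left[OF d2] by metis
  qed
  have "Ck_on 2 U (\<lambda>y. F y \<bullet> b)"
    using Ck_on_bounded_linear_compose[OF U(1) bounded_linear_inner_left F] .
  from Schwarz_symmetry_real[OF U this]
  show "frechet_derivative (\<lambda>y. frechet_derivative F (at y) v) (at x) u \<bullet> b =
    frechet_derivative (\<lambda>y. frechet_derivative F (at y) u) (at x) v \<bullet> b"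
    by (simp add: *)
qed

section \<open>Smoothness on arbitrary sets through local extensions\<close>

abbreviation extends_at :: "'e::euclidean_space set \<Rightarrow> ('e \<Rightarrow> 'v::real_normed_vector) \<Rightarrow> 'e \<Rightarrow> bool" where
  "extends_at S F x \<equiv> \<exists>W F'. open W \<and> x \<in> W \<and> (\<forall>k. Ck_on k W F') \<and> (\<forall>y\<in>W \<inter> S. F' y = F y)"

lemma smooth_onI:
  assumes "\<And>x. x \<in> S \<Longrightarrow> extends_at S F x"
  shows "smooth_on S F"
  using assms unfolding smooth_on_def by blast

lemma smooth_onE:
  assumes "smooth_on S F" "x \<in> S"
  obtains W F' where "open W" "x \<in> W" "\<And>k. Ck_on k W F'" "\<And>y. y \<in> W \<Longrightarrow> y \<in> S \<Longrightarrow> F' y = F y"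
proof -
  obtain W F' where "open W" "x \<in> W" "\<forall>k. Ck_on k W F'" "\<forall>y\<in>W \<inter> S. F' y = F y"
    using assms unfolding smooth_on_def by blast
  then show thesis using that by blast
qed

lemma smooth_on_subset: "smooth_on S F \<Longrightarrow> T \<subseteq> S \<Longrightarrow> smooth_on T F"
proof (rule smooth_onI)
  fix x assume F: "smooth_on S F" and T: "T \<subseteq> S" and "x \<in> T"
  then have "x \<in> S" by blast
  from smooth_onE[OF F this] obtain W F' where "open W" "x \<in> W" "\<And>k. Ck_on k W F'"
    "\<And>y. y \<in> W \<Longrightarrow> y \<in> S \<Longrightarrow> F' y = F y" by blast
  then show "extends_at T F x"
    using T by (intro exI[of _ W] exI[of _ F']) auto
qed

lemma smooth_on_cong:
  assumes "smooth_on S F" "\<And>x. x \<in> S \<Longrightarrow> F x = G x"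
  shows "smooth_on S G"
proof (rule smooth_onI)
  fix x assume x: "x \<in> S"
  from smooth_onE[OF assms(1) x] obtain W F' where "open W" "x \<in> W" "\<And>k. Ck_on k W F'"
    "\<And>y. y \<in> W \<Longrightarrow> y \<in> S \<Longrightarrow> F' y = F y" by blast
  then show "extends_at S G x"
    using assms(2) by (intro exI[of _ W] exI[of _ F']) auto
qed

lemma smooth_on_local:
  fixes S :: "'e::euclidean_space set"
  assumes "\<And>x. x \<in> S \<Longrightarrow> \<exists>W. open W \<and> x \<in> W \<and> smooth_on (S \<inter> W) F"
  shows "smooth_on S F"
proof (rule smooth_onI)
  fix x assume x: "x \<in> S"
  then obtain W where W: "open W" "x \<in> W" "smooth_on (S \<inter> W) F" using assms by blast
  from smooth_onE[OF W(3)] x W(2) obtain V F' where "open V" "x \<in> V" "\<And>k. Ck_on k V F'"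
    "\<And>y. y \<in> V \<Longrightarrow> y \<in> S \<inter> W \<Longrightarrow> F' y = F y" by blast
  then show "extends_at S F x"
    using W by (intro exI[of _ "V \<inter> W"] exI[of _ F']) (auto intro: Ck_on_subset)
qed

text \<open>\<open>P\<close> is the open set on which the operation \<open>h\<close> is regular,
  such as the nonzero or the positive reals. A local extension \<open>F'\<close> may leave
  \<open>P\<close> away from \<open>S\<close>, so its domain is first shrunk to the preimage of
  \<open>P\<close>.\<close>

lemma smooth_on_unary:
  fixes F :: "'e::euclidean_space \<Rightarrow> 'v::real_normed_vector"
  assumes "smooth_on S F"
    and op: "\<And>(W::'e set) F' k. open W \<Longrightarrow> (\<And>x. x \<in> W \<Longrightarrow> F' x \<in> P) \<Longrightarrow> (\<And>k. Ck_on k W F') \<Longrightarrow> Ck_on k W (\<lambda>x. h (F' x))"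
    and "open P" "\<And>x. x \<in> S \<Longrightarrow> F x \<in> P"
  shows "smooth_on S (\<lambda>x. h (F x))"
proof (rule smooth_onI)
  fix x assume x: "x \<in> S"
  from smooth_onE[OF assms(1) x] obtain W F' where W: "open W" "x \<in> W" "\<And>k. Ck_on k W F'"
    "\<And>y. y \<in> W \<Longrightarrow> y \<in> S \<Longrightarrow> F' y = F y" by blast
  have "continuous_on W F'" using W(3)[of 0] by simp
  then have o: "open (W \<inter> F' -` P)" using W(1) assms(3) continuous_on_open_vimage by (metis inf_commute)
  have "Ck_on k (W \<inter> F' -` P) (\<lambda>x. h (F' x))" for k
    by (rule op[OF o]) (auto intro: Ck_on_subset[OF W(3)])
  then show "extends_at S (\<lambda>y. h (F y)) x"
    using W x assms(4) o by (intro exI[of _ "W \<inter> F' -` P"] exI[of _ "\<lambda>x. h (F' x)"]) auto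
qed

lemma smooth_on_binary:
  fixes F :: "'e::euclidean_space \<Rightarrow> 'v::real_normed_vector" and G :: "'e \<Rightarrow> 'w::real_normed_vector"
  assumes "smooth_on S F" "smooth_on S G"
    and op: "\<And>(W::'e set) F' G' k. open W \<Longrightarrow> (\<And>k. Ck_on k W F') \<Longrightarrow> (\<And>k. Ck_on k W G') \<Longrightarrow> Ck_on k W (\<lambda>x. h (F' x) (G' x))"
  shows "smooth_on S (\<lambda>x. h (F x) (G x))"
proof (rule smooth_onI)
  fix x assume x: "x \<in> S"
  from smooth_onE[OF assms(1) x] obtain W F' where W: "open W" "x \<in> W" "\<And>k. Ck_on k W F'"
    "\<And>y. y \<in> W \<Longrightarrow> y \<in> S \<Longrightarrow> F' y = F y" by blast
  from smooth_onE[OF assms(2) x] obtain V G' where V: "open V" "x \<in> V" "\<And>k. Ck_on k V G'"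
    "\<And>y. y \<in> V \<Longrightarrow> y \<in> S \<Longrightarrow> G' y = G y" by blast
  have o: "open (W \<inter> V)" using W V by auto
  have "Ck_on k (W \<inter> V) (\<lambda>x. h (F' x) (G' x))" for k
    by (rule op[OF o]) (auto intro: Ck_on_subset[OF W(3)] Ck_on_subset[OF V(3)])
  then show "extends_at S (\<lambda>y. h (F y) (G y)) x"
    using W V x o by (intro exI[of _ "W \<inter> V"] exI[of _ "\<lambda>x. h (F' x) (G' x)"]) auto
qed

lemma smooth_on_const: "smooth_on S (\<lambda>x. c)"
  by (rule smooth_onI) (auto intro!: exI[of _ UNIV] Ck_on_const)

lemma smooth_on_bounded_bilinear:
  "bounded_bilinear B \<Longrightarrow> smooth_on S F \<Longrightarrow> smooth_on S G \<Longrightarrow> smooth_on S (\<lambda>x. B (F x) (G x))"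
  by (rule smooth_on_binary) (auto intro: Ck_on_bounded_bilinear)

lemma smooth_on_bounded_linear:
  "bounded_linear L \<Longrightarrow> smooth_on S F \<Longrightarrow> smooth_on S (\<lambda>x. L (F x))"
  by (rule smooth_on_unary[where P=UNIV]) (auto intro: Ck_on_bounded_linear_compose)

lemma smooth_on_add: "smooth_on S F \<Longrightarrow> smooth_on S G \<Longrightarrow> smooth_on S (\<lambda>x. F x + G x)"
  by (rule smooth_on_binary) (auto intro: Ck_on_add)

lemmas smooth_on_scaleR = smooth_on_bounded_bilinear[OF bounded_bilinear_scaleR]
lemmas smooth_on_mult = smooth_on_bounded_bilinear[OF bounded_bilinear_mult]
lemmas smooth_on_inner_left = smooth_on_bounded_linear[OF bounded_linear_inner_left]
lemmas smooth_on_minus = smooth_on_bounded_linear[OF bounded_linear_minus[OF bounded_linear_ident]]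

lemma smooth_on_diff: "smooth_on S F \<Longrightarrow> smooth_on S G \<Longrightarrow> smooth_on S (\<lambda>x. F x - G x)"
  using smooth_on_add[OF _ smooth_on_minus] by fastforce

lemma smooth_on_sum:
  "(\<And>i. i \<in> I \<Longrightarrow> smooth_on S (F i)) \<Longrightarrow> smooth_on S (\<lambda>x. \<Sum>i\<in>I. F i x)"
  by (induction I rule: infinite_finite_induct) (auto simp: smooth_on_const smooth_on_add)

lemma smooth_on_inverse:
  fixes F :: "'e::euclidean_space \<Rightarrow> real"
  assumes "smooth_on S F" "\<And>x. x \<in> S \<Longrightarrow> F x \<noteq> 0"
  shows "smooth_on S (\<lambda>x. inverse (F x))"
  by (rule smooth_on_unary[where P="- {0}", OF assms(1)]) (use assms in \<open>auto intro!: Ck_on_inverse\<close>)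

lemma smooth_on_divide:
  fixes F :: "'e::euclidean_space \<Rightarrow> real"
  assumes "smooth_on S F" "smooth_on S G" "\<And>x. x \<in> S \<Longrightarrow> G x \<noteq> 0"
  shows "smooth_on S (\<lambda>x. F x / G x)"
  using smooth_on_mult[OF assms(1) smooth_on_inverse[OF assms(2,3)]] by (simp add: divide_inverse)

lemma smooth_on_sqrt:
  fixes F :: "'e::euclidean_space \<Rightarrow> real"
  assumes "smooth_on S F" "\<And>x. x \<in> S \<Longrightarrow> F x > 0"
  shows "smooth_on S (\<lambda>x. sqrt (F x))"
  by (rule smooth_on_unary[where P="{0<..}", OF assms(1)]) (use assms in \<open>auto intro!: Ck_on_sqrt\<close>)

lemma smooth_on_compose:
  fixes G :: "'e::euclidean_space \<Rightarrow> 'f::euclidean_space"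
  assumes F: "smooth_on T F" and G: "smooth_on S G" and ST: "\<And>x. x \<in> S \<Longrightarrow> G x \<in> T"
  shows "smooth_on S (\<lambda>x. F (G x))"
proof (rule smooth_onI)
  fix x assume x: "x \<in> S"
  from smooth_onE[OF G x] obtain W G' where W: "open W" "x \<in> W" "\<And>k. Ck_on k W G'"
    "\<And>y. y \<in> W \<Longrightarrow> y \<in> S \<Longrightarrow> G' y = G y" by blast
  from smooth_onE[OF F ST[OF x]] obtain V F' where V: "open V" "G x \<in> V" "\<And>k. Ck_on k V F'"
    "\<And>y. y \<in> V \<Longrightarrow> y \<in> T \<Longrightarrow> F' y = F y" by blast
  have "continuous_on W G'" using W(3)[of 0] by simp
  then have o: "open (W \<inter> G' -` V)" using W(1) V(1) continuous_on_open_vimage by (metis inf_commute)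
  have "Ck_on k (W \<inter> G' -` V) (\<lambda>x. F' (G' x))" for k
    by (rule Ck_on_compose[OF o V(1)]) (auto intro: Ck_on_subset[OF W(3)] V(3))
  then show "extends_at S (\<lambda>y. F (G y)) x"
    using W V x o ST by (intro exI[of _ "W \<inter> G' -` V"] exI[of _ "\<lambda>x. F' (G' x)"]) auto
qed

lemma smooth_on_imp_continuous_on: "smooth_on S F \<Longrightarrow> continuous_on S F"
proof (unfold continuous_on_eq_continuous_within, rule ballI)
  assume F: "smooth_on S F"
  fix x assume x: "x \<in> S"
  from smooth_onE[OF F x] obtain W F' where W: "open W" "x \<in> W" "\<And>k. Ck_on k W F'"
    "\<And>y. y \<in> W \<Longrightarrow> y \<in> S \<Longrightarrow> F' y = F y" by blast
  have "continuous_on W F'" using W(3)[of 0] by simp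
  then have "continuous (at x within S) F'"
    using W(1,2) continuous_at_imp_continuous_at_within continuous_on_eq_continuous_at by blast
  moreover obtain e where e: "e > 0" "ball x e \<subseteq> W" using W open_contains_ball by blast
  ultimately show "continuous (at x within S) F"
    using W(4) x by (intro continuous_transform_within[of x S F' e F]) (auto simp: subset_iff dist_commute)
qed

section \<open>Derivatives on the half-space\<close>

text \<open>At a boundary point of the half-space the derivative of a smooth function is still unique, and
  it is the derivative of any local smooth extension. So all rules of calculus carry over.\<close>

definition pd :: "'a::euclidean_space \<times> real \<Rightarrow> ('a \<times> real \<Rightarrow> 'v::real_normed_vector) \<Rightarrow> 'a \<times> real \<Rightarrow> 'v" where
  "pd v F x = frechet_derivative F (at x within half_space) v"

abbreviation hs_open :: "('a::euclidean_space \<times> real) set \<Rightarrow> bool" where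
  "hs_open \<equiv> openin (top_of_set half_space)"

lemma hs_open_subset: "hs_open U \<Longrightarrow> U \<subseteq> half_space"
  using openin_imp_subset by blast

lemma hs_open_at_within: "hs_open U \<Longrightarrow> x \<in> U \<Longrightarrow> at x within U = at x within half_space"
  unfolding openin_open by (clarify, rule at_within_nhd) auto

text \<open>Uniqueness of a derivative within a set only requires that some arbitrarily small
  nonzero multiple of each basis vector stays in the set. Basis vectors have last coordinate 0 or 1,
  so positive multiples do so even at the boundary.\<close>

lemma pd_unique:
  assumes "x \<in> half_space" "(F has_derivative F') (at x within half_space)"
  shows "pd v F x = F' v"
proof -
  have "frechet_derivative F (at x within half_space) = F'"
  proof (rule frechet_derivative_unique_within[OF _ assms(2)])
    show "(F has_derivative frechet_derivative F (at x within half_space)) (at x within half_space)"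
      using assms(2) differentiableI frechet_derivative_works by blast
    fix i :: "'a \<times> real" and e :: real assume i: "i \<in> Basis" and e: "e > 0"
    have "0 \<le> snd i" using i by (force simp: Basis_prod_def)
    then show "\<exists>d. 0 < \<bar>d\<bar> \<and> \<bar>d\<bar> < e \<and> x + d *\<^sub>R i \<in> half_space"
      using assms(1) e by (intro exI[of _ "e/2"]) (auto simp: half_space_def)
  qed
  then show ?thesis by (simp add: pd_def)
qed

lemma smooth_on_extension:
  assumes "hs_open U" "smooth_on U F" "x \<in> U"
  obtains W F' where "open W" "x \<in> W" "W \<inter> half_space \<subseteq> U" "\<And>k. Ck_on k W F'"
    "\<And>y. y \<in> W \<Longrightarrow> y \<in> half_space \<Longrightarrow> F' y = F y"
    "\<And>y. y \<in> W \<Longrightarrow> y \<in> half_space \<Longrightarrow>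
      (F has_derivative frechet_derivative F' (at y)) (at y within half_space)"
    "\<And>y v. y \<in> W \<Longrightarrow> y \<in> half_space \<Longrightarrow> pd v F y = frechet_derivative F' (at y) v"
proof -
  obtain Q where Q: "open Q" "U = half_space \<inter> Q" using assms(1) openin_open by blast
  from smooth_onE[OF assms(2,3)] obtain W F' where W: "open W" "x \<in> W" "\<And>k. Ck_on k W F'"
    "\<And>y. y \<in> W \<Longrightarrow> y \<in> U \<Longrightarrow> F' y = F y" by blast
  \<comment> \<open>Intersecting with \<open>Q\<close> puts every half-space point of
    \<open>V\<close> into \<open>U\<close>, where \<open>F'\<close> and \<open>F\<close> agree. So
    the two functions share their derivative within the half-space on all of \<open>V\<close>, not
    only at \<open>x\<close>.\<close>
  define V where "V = W \<inter> Q"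
  have V: "open V" "x \<in> V" "V \<inter> half_space \<subseteq> U" "\<And>k. Ck_on k V F'"
    "\<And>y. y \<in> V \<Longrightarrow> y \<in> half_space \<Longrightarrow> F' y = F y"
    using W Q assms(3) unfolding V_def by (blast intro: Ck_on_subset)+
  have der: "(F has_derivative frechet_derivative F' (at y)) (at y within half_space)"
    if y: "y \<in> V" "y \<in> half_space" for y
  proof -
    have "(F' has_derivative frechet_derivative F' (at y)) (at y within half_space)"
      by (rule has_derivative_at_withinI[OF Ck_on_has_derivative[OF V(1) V(4) y(1)]])
    moreover obtain e where e: "e > 0" "ball y e \<subseteq> V" using V(1) y(1) open_contains_ball by blast
    ultimately show ?thesis
      using has_derivative_transform_within[of F' _ y half_space e F] V(5) y
      by (auto simp: dist_commute subset_iff)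
  qed
  then show thesis using that[OF V(1-5)] pd_unique by blast
qed

lemma has_derivative_pd:
  assumes "hs_open U" "smooth_on U F" "x \<in> U"
  shows "(F has_derivative (\<lambda>v. pd v F x)) (at x within half_space)"
proof -
  have x: "x \<in> half_space" using assms hs_open_subset by blast
  from smooth_on_extension[OF assms] obtain F' where
    F: "(F has_derivative F') (at x within half_space)" using x by metis
  have "(\<lambda>v. pd v F x) = F'" using pd_unique[OF x F] by (rule ext)
  then show ?thesis using F by simp
qed

lemma linear_pd: "hs_open U \<Longrightarrow> smooth_on U F \<Longrightarrow> x \<in> U \<Longrightarrow> linear (\<lambda>v. pd v F x)"
  using has_derivative_pd has_derivative_linear by blast

text \<open>The derivative of a local extension is a local extension of the derivative.\<close>

lemma smooth_on_pd:
  assumes "hs_open U" "smooth_on U F"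
  shows "smooth_on U (pd v F)"
proof (rule smooth_onI)
  fix x assume x: "x \<in> U"
  from smooth_on_extension[OF assms x] obtain W F' where
    W: "open W" "x \<in> W" "\<And>k. Ck_on k W F'"
    "\<And>y v. y \<in> W \<Longrightarrow> y \<in> half_space \<Longrightarrow> pd v F y = frechet_derivative F' (at y) v"
    by metis
  have "Ck_on k W (\<lambda>y. frechet_derivative F' (at y) v)" for k using W(3)[of "Suc k"] by (metis Ck_on.simps(2))
  then show "extends_at U (\<lambda>y. pd v F y) x"
    using W hs_open_subset[OF assms(1)]
    by (intro exI[of _ W] exI[of _ "\<lambda>y. frechet_derivative F' (at y) v"]) (metis IntE subsetD)
qed

lemma pd_cong:
  assumes "hs_open U" "x \<in> U" "\<And>y. y \<in> U \<Longrightarrow> F y = G y"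
  shows "pd v F x = pd v G x"
proof -
  obtain Q where Q: "open Q" "U = half_space \<inter> Q" using assms(1) openin_open by blast
  obtain e where e: "e > 0" "ball x e \<subseteq> Q" using Q assms(2) open_contains_ball by blast
  have near: "F y = G y" if "y \<in> half_space" "dist y x < e" for y
    using that e Q assms(3) by (metis IntI dist_commute mem_ball subsetD)
  have x: "x \<in> half_space" using Q assms(2) by simp
  have "(F has_derivative D) (at x within half_space) \<longleftrightarrow> (G has_derivative D) (at x within half_space)" for D
    using has_derivative_transform_within[OF _ e(1) x, of F D G]
      has_derivative_transform_within[OF _ e(1) x, of G D F] near by metis
  then show ?thesis by (simp add: pd_def frechet_derivative_def)
qed

text \<open>Both sides are second derivatives of one extension on the open set \<open>W\<close>,
  where Schwarz's theorem is available.\<close>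

lemma pd_commute:
  fixes F :: "'a::euclidean_space \<times> real \<Rightarrow> 'v::euclidean_space"
  assumes "hs_open U" "smooth_on U F" "x \<in> U"
  shows "pd u (pd v F) x = pd v (pd u F) x"
proof -
  have x: "x \<in> half_space" using assms hs_open_subset by blast
  from smooth_on_extension[OF assms] obtain W F' where
    W: "open W" "x \<in> W" "W \<inter> half_space \<subseteq> U" "\<And>k. Ck_on k W F'"
    "\<And>y v. y \<in> W \<Longrightarrow> y \<in> half_space \<Longrightarrow> pd v F y = frechet_derivative F' (at y) v"
    by metis
  have o: "hs_open (half_space \<inter> W)" using W(1) by (auto simp: openin_open)
  have "pd u (pd v F) x = frechet_derivative (\<lambda>y. frechet_derivative F' (at y) v) (at x) u" for u v
  proof -
    have "Ck_on (Suc 0) W (\<lambda>y. frechet_derivative F' (at y) v)"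
      using W(4)[of "Suc (Suc 0)"] by (metis Ck_on.simps(2))
    from has_derivative_at_withinI[OF Ck_on_has_derivative[OF W(1) this W(2)]]
    have "pd u (\<lambda>y. frechet_derivative F' (at y) v) x
      = frechet_derivative (\<lambda>y. frechet_derivative F' (at y) v) (at x) u"
      by (rule pd_unique[OF x])
    moreover have "pd u (pd v F) x = pd u (\<lambda>y. frechet_derivative F' (at y) v) x"
      by (rule pd_cong[OF o]) (use W x in auto)
    ultimately show ?thesis by simp
  qed
  then show ?thesis using Schwarz_symmetry[OF W(1,2) W(4)[of 2]] by metis
qed

lemma pd_const: "x \<in> half_space \<Longrightarrow> pd v (\<lambda>x. c) x = 0"
  using pd_unique[of x "\<lambda>x. c" "\<lambda>v. 0"] by simp

lemma pd_add:
  assumes "hs_open U" "smooth_on U F" "smooth_on U G" "x \<in> U"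
  shows "pd v (\<lambda>x. F x + G x) x = pd v F x + pd v G x"
  by (rule pd_unique[OF _ has_derivative_add]) (use assms hs_open_subset in \<open>auto intro: has_derivative_pd\<close>)

lemma pd_diff:
  assumes "hs_open U" "smooth_on U F" "smooth_on U G" "x \<in> U"
  shows "pd v (\<lambda>x. F x - G x) x = pd v F x - pd v G x"
  by (rule pd_unique[OF _ has_derivative_diff]) (use assms hs_open_subset in \<open>auto intro: has_derivative_pd\<close>)

lemma pd_bounded_linear:
  assumes "hs_open U" "bounded_linear L" "smooth_on U F" "x \<in> U"
  shows "pd v (\<lambda>x. L (F x)) x = L (pd v F x)"
  by (rule pd_unique[OF _ bounded_linear.has_derivative[OF assms(2)]])
    (use assms hs_open_subset in \<open>auto intro: has_derivative_pd\<close>)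

lemma pd_bounded_bilinear:
  assumes "hs_open U" "bounded_bilinear B" "smooth_on U F" "smooth_on U G" "x \<in> U"
  shows "pd v (\<lambda>x. B (F x) (G x)) x = B (F x) (pd v G x) + B (pd v F x) (G x)"
  by (rule pd_unique[OF _ bounded_bilinear.FDERIV[OF assms(2)]])
    (use assms hs_open_subset in \<open>auto intro: has_derivative_pd\<close>)

lemma pd_sum:
  assumes "hs_open U" "\<And>i. i \<in> I \<Longrightarrow> smooth_on U (F i)" "x \<in> U"
  shows "pd v (\<lambda>x. \<Sum>i\<in>I. F i x) x = (\<Sum>i\<in>I. pd v (F i) x)"
  by (rule pd_unique[OF _ has_derivative_sum]) (use assms hs_open_subset in \<open>auto intro: has_derivative_pd\<close>)

lemma pd_compose:
  fixes F :: "'b::euclidean_space \<times> real \<Rightarrow> 'a::euclidean_space \<times> real"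
  assumes "hs_open U" "smooth_on U F" "hs_open V" "smooth_on V H" "\<And>x. x \<in> U \<Longrightarrow> F x \<in> V" "x \<in> U"
  shows "pd v (\<lambda>x. H (F x)) x = pd (pd v F x) H (F x)"
proof (rule pd_unique)
  show x: "x \<in> half_space" using assms hs_open_subset by blast
  have F: "(F has_derivative (\<lambda>v. pd v F x)) (at x within U)"
    using has_derivative_pd[OF assms(1,2,6)] assms by (simp add: hs_open_at_within)
  have "((\<lambda>x. H (F x)) has_derivative (\<lambda>v. pd (pd v F x) H (F x))) (at x within U)"
  proof (rule has_derivative_in_compose2[OF _ _ assms(6) F, of V H "\<lambda>y v. pd v H y"])
    show "(H has_derivative (\<lambda>v. pd v H y)) (at y within V)" if "y \<in> V" for y
      using has_derivative_pd[OF assms(3,4) that] hs_open_at_within[OF assms(3) that] by simp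
    show "F ` U \<subseteq> V" using assms(5) by blast
  qed
  then show "((\<lambda>x. H (F x)) has_derivative (\<lambda>v. pd (pd v F x) H (F x))) (at x within half_space)"
    using assms by (simp add: hs_open_at_within)
qed

section \<open>Inner products on finite-dimensional spaces\<close>

definition inner_form :: "('e::real_vector \<Rightarrow> 'e \<Rightarrow> real) \<Rightarrow> bool" where
  "inner_form b \<longleftrightarrow> bilinear b \<and> (\<forall>v w. b v w = b w v) \<and> (\<forall>v. v \<noteq> 0 \<longrightarrow> 0 < b v v)"

definition orthonormal_basis :: "('e::real_vector \<Rightarrow> 'e \<Rightarrow> real) \<Rightarrow> 'e set \<Rightarrow> 'e set \<Rightarrow> bool" where
  "orthonormal_basis b W E \<longleftrightarrow>
     E \<subseteq> W \<and> span E = W \<and> (\<forall>e\<in>E. \<forall>e'\<in>E. b e e' = (if e = e' then 1 else 0))"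

text \<open>The trace of \<open>Q\<close> with respect to \<open>b\<close>, computed in the basis
  selected by \<open>onb\<close>. For an inner form \<open>b\<close> and bilinear \<open>Q\<close>
  any other orthonormal basis of \<open>W\<close> gives the same value, see
  \<open>form_trace_eq\<close>.\<close>

definition form_trace :: "('e::real_vector \<Rightarrow> 'e \<Rightarrow> real) \<Rightarrow> 'e set \<Rightarrow> ('e \<Rightarrow> 'e \<Rightarrow> real) \<Rightarrow> real" where
  "form_trace b W Q = (\<Sum>e\<in>onb b W. Q e e)"

lemma bilinear_linear_left: "bilinear B \<Longrightarrow> linear (\<lambda>x. B x y)"
  and bilinear_linear_right: "bilinear B \<Longrightarrow> linear (B x)"
  by (auto simp: bilinear_def)

lemma bilinear_expand:
  fixes B :: "'e::euclidean_space \<Rightarrow> 'f::euclidean_space \<Rightarrow> 'v::real_vector"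
  assumes "bilinear B"
  shows "B v w = (\<Sum>i\<in>Basis. \<Sum>j\<in>Basis. ((v \<bullet> i) * (w \<bullet> j)) *\<^sub>R B i j)"
proof -
  have l: "B v w = (\<Sum>i\<in>Basis. (v \<bullet> i) *\<^sub>R B i w)" for v w
    using linear_sum[OF bilinear_linear_left[OF assms], of "\<lambda>i. (v \<bullet> i) *\<^sub>R i" Basis w]
    by (simp add: euclidean_representation bilinear_lmul[OF assms])
  have r: "B v w = (\<Sum>j\<in>Basis. (w \<bullet> j) *\<^sub>R B v j)" for v w
    using linear_sum[OF bilinear_linear_right[OF assms], of v "\<lambda>i. (w \<bullet> i) *\<^sub>R i" Basis]
    by (simp add: euclidean_representation bilinear_rmul[OF assms])
  have "B v w = (\<Sum>i\<in>Basis. (v \<bullet> i) *\<^sub>R (\<Sum>j\<in>Basis. (w \<bullet> j) *\<^sub>R B i j))"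
    by (subst l, subst r) (rule refl)
  then show ?thesis by (simp add: scaleR_sum_right)
qed

lemma inner_formD:
  assumes "inner_form b"
  shows "bilinear b" "b v w = b w v" "v \<noteq> 0 \<Longrightarrow> 0 < b v v" "b v v = 0 \<longleftrightarrow> v = 0"
proof -
  show *: "bilinear b" "b v w = b w v" "v \<noteq> 0 \<Longrightarrow> 0 < b v v" for v w
    using assms by (auto simp: inner_form_def)
  show "b v v = 0 \<longleftrightarrow> v = 0" using *(3)[of v] bilinear_lzero[OF *(1)] by force
qed

lemma inner_form_eqI:
  assumes "inner_form b" "\<And>u. b z u = b z' u"
  shows "z = z'"
proof -
  have "b (z - z') (z - z') = 0"
    using assms(2)[of "z - z'"] by (simp add: bilinear_lsub[OF inner_formD(1)[OF assms(1)]])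
  then show ?thesis using inner_formD(4)[OF assms(1)] by auto
qed

lemma orthonormal_basis_finite:
  fixes b :: "'e::euclidean_space \<Rightarrow> 'e \<Rightarrow> real"
  assumes b: "inner_form b" and E: "orthonormal_basis b W E"
  shows "finite E"
proof (rule independent_imp_finite)
  have on: "\<And>e e'. e \<in> E \<Longrightarrow> e' \<in> E \<Longrightarrow> b e e' = (if e = e' then 1 else 0)"
    using E by (auto simp: orthonormal_basis_def)
  show "independent E"
    unfolding dependent_def
  proof (intro notI, elim bexE)
    fix e assume e: "e \<in> E" "e \<in> span (E - {e})"
    have "b x e = 0" if "x \<in> span (E - {e})" for x
      using linear_eq_0_on_span[OF bilinear_linear_left[OF inner_formD(1)[OF b]] _ that] on e(1) by fastforce
    then show False using e on[of e e] by auto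
  qed
qed

lemma orthonormal_basis_expand:
  fixes b :: "'e::euclidean_space \<Rightarrow> 'e \<Rightarrow> real"
  assumes b: "inner_form b" and E: "orthonormal_basis b W E" and x: "x \<in> W"
  shows "x = (\<Sum>e\<in>E. b x e *\<^sub>R e)"
proof (rule linear_eq_on_span[of "\<lambda>x. x" "\<lambda>x. \<Sum>e\<in>E. b x e *\<^sub>R e" E])
  note bil = inner_formD(1)[OF b]
  show "linear (\<lambda>x. \<Sum>e\<in>E. b x e *\<^sub>R e)"
    by (rule linearI) (simp_all add: bilinear_ladd[OF bil] bilinear_lmul[OF bil] scaleR_add_left
        sum.distrib scaleR_sum_right)
  show "x \<in> span E" using E x by (simp add: orthonormal_basis_def)
  fix e assume e: "e \<in> E"
  have "(\<Sum>e'\<in>E. b e e' *\<^sub>R e') = (\<Sum>e'\<in>E. if e = e' then e' else 0)"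
    using E e by (intro sum.cong) (auto simp: orthonormal_basis_def)
  also have "\<dots> = e" using e orthonormal_basis_finite[OF b E] by simp
  finally show "e = (\<Sum>e'\<in>E. b e e' *\<^sub>R e')" by simp
qed (auto simp: linear_iff)

text \<open>Expanding one argument of each \<open>Q e e\<close> in the other basis turns both traces
  into the same double sum of \<open>b e e' * Q e e'\<close>.\<close>

lemma trace_orthonormal_basis_unique:
  fixes b :: "'e::euclidean_space \<Rightarrow> 'e \<Rightarrow> real"
  assumes b: "inner_form b" and Q: "bilinear Q"
    and E: "orthonormal_basis b W E" and E': "orthonormal_basis b W E'"
  shows "(\<Sum>e\<in>E. Q e e) = (\<Sum>e\<in>E'. Q e e :: real)"
proof -
  have sub: "E \<subseteq> W" "E' \<subseteq> W" using E E' by (auto simp: orthonormal_basis_def)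
  have "(\<Sum>e\<in>E. Q e e) = (\<Sum>e\<in>E. \<Sum>e'\<in>E'. b e e' * Q e e')"
  proof (rule sum.cong[OF refl])
    fix e assume e: "e \<in> E"
    have "Q e e = Q e (\<Sum>e'\<in>E'. b e e' *\<^sub>R e')"
      by (rule arg_cong[OF orthonormal_basis_expand[OF b E'], of _ "Q e"]) (use e sub in auto)
    also have "\<dots> = (\<Sum>e'\<in>E'. b e e' * Q e e')"
      by (simp add: linear_sum[OF bilinear_linear_right[OF Q]] bilinear_rmul[OF Q])
    finally show "Q e e = (\<Sum>e'\<in>E'. b e e' * Q e e')" .
  qed
  also have "\<dots> = (\<Sum>e'\<in>E'. \<Sum>e\<in>E. b e e' * Q e e')" by (rule sum.swap)
  also have "\<dots> = (\<Sum>e'\<in>E'. Q e' e')"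
  proof (rule sum.cong[OF refl])
    fix e' assume e': "e' \<in> E'"
    have "Q e' e' = Q (\<Sum>e\<in>E. b e' e *\<^sub>R e) e'"
      by (rule arg_cong[OF orthonormal_basis_expand[OF b E], of _ "\<lambda>x. Q x e'"]) (use e' sub in auto)
    also have "\<dots> = (\<Sum>e\<in>E. b e' e * Q e e')"
      by (simp add: linear_sum[OF bilinear_linear_left[OF Q]] bilinear_lmul[OF Q])
    also have "\<dots> = (\<Sum>e\<in>E. b e e' * Q e e')"
      by (rule sum.cong[OF refl]) (metis inner_formD(2)[OF b])
    finally show "(\<Sum>e\<in>E. b e e' * Q e e') = Q e' e'" by (rule sym)
  qed
  finally show ?thesis .
qed

section \<open>Fields of linear and bilinear maps\<close>

text \<open>Smoothness is demanded for constant arguments only, which is the form in which a metric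
  is given in charts. In finite dimension this already implies smoothness for moving arguments, see
  \<open>bilinear_field_smooth\<close>.\<close>

definition bilinear_field ::
  "('a::euclidean_space \<times> real) set \<Rightarrow> ('a \<times> real \<Rightarrow> 'e::euclidean_space \<Rightarrow> 'f::euclidean_space \<Rightarrow> 'v::real_normed_vector) \<Rightarrow> bool" where
  "bilinear_field U \<beta> \<longleftrightarrow> (\<forall>x\<in>U. bilinear (\<beta> x)) \<and> (\<forall>v w. smooth_on U (\<lambda>x. \<beta> x v w))"

definition linear_field ::
  "('a::euclidean_space \<times> real) set \<Rightarrow> ('a \<times> real \<Rightarrow> 'e::euclidean_space \<Rightarrow> 'v::real_normed_vector) \<Rightarrow> bool" where
  "linear_field U T \<longleftrightarrow> (\<forall>x\<in>U. linear (T x)) \<and> (\<forall>v. smooth_on U (\<lambda>x. T x v))"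

definition metric_on :: "('a::euclidean_space \<times> real) set \<Rightarrow> ('a \<times> real \<Rightarrow> 'e::euclidean_space \<Rightarrow> 'e \<Rightarrow> real) \<Rightarrow> bool" where
  "metric_on U \<gamma> \<longleftrightarrow> bilinear_field U \<gamma> \<and> (\<forall>x\<in>U. inner_form (\<gamma> x))"

lemma bilinear_fieldD:
  "bilinear_field U \<beta> \<Longrightarrow> x \<in> U \<Longrightarrow> bilinear (\<beta> x)"
  "bilinear_field U \<beta> \<Longrightarrow> smooth_on U (\<lambda>x. \<beta> x v w)"
  by (auto simp: bilinear_field_def)

lemma metric_onD:
  "metric_on U \<gamma> \<Longrightarrow> bilinear_field U \<gamma>"
  "metric_on U \<gamma> \<Longrightarrow> x \<in> U \<Longrightarrow> inner_form (\<gamma> x)"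
  by (auto simp: metric_on_def)

lemma bilinear_field_smooth:
  assumes \<beta>: "bilinear_field U \<beta>" and X: "smooth_on U X" and Y: "smooth_on U Y"
  shows "smooth_on U (\<lambda>x. \<beta> x (X x) (Y x))"
proof (rule smooth_on_cong)
  show "smooth_on U (\<lambda>x. \<Sum>i\<in>Basis. \<Sum>j\<in>Basis. ((X x \<bullet> i) * (Y x \<bullet> j)) *\<^sub>R \<beta> x i j)"
    by (intro smooth_on_sum smooth_on_scaleR smooth_on_mult smooth_on_inner_left X Y bilinear_fieldD(2)[OF \<beta>])
  show "(\<Sum>i\<in>Basis. \<Sum>j\<in>Basis. ((X x \<bullet> i) * (Y x \<bullet> j)) *\<^sub>R \<beta> x i j) = \<beta> x (X x) (Y x)" if "x \<in> U" for x
    by (rule bilinear_expand[OF bilinear_fieldD(1)[OF \<beta> that], symmetric])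
qed

text \<open>The product rule with three factors: the form and both arguments vary. Expansion in
  \<open>Basis\<close> reduces it to products of scalar functions with the smooth coefficients of
  the form.\<close>

lemma bilinear_field_pd:
  assumes U: "hs_open U" and \<beta>: "bilinear_field U \<beta>" and X: "smooth_on U X" and Y: "smooth_on U Y" and x: "x \<in> U"
  shows "pd u (\<lambda>x. \<beta> x (X x) (Y x)) x
    = pd u (\<lambda>y. \<beta> y (X x) (Y x)) x + \<beta> x (pd u X x) (Y x) + \<beta> x (X x) (pd u Y x)"
proof -
  note bil = bilinear_fieldD(1)[OF \<beta>] and sm = bilinear_fieldD(2)[OF \<beta>]
  have c: "smooth_on U (\<lambda>x. (X x \<bullet> i) * (Y x \<bullet> j))" for i j
    by (intro smooth_on_mult smooth_on_inner_left X Y)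
  have xh: "x \<in> half_space" using U x hs_open_subset by blast
  have pdc: "pd u (\<lambda>x. (X x \<bullet> i) * (Y x \<bullet> j)) x = (X x \<bullet> i) * (pd u Y x \<bullet> j) + (pd u X x \<bullet> i) * (Y x \<bullet> j)" for i j
    by (simp add: pd_bounded_bilinear[OF U bounded_bilinear_mult smooth_on_inner_left[OF X] smooth_on_inner_left[OF Y] x]
        pd_bounded_linear[OF U bounded_linear_inner_left _ x] X Y)
  have "pd u (\<lambda>x. \<beta> x (X x) (Y x)) x = pd u (\<lambda>x. \<Sum>i\<in>Basis. \<Sum>j\<in>Basis. ((X x \<bullet> i) * (Y x \<bullet> j)) *\<^sub>R \<beta> x i j) x"
    by (rule pd_cong[OF U x]) (rule bilinear_expand[OF bil])
  also have "\<dots> = (\<Sum>i\<in>Basis. \<Sum>j\<in>Basis. pd u (\<lambda>x. ((X x \<bullet> i) * (Y x \<bullet> j)) *\<^sub>R \<beta> x i j) x)"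
    by (simp add: pd_sum[OF U _ x] smooth_on_sum smooth_on_scaleR c sm)
  also have "\<dots> = (\<Sum>i\<in>Basis. \<Sum>j\<in>Basis. ((X x \<bullet> i) * (Y x \<bullet> j)) *\<^sub>R pd u (\<lambda>y. \<beta> y i j) x
      + (((X x \<bullet> i) * (pd u Y x \<bullet> j)) *\<^sub>R \<beta> x i j + ((pd u X x \<bullet> i) * (Y x \<bullet> j)) *\<^sub>R \<beta> x i j))"
    by (intro sum.cong refl)
      (simp add: pd_bounded_bilinear[OF U bounded_bilinear_scaleR c sm x] pdc scaleR_add_left)
  also have "\<dots> = (\<Sum>i\<in>Basis. \<Sum>j\<in>Basis. ((X x \<bullet> i) * (Y x \<bullet> j)) *\<^sub>R pd u (\<lambda>y. \<beta> y i j) x)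
      + (\<beta> x (X x) (pd u Y x) + \<beta> x (pd u X x) (Y x))"
    by (simp add: sum.distrib bilinear_expand[OF bil[OF x], symmetric])
  also have "(\<Sum>i\<in>Basis. \<Sum>j\<in>Basis. ((X x \<bullet> i) * (Y x \<bullet> j)) *\<^sub>R pd u (\<lambda>y. \<beta> y i j) x)
      = pd u (\<lambda>y. \<beta> y (X x) (Y x)) x"
  proof -
    have "pd u (\<lambda>y. \<beta> y (X x) (Y x)) x
      = pd u (\<lambda>y. \<Sum>i\<in>Basis. \<Sum>j\<in>Basis. ((X x \<bullet> i) * (Y x \<bullet> j)) *\<^sub>R \<beta> y i j) x"
      by (rule pd_cong[OF U x]) (rule bilinear_expand[OF bil])
    also have "\<dots> = (\<Sum>i\<in>Basis. \<Sum>j\<in>Basis. ((X x \<bullet> i) * (Y x \<bullet> j)) *\<^sub>R pd u (\<lambda>y. \<beta> y i j) x)"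
      by (simp add: pd_sum[OF U _ x] smooth_on_sum smooth_on_bounded_linear[OF bounded_linear_scaleR_right] sm
          pd_bounded_linear[OF U bounded_linear_scaleR_right sm x])
    finally show ?thesis by simp
  qed
  finally show ?thesis by simp
qed

lemma linear_imp_bilinear_scaleR: "linear T \<Longrightarrow> bilinear (\<lambda>v r. r *\<^sub>R T v)" for r :: real
  unfolding bilinear_def
  by (auto simp: linear_iff scaleR_add_left scaleR_add_right)

text \<open>A linear map becomes a bilinear one by letting a real second argument scale the result.
  Inserting the constant 1 there transfers smoothness and product rule from bilinear to linear
  fields.\<close>

lemma linear_field_bilinear:
  "linear_field U T \<Longrightarrow> bilinear_field U (\<lambda>x v r. r *\<^sub>R T x v)" for r :: real
  unfolding linear_field_def bilinear_field_def
  by (auto simp: linear_imp_bilinear_scaleR intro: smooth_on_bounded_linear[OF bounded_linear_scaleR_right])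

lemma linear_field_smooth:
  assumes "linear_field U T" "smooth_on U X"
  shows "smooth_on U (\<lambda>x. T x (X x))"
  using bilinear_field_smooth[OF linear_field_bilinear[OF assms(1)] assms(2) smooth_on_const[of U 1]] by simp

lemma linear_field_pd:
  assumes "hs_open U" "linear_field U T" "smooth_on U X" "x \<in> U"
  shows "pd u (\<lambda>x. T x (X x)) x = pd u (\<lambda>y. T y (X x)) x + T x (pd u X x)"
  using bilinear_field_pd[OF assms(1) linear_field_bilinear[OF assms(2)] assms(3) smooth_on_const[of U 1] assms(4), of u]
    pd_const[of x u "1::real"] hs_open_subset[OF assms(1)] assms(4) by auto

lemma linear_field_pd_map:
  assumes "hs_open U" "smooth_on U F"
  shows "linear_field U (\<lambda>x v. pd v F x)"
  unfolding linear_field_def using linear_pd[OF assms] smooth_on_pd[OF assms] by blast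

lemma bilinear_field_compose:
  assumes "bilinear_field V \<beta>" "smooth_on U F" "\<And>x. x \<in> U \<Longrightarrow> F x \<in> V"
  shows "bilinear_field U (\<lambda>x. \<beta> (F x))"
  unfolding bilinear_field_def
  using assms bilinear_fieldD[OF assms(1)] smooth_on_compose[OF bilinear_fieldD(2)[OF assms(1)] assms(2)] by auto

lemma linear_pd_bilinear_left:
  assumes "hs_open U" "bilinear_field U \<beta>" "x \<in> U"
  shows "linear (\<lambda>v. pd u (\<lambda>y. \<beta> y v w) x)"
proof -
  note bil = bilinear_fieldD(1)[OF assms(2)] and sm = bilinear_fieldD(2)[OF assms(2)]
  note U = assms(1) and x = assms(3)
  show "linear (\<lambda>v. pd u (\<lambda>y. \<beta> y v w) x)"
  proof (rule linearI)
    fix v v' and r :: real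
    have "pd u (\<lambda>y. \<beta> y (v + v') w) x = pd u (\<lambda>y. \<beta> y v w + \<beta> y v' w) x"
      by (rule pd_cong[OF U x]) (simp add: bilinear_ladd[OF bil])
    then show "pd u (\<lambda>y. \<beta> y (v + v') w) x = pd u (\<lambda>y. \<beta> y v w) x + pd u (\<lambda>y. \<beta> y v' w) x"
      by (simp add: pd_add[OF U sm sm x])
    have "pd u (\<lambda>y. \<beta> y (r *\<^sub>R v) w) x = pd u (\<lambda>y. r *\<^sub>R \<beta> y v w) x"
      by (rule pd_cong[OF U x]) (simp add: bilinear_lmul[OF bil])
    then show "pd u (\<lambda>y. \<beta> y (r *\<^sub>R v) w) x = r *\<^sub>R pd u (\<lambda>y. \<beta> y v w) x"
      by (simp add: pd_bounded_linear[OF U bounded_linear_scaleR_right sm x])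
  qed
qed

lemma linear_pd_bilinear:
  assumes "hs_open U" "bilinear_field U \<beta>" "x \<in> U"
  shows "linear (\<lambda>v. pd u (\<lambda>y. \<beta> y v w) x)" "linear (\<lambda>w. pd u (\<lambda>y. \<beta> y v w) x)"
proof -
  have "bilinear_field U (\<lambda>x w v. \<beta> x v w)" using assms(2) by (auto simp: bilinear_field_def bilinear_def)
  then show "linear (\<lambda>v. pd u (\<lambda>y. \<beta> y v w) x)" "linear (\<lambda>w. pd u (\<lambda>y. \<beta> y v w) x)"
    using linear_pd_bilinear_left[OF assms(1) _ assms(3)] assms(2) by blast+
qed

text \<open>Gram--Schmidt without normalisation, so that only divisions occur.\<close>

lemma smooth_orthogonal_frame:
  fixes \<gamma> :: "'a::euclidean_space \<times> real \<Rightarrow> 'e::euclidean_space \<Rightarrow> 'e \<Rightarrow> real"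
  assumes \<gamma>: "metric_on U \<gamma>"
  shows "finite B \<Longrightarrow> independent B \<Longrightarrow> \<exists>e. (\<forall>b\<in>B. smooth_on U (e b)) \<and>
     (\<forall>x\<in>U. (\<forall>b\<in>B. e b x \<noteq> 0) \<and> (\<forall>b\<in>B. \<forall>c\<in>B. b \<noteq> c \<longrightarrow> \<gamma> x (e b x) (e c x) = 0) \<and>
       span ((\<lambda>b. e b x) ` B) = span B)"
proof (induction B rule: finite_induct)
  case empty then show ?case by auto
next
  case (insert a B)
  note bf = metric_onD(1)[OF \<gamma>]
  have ind: "independent B" "a \<notin> span B" using insert.prems insert.hyps independent_insert by metis+
  then obtain e where e: "\<And>b. b \<in> B \<Longrightarrow> smooth_on U (e b)" "\<And>x b. x \<in> U \<Longrightarrow> b \<in> B \<Longrightarrow> e b x \<noteq> 0"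
    "\<And>x b c. x \<in> U \<Longrightarrow> b \<in> B \<Longrightarrow> c \<in> B \<Longrightarrow> b \<noteq> c \<Longrightarrow> \<gamma> x (e b x) (e c x) = 0"
    "\<And>x. x \<in> U \<Longrightarrow> span ((\<lambda>b. e b x) ` B) = span B"
    using insert.IH by metis
  have pos: "\<gamma> x (e b x) (e b x) \<noteq> 0" if "x \<in> U" "b \<in> B" for x b
    using inner_formD(4)[OF metric_onD(2)[OF \<gamma> that(1)]] e(2)[OF that] by simp
  \<comment> \<open>The orthogonal projection of the constant vector \<open>a\<close> onto the span
    of the frame built so far. Since \<open>a\<close> lies outside this span, \<open>a - p x\<close>
    is nonzero.\<close>
  define p where "p x = (\<Sum>b\<in>B. (\<gamma> x a (e b x) / \<gamma> x (e b x) (e b x)) *\<^sub>R e b x)" for x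
  have psm: "smooth_on U p"
    unfolding p_def
    by (intro smooth_on_sum smooth_on_scaleR smooth_on_divide bilinear_field_smooth[OF bf] smooth_on_const e(1) pos)
  have pspan: "p x \<in> span B" if "x \<in> U" for x
    unfolding p_def e(4)[OF that, symmetric] by (intro span_sum span_scale span_base) auto
  have porth: "\<gamma> x (p x) (e c x) = \<gamma> x a (e c x)" if x: "x \<in> U" and c: "c \<in> B" for x c
  proof -
    note bil = bilinear_fieldD(1)[OF bf x]
    have "\<gamma> x (p x) (e c x) = (\<Sum>b\<in>B. \<gamma> x a (e b x) / \<gamma> x (e b x) (e b x) * \<gamma> x (e b x) (e c x))"
      unfolding p_def by (simp add: linear_sum[OF bilinear_linear_left[OF bil]] bilinear_lmul[OF bil])
    also have "\<dots> = (\<Sum>b\<in>B. if b = c then \<gamma> x a (e c x) else 0)"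
      using e(3)[OF x _ c] pos[OF x c] by (intro sum.cong) auto
    finally show ?thesis using insert.hyps c by simp
  qed
  define e' where "e' b x = (if b = a then a - p x else e b x)" for b x
  have e'B: "e' b = e b" if "b \<in> B" for b using that insert.hyps by (auto simp: e'_def)
  have e'a: "e' a = (\<lambda>x. a - p x)" by (auto simp: e'_def)
  show ?case
  proof (intro exI[of _ e'] conjI ballI)
    show "smooth_on U (e' b)" if "b \<in> insert a B" for b
      using that smooth_on_diff[OF smooth_on_const psm, of a] by (auto simp: e'a e'B intro: e(1))
    fix x assume x: "x \<in> U"
    note bil = bilinear_fieldD(1)[OF bf x]
    show "e' b x \<noteq> 0" if "b \<in> insert a B" for b
      using that e(2)[OF x] pspan[OF x] ind(2) by (auto simp: e'a e'B)
    show "b \<noteq> c \<longrightarrow> \<gamma> x (e' b x) (e' c x) = 0" if "b \<in> insert a B" "c \<in> insert a B" for b c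
      using that e(3)[OF x] porth[OF x] inner_formD(2)[OF metric_onD(2)[OF \<gamma> x], of "e b x"]
      by (auto simp: e'a e'B bilinear_lsub[OF bil] bilinear_rsub[OF bil])
    have "span ((\<lambda>b. e' b x) ` insert a B) = span (insert (a - p x) ((\<lambda>b. e b x) ` B))"
      by (simp add: e'a e'B)
    also have "\<dots> = span (insert a B)"
    proof (rule antisym)
      have B: "span B \<subseteq> span (insert a B)" by (rule span_mono) auto
      have "(\<lambda>b. e b x) ` B \<subseteq> span B" using e(4)[OF x] span_superset by metis
      then show "span (insert (a - p x) ((\<lambda>b. e b x) ` B)) \<subseteq> span (insert a B)"
        using B pspan[OF x] by (intro span_minimal insert_subsetI subspace_span span_diff) (auto intro: span_base)
      let ?S = "span (insert (a - p x) ((\<lambda>b. e b x) ` B))"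
      have B': "span B \<subseteq> ?S" unfolding e(4)[OF x, symmetric] by (rule span_mono) auto
      have "(a - p x) + p x \<in> ?S" by (rule span_add) (use B' pspan[OF x] in \<open>auto intro: span_base\<close>)
      then show "span (insert a B) \<subseteq> ?S"
        using B' span_superset[of B] by (intro span_minimal insert_subsetI subspace_span) auto
    qed
    finally show "span ((\<lambda>b. e' b x) ` insert a B) = span (insert a B)" .
  qed
qed

text \<open>Injectivity in the index is recorded so that a sum over the basis at a point can be
  rewritten as a sum over the fixed index set \<open>B\<close>, whose summands are smooth.\<close>

definition orthonormal_frame ::
  "('a::euclidean_space \<times> real \<Rightarrow> 'e::euclidean_space \<Rightarrow> 'e \<Rightarrow> real) \<Rightarrow> ('a \<times> real) set \<Rightarrow> 'e set \<Rightarrow> 'e set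
    \<Rightarrow> ('e \<Rightarrow> 'a \<times> real \<Rightarrow> 'e) \<Rightarrow> bool" where
  "orthonormal_frame \<gamma> U W B e \<longleftrightarrow> (\<forall>b\<in>B. smooth_on U (e b)) \<and>
     (\<forall>x\<in>U. orthonormal_basis (\<gamma> x) W ((\<lambda>b. e b x) ` B) \<and> inj_on (\<lambda>b. e b x) B)"

lemma orthonormal_frameD:
  assumes "orthonormal_frame \<gamma> U W B e"
  shows "b \<in> B \<Longrightarrow> smooth_on U (e b)"
    "x \<in> U \<Longrightarrow> orthonormal_basis (\<gamma> x) W ((\<lambda>b. e b x) ` B)"
    "x \<in> U \<Longrightarrow> inj_on (\<lambda>b. e b x) B"
  using assms by (auto simp: orthonormal_frame_def)

lemma smooth_orthonormal_frame:
  fixes \<gamma> :: "'a::euclidean_space \<times> real \<Rightarrow> 'e::euclidean_space \<Rightarrow> 'e \<Rightarrow> real"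
  assumes \<gamma>: "metric_on U \<gamma>" and W: "subspace W"
  obtains B e where "orthonormal_frame \<gamma> U W B e"
proof -
  obtain B where B: "B \<subseteq> W" "independent B" "W \<subseteq> span B" using basis_exists[of W] by metis
  have W': "span B = W" using B W by (metis span_minimal subset_antisym)
  have fin: "finite B" using B independent_imp_finite by blast
  from smooth_orthogonal_frame[OF \<gamma> fin B(2)] obtain e where e: "\<And>b. b \<in> B \<Longrightarrow> smooth_on U (e b)"
    "\<And>x b. x \<in> U \<Longrightarrow> b \<in> B \<Longrightarrow> e b x \<noteq> 0"
    "\<And>x b c. x \<in> U \<Longrightarrow> b \<in> B \<Longrightarrow> c \<in> B \<Longrightarrow> b \<noteq> c \<Longrightarrow> \<gamma> x (e b x) (e c x) = 0"
    "\<And>x. x \<in> U \<Longrightarrow> span ((\<lambda>b. e b x) ` B) = span B" by metis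
  define r where "r b x = 1 / sqrt (\<gamma> x (e b x) (e b x))" for b x
  have pos: "\<gamma> x (e b x) (e b x) > 0" if "x \<in> U" "b \<in> B" for x b
    using inner_formD(3)[OF metric_onD(2)[OF \<gamma> that(1)] e(2)[OF that]] .
  have rpos: "r b x > 0" if "x \<in> U" "b \<in> B" for x b using pos[OF that] by (simp add: r_def)
  define e' where "e' b x = r b x *\<^sub>R e b x" for b x
  show thesis
  proof (rule that[of B e'], unfold orthonormal_frame_def, intro conjI ballI)
    show "smooth_on U (e' b)" if b: "b \<in> B" for b
    proof -
      have "sqrt (\<gamma> x (e b x) (e b x)) \<noteq> 0" if "x \<in> U" for x using pos[OF that b] by simp
      then show ?thesis unfolding e'_def r_def
        by (intro smooth_on_scaleR smooth_on_divide smooth_on_const smooth_on_sqrt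
            bilinear_field_smooth[OF metric_onD(1)[OF \<gamma>]] e(1)[OF b] pos[OF _ b])
    qed
    fix x assume x: "x \<in> U"
    note bil = bilinear_fieldD(1)[OF metric_onD(1)[OF \<gamma>] x]
    have on: "\<gamma> x (e' b x) (e' c x) = (if b = c then 1 else 0)" if "b \<in> B" "c \<in> B" for b c
      using e(3)[OF x that] pos[OF x that(1)]
      by (auto simp: e'_def bilinear_lmul[OF bil] bilinear_rmul[OF bil] r_def)
    show inj: "inj_on (\<lambda>b. e' b x) B"
      by (rule inj_onI) (metis on zero_neq_one)
    have sp: "span ((\<lambda>b. e' b x) ` B) = W"
    proof -
      have "span ((\<lambda>b. e' b x) ` B) = span ((\<lambda>b. e b x) ` B)"
      proof (intro antisym span_minimal subspace_span image_subsetI)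
        fix b assume b: "b \<in> B"
        show "e' b x \<in> span ((\<lambda>b. e b x) ` B)" unfolding e'_def by (intro span_scale span_base imageI b)
        have "(1 / r b x) *\<^sub>R e' b x \<in> span ((\<lambda>b. e' b x) ` B)" by (intro span_scale span_base imageI b)
        then show "e b x \<in> span ((\<lambda>b. e' b x) ` B)" using rpos[OF x b] by (simp add: e'_def)
      qed
      then show ?thesis using e(4)[OF x] W' by simp
    qed
    then show "orthonormal_basis (\<gamma> x) W ((\<lambda>b. e' b x) ` B)"
      using on inj span_superset[of "(\<lambda>b. e' b x) ` B"]
      by (auto simp: orthonormal_basis_def inj_on_def)
  qed
qed

text \<open>Existence behind the \<open>SOME\<close> in \<open>onb\<close>: the frame lemma applied
  to the constant metric \<open>b\<close> over a one-point set, on which constants are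
  smooth.\<close>

lemma onb_orthonormal_basis:
  fixes b :: "'e::euclidean_space \<Rightarrow> 'e \<Rightarrow> real"
  assumes b: "inner_form b" and W: "subspace W"
  shows "orthonormal_basis b W (onb b W)"
proof -
  have "metric_on {0 :: real \<times> real} (\<lambda>_. b)"
    using b inner_formD(1)[OF b] by (simp add: metric_on_def bilinear_field_def smooth_on_const)
  from smooth_orthonormal_frame[OF this W] obtain E where "orthonormal_basis b W E"
    by (metis orthonormal_frameD(2) singletonI)
  then show ?thesis unfolding onb_def orthonormal_basis_def by (rule someI)
qed

lemma form_trace_eq:
  fixes b :: "'e::euclidean_space \<Rightarrow> 'e \<Rightarrow> real"
  assumes "inner_form b" "bilinear Q" "orthonormal_basis b W E"
  shows "form_trace b W Q = (\<Sum>e\<in>E. Q e e)"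
proof -
  have "subspace W" using assms(3) by (metis orthonormal_basis_def subspace_span)
  then show ?thesis unfolding form_trace_def
    by (intro trace_orthonormal_basis_unique[OF assms(1,2) onb_orthonormal_basis assms(3)] assms)
qed

text \<open>The bases chosen by \<open>onb\<close> need not vary continuously with \<open>x\<close>.
  Independence of the trace from the basis allows them to be replaced by a smooth frame.\<close>

lemma form_trace_smooth:
  fixes \<gamma> :: "'a::euclidean_space \<times> real \<Rightarrow> 'e::euclidean_space \<Rightarrow> 'e \<Rightarrow> real"
  assumes \<gamma>: "metric_on U \<gamma>" and W: "subspace W" and Q: "bilinear_field U Q"
  shows "smooth_on U (\<lambda>x. form_trace (\<gamma> x) W (Q x))"
proof -
  obtain B e where "orthonormal_frame \<gamma> U W B e"
    using smooth_orthonormal_frame[OF \<gamma> W] by blast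
  note e = orthonormal_frameD[OF this]
  show ?thesis
  proof (rule smooth_on_cong)
    show "smooth_on U (\<lambda>x. \<Sum>b\<in>B. Q x (e b x) (e b x))"
      by (intro smooth_on_sum bilinear_field_smooth[OF Q] e(1))
    show "(\<Sum>b\<in>B. Q x (e b x) (e b x)) = form_trace (\<gamma> x) W (Q x)" if x: "x \<in> U" for x
      using form_trace_eq[OF metric_onD(2)[OF \<gamma> x] bilinear_fieldD(1)[OF Q x] e(2)[OF x]]
      by (simp add: sum.reindex[OF e(3)[OF x]])
  qed
qed

text \<open>In a smooth orthonormal frame the coefficients of the representing vector are the values
  of the functional on the frame. This replaces inverting the matrix of the metric.\<close>

lemma riesz_smooth:
  fixes \<gamma> :: "'a::euclidean_space \<times> real \<Rightarrow> 'e::euclidean_space \<Rightarrow> 'e \<Rightarrow> real"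
  assumes \<gamma>: "metric_on U \<gamma>" and l: "\<And>u. smooth_on U (\<lambda>x. l x u)"
    and Z: "\<And>x u. x \<in> U \<Longrightarrow> \<gamma> x (Z x) u = l x u"
  shows "smooth_on U Z"
proof -
  obtain B e where "orthonormal_frame \<gamma> U UNIV B e"
    using smooth_orthonormal_frame[OF \<gamma> subspace_UNIV] by blast
  note e = orthonormal_frameD[OF this]
  have "linear (l x)" if x: "x \<in> U" for x
  proof -
    have "\<gamma> x (Z x) = l x" using Z[OF x] by (rule ext)
    then show ?thesis
      using bilinear_linear_right[OF bilinear_fieldD(1)[OF metric_onD(1)[OF \<gamma>] x], of "Z x"] by simp
  qed
  then have lf: "linear_field U l" using l by (simp add: linear_field_def)
  show ?thesis
  proof (rule smooth_on_cong)
    show "smooth_on U (\<lambda>x. \<Sum>b\<in>B. l x (e b x) *\<^sub>R e b x)"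
      by (intro smooth_on_sum smooth_on_scaleR linear_field_smooth[OF lf] e(1))
    show "(\<Sum>b\<in>B. l x (e b x) *\<^sub>R e b x) = Z x" if x: "x \<in> U" for x
    proof -
      have "Z x = (\<Sum>e\<in>(\<lambda>b. e b x) ` B. \<gamma> x (Z x) e *\<^sub>R e)"
        by (rule orthonormal_basis_expand[OF metric_onD(2)[OF \<gamma> x] e(2)[OF x] UNIV_I])
      also have "\<dots> = (\<Sum>b\<in>B. l x (e b x) *\<^sub>R e b x)"
        by (simp add: sum.reindex[OF e(3)[OF x]] Z[OF x])
      finally show ?thesis by simp
    qed
  qed
qed

lemma riesz_ex1:
  fixes b :: "'e::euclidean_space \<Rightarrow> 'e \<Rightarrow> real"
  assumes b: "inner_form b" and l: "linear l"
  shows "\<exists>!z. \<forall>u. b z u = l u"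
proof -
  note E = onb_orthonormal_basis[OF b subspace_UNIV]
  have "b (\<Sum>e\<in>onb b UNIV. l e *\<^sub>R e) u = l u" for u
  proof -
    have "b (\<Sum>e\<in>onb b UNIV. l e *\<^sub>R e) u = (\<Sum>e\<in>onb b UNIV. l e * b e u)"
      by (simp add: linear_sum[OF bilinear_linear_left[OF inner_formD(1)[OF b]]] bilinear_lmul[OF inner_formD(1)[OF b]])
    also have "\<dots> = l (\<Sum>e\<in>onb b UNIV. b u e *\<^sub>R e)"
      unfolding linear_sum[OF l] linear_cmul[OF l] real_scaleR_def
      by (rule sum.cong[OF refl]) (metis inner_formD(2)[OF b] mult.commute)
    also have "(\<Sum>e\<in>onb b UNIV. b u e *\<^sub>R e) = u"
      by (rule orthonormal_basis_expand[OF b E UNIV_I, symmetric])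
    finally show ?thesis .
  qed
  then show ?thesis using inner_form_eqI[OF b] by (intro ex1I[of _ "\<Sum>e\<in>onb b UNIV. l e *\<^sub>R e"]) auto
qed

text \<open>An isometric linear map is injective and carries orthonormal bases to orthonormal bases
  of the image. The first part serves maps onto the target and the second codimension one, where a
  unit normal \<open>N\<close> completes the basis. \<open>W\<close> is kept general to cover both
  full tangent spaces and tangent spaces of boundaries.\<close>

lemma form_trace_isometry:
  fixes b :: "'e::euclidean_space \<Rightarrow> 'e \<Rightarrow> real" and b' :: "'f::euclidean_space \<Rightarrow> 'f \<Rightarrow> real"
  assumes b: "inner_form b" and b': "inner_form b'" and T: "linear T" and W: "subspace W"
    and iso: "\<And>v w. b v w = b' (T v) (T w)" and Q: "bilinear Q"
  shows "form_trace b' (T ` W) Q = form_trace b W (\<lambda>v w. Q (T v) (T w))"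
    and "b' N N = 1 \<Longrightarrow> (\<And>v. b' N (T v) = 0) \<Longrightarrow> W' = span (insert N (T ` W)) \<Longrightarrow>
      form_trace b' W' Q = form_trace b W (\<lambda>v w. Q (T v) (T w)) + Q N N"
proof -
  have inj: "inj T"
  proof (rule injI)
    fix v w assume "T v = T w"
    then have "b (v - w) (v - w) = 0"
      using iso[of "v - w" "v - w"] bilinear_lzero[OF inner_formD(1)[OF b']] by (simp add: linear_diff[OF T])
    then show "v = w" using inner_formD(4)[OF b] by simp
  qed
  note E = onb_orthonormal_basis[OF b W]
  have on: "\<And>e e'. e \<in> onb b W \<Longrightarrow> e' \<in> onb b W \<Longrightarrow> b' (T e) (T e') = (if e = e' then 1 else 0)"
    using E iso by (simp add: orthonormal_basis_def)
  have sp: "span (T ` onb b W) = T ` W"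
    using E linear_span_image[OF T] by (simp add: orthonormal_basis_def)
  have E': "orthonormal_basis b' (T ` W) (T ` onb b W)"
    unfolding orthonormal_basis_def using on E sp inj by (auto simp: orthonormal_basis_def inj_def)
  have fin: "finite (onb b W)" using orthonormal_basis_finite[OF b E] .
  have re: "(\<Sum>e\<in>T ` onb b W. Q e e) = form_trace b W (\<lambda>v w. Q (T v) (T w))"
    unfolding form_trace_def by (subst sum.reindex) (use inj in \<open>auto simp: inj_on_def inj_def\<close>)
  show "form_trace b' (T ` W) Q = form_trace b W (\<lambda>v w. Q (T v) (T w))"
    using form_trace_eq[OF b' Q E'] re by simp
  assume N: "b' N N = 1" "\<And>v. b' N (T v) = 0" and W': "W' = span (insert N (T ` W))"
  have N': "b' (T v) N = 0" for v using N(2) inner_formD(2)[OF b'] by metis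
  have notin: "N \<notin> T ` onb b W" using N by force
  have "span (insert N (T ` onb b W)) = W'"
    unfolding W'
  proof (intro antisym span_minimal subspace_span insert_subsetI)
    have "T ` W \<subseteq> span (insert N (T ` onb b W))" unfolding sp[symmetric] by (rule span_mono) auto
    then show "T ` W \<subseteq> span (insert N (T ` onb b W))" .
    have "onb b W \<subseteq> W" using E by (simp add: orthonormal_basis_def)
    then show "T ` onb b W \<subseteq> span (insert N (T ` W))" by (auto intro: span_base)
  qed (auto intro: span_base)
  then have "orthonormal_basis b' W' (insert N (T ` onb b W))"
    unfolding orthonormal_basis_def using on N N' notin inj by (auto simp: inj_def intro: span_base)
  from form_trace_eq[OF b' Q this]
  show "form_trace b' W' Q = form_trace b W (\<lambda>v w. Q (T v) (T w)) + Q N N"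
    using notin fin re by simp
qed

section \<open>Riemannian geometry in coordinates\<close>

type_synonym 'a coord_metric = "'a \<times> real \<Rightarrow> 'a \<times> real \<Rightarrow> 'a \<times> real \<Rightarrow> real"

text \<open>This and the next three are the counterparts of \<open>christoffel\<close>,
  \<open>riemann\<close>, \<open>ricci\<close> and \<open>scalar_curvature\<close> for a metric read
  in one chart, so that the calculus of \<open>pd\<close> applies to them.\<close>

definition chr ::
  "'a::euclidean_space coord_metric \<Rightarrow> 'a \<times> real \<Rightarrow> 'a \<times> real \<Rightarrow> 'a \<times> real \<Rightarrow> 'a \<times> real" where
  "chr \<gamma> x v w = (THE z. \<forall>u. 2 * \<gamma> x z u =
     pd v (\<lambda>y. \<gamma> y w u) x + pd w (\<lambda>y. \<gamma> y v u) x - pd u (\<lambda>y. \<gamma> y v w) x)"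

definition riem ::
  "'a::euclidean_space coord_metric \<Rightarrow> 'a \<times> real \<Rightarrow> 'a \<times> real \<Rightarrow> 'a \<times> real \<Rightarrow> 'a \<times> real \<Rightarrow> 'a \<times> real" where
  "riem \<gamma> x u v w = pd u (\<lambda>y. chr \<gamma> y v w) x + chr \<gamma> x u (chr \<gamma> x v w)
     - pd v (\<lambda>y. chr \<gamma> y u w) x - chr \<gamma> x v (chr \<gamma> x u w)"

definition ric ::
  "'a::euclidean_space coord_metric \<Rightarrow> 'a \<times> real \<Rightarrow> 'a \<times> real \<Rightarrow> 'a \<times> real \<Rightarrow> real" where
  "ric \<gamma> x v w = form_trace (\<gamma> x) UNIV (\<lambda>e e'. \<gamma> x (riem \<gamma> x e v w) e')"

definition scal ::
  "'a::euclidean_space coord_metric \<Rightarrow> 'a \<times> real \<Rightarrow> real" where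
  "scal \<gamma> x = form_trace (\<gamma> x) UNIV (ric \<gamma> x)"

locale coordinate_metric =
  fixes U :: "('a::euclidean_space \<times> real) set" and \<gamma> :: "'a \<times> real \<Rightarrow> 'a \<times> real \<Rightarrow> 'a \<times> real \<Rightarrow> real"
  assumes hs: "hs_open U" and metric: "metric_on U \<gamma>"
begin

lemmas field = metric_onD(1)[OF metric]
lemmas inner = metric_onD(2)[OF metric]
lemmas bil = bilinear_fieldD(1)[OF field]
lemmas smooth = bilinear_fieldD(2)[OF field]
lemmas symm = inner_formD(2)[OF inner]
lemmas eqI = inner_form_eqI[OF inner]
lemmas field_pd = bilinear_field_pd[OF hs field]

lemma linear_koszul:
  assumes x: "x \<in> U"
  shows "linear (\<lambda>u. pd v (\<lambda>y. \<gamma> y w u) x + pd w (\<lambda>y. \<gamma> y v u) x - pd u (\<lambda>y. \<gamma> y v w) x)"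
    "linear (\<lambda>v. pd v (\<lambda>y. \<gamma> y w u) x + pd w (\<lambda>y. \<gamma> y v u) x - pd u (\<lambda>y. \<gamma> y v w) x)"
    "linear (\<lambda>w. pd v (\<lambda>y. \<gamma> y w u) x + pd w (\<lambda>y. \<gamma> y v u) x - pd u (\<lambda>y. \<gamma> y v w) x)"
  by (intro linear_compose_add linear_compose_sub linear_pd_bilinear[OF hs field x] linear_pd[OF hs smooth x])+

text \<open>The right-hand side of the Koszul formula is linear in \<open>u\<close>, so Riesz
  representation provides the unique vector that \<open>THE\<close> asks for.\<close>

lemma chr_spec:
  assumes x: "x \<in> U"
  shows "2 * \<gamma> x (chr \<gamma> x v w) u =
    pd v (\<lambda>y. \<gamma> y w u) x + pd w (\<lambda>y. \<gamma> y v u) x - pd u (\<lambda>y. \<gamma> y v w) x"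
proof -
  let ?l = "\<lambda>u. (pd v (\<lambda>y. \<gamma> y w u) x + pd w (\<lambda>y. \<gamma> y v u) x - pd u (\<lambda>y. \<gamma> y v w) x) / 2"
  have "linear ?l"
    using linear_compose[OF linear_koszul(1)[OF x, of v w] bounded_linear.linear[OF bounded_linear_divide[of 2]]]
    by (simp add: o_def)
  from riesz_ex1[OF inner[OF x] this] have "\<exists>!z. \<forall>u. 2 * \<gamma> x z u =
    pd v (\<lambda>y. \<gamma> y w u) x + pd w (\<lambda>y. \<gamma> y v u) x - pd u (\<lambda>y. \<gamma> y v w) x"
    by (simp add: field_simps)
  from theI'[OF this] show ?thesis unfolding chr_def by blast
qed

lemma chr_eqI:
  assumes "x \<in> U" "\<And>u. 2 * \<gamma> x z u =
    pd v (\<lambda>y. \<gamma> y w u) x + pd w (\<lambda>y. \<gamma> y v u) x - pd u (\<lambda>y. \<gamma> y v w) x"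
  shows "chr \<gamma> x v w = z"
  by (rule eqI[OF assms(1)]) (use chr_spec[OF assms(1), of v w] assms(2) in \<open>metis mult_cancel_left zero_neq_numeral\<close>)

lemma pd_symm: "x \<in> U \<Longrightarrow> pd u (\<lambda>y. \<gamma> y v w) x = pd u (\<lambda>y. \<gamma> y w v) x"
  by (rule pd_cong[OF hs]) (auto intro: symm)

lemma chr_symm: "x \<in> U \<Longrightarrow> chr \<gamma> x v w = chr \<gamma> x w v"
  by (rule chr_eqI) (simp_all add: chr_spec pd_symm[of x _ w v])

text \<open>Bilinearity is read off the Koszul formula by nondegeneracy of the metric, for the
  second argument by way of \<open>chr_symm\<close>; smoothness comes from
  \<open>riesz_smooth\<close>.\<close>

lemma chr_field: "bilinear_field U (chr \<gamma>)"
  unfolding bilinear_field_def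
proof (intro conjI ballI allI)
  fix x assume x: "x \<in> U"
  have l: "linear (\<lambda>v. 2 * \<gamma> x (chr \<gamma> x v w) u)" for w u
    using linear_koszul(2)[OF x, of w u] by (simp add: chr_spec[OF x])
  have 1: "linear (\<lambda>v. chr \<gamma> x v w)" for w
  proof (rule linearI)
    fix v v' and r :: real
    show "chr \<gamma> x (v + v') w = chr \<gamma> x v w + chr \<gamma> x v' w"
    proof (rule eqI[OF x])
      fix u show "\<gamma> x (chr \<gamma> x (v + v') w) u = \<gamma> x (chr \<gamma> x v w + chr \<gamma> x v' w) u"
        using linear_add[OF l[where w=w and u=u], of v v'] by (simp add: bilinear_ladd[OF bil[OF x]])
    qed
    show "chr \<gamma> x (r *\<^sub>R v) w = r *\<^sub>R chr \<gamma> x v w"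
    proof (rule eqI[OF x])
      fix u show "\<gamma> x (chr \<gamma> x (r *\<^sub>R v) w) u = \<gamma> x (r *\<^sub>R chr \<gamma> x v w) u"
        using linear_cmul[OF l[where w=w and u=u], of r v] by (simp add: bilinear_lmul[OF bil[OF x]])
    qed
  qed
  moreover have "linear (\<lambda>w. chr \<gamma> x v w)" for v
    using 1[of v] by (simp add: chr_symm[OF x, of v])
  ultimately show "bilinear (chr \<gamma> x)" by (simp add: bilinear_def)
next
  fix v w
  show "smooth_on U (\<lambda>x. chr \<gamma> x v w)"
  proof (rule riesz_smooth[OF metric])
    show "smooth_on U (\<lambda>x. (1/2) * (pd v (\<lambda>y. \<gamma> y w u) x + pd w (\<lambda>y. \<gamma> y v u) x - pd u (\<lambda>y. \<gamma> y v w) x))" for u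
      by (intro smooth_on_mult smooth_on_const smooth_on_diff smooth_on_add smooth_on_pd[OF hs smooth])
    show "\<gamma> x (chr \<gamma> x v w) u = (1/2) * (pd v (\<lambda>y. \<gamma> y w u) x + pd w (\<lambda>y. \<gamma> y v u) x - pd u (\<lambda>y. \<gamma> y v w) x)"
      if "x \<in> U" for x u
      using chr_spec[OF that, of v w u] by simp
  qed
qed

lemmas chr_bil = bilinear_fieldD(1)[OF chr_field]
lemmas chr_smooth = bilinear_fieldD(2)[OF chr_field]

text \<open>In the sum of the Koszul formulas for the argument triples \<open>u\<close>,
  \<open>v\<close>, \<open>w\<close> and \<open>u\<close>, \<open>w\<close>, \<open>v\<close> the
  derivatives in the directions \<open>v\<close> and \<open>w\<close> cancel.\<close>

lemma compat:
  assumes x: "x \<in> U"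
  shows "pd u (\<lambda>y. \<gamma> y v w) x = \<gamma> x (chr \<gamma> x u v) w + \<gamma> x v (chr \<gamma> x u w)"
  using chr_spec[OF x, of u v w] chr_spec[OF x, of u w v] symm[OF x, of v "chr \<gamma> x u w"]
    pd_symm[OF x, of u v w] pd_symm[OF x, of v u w] pd_symm[OF x, of w u v]
  by simp

lemma compat_fields:
  assumes x: "x \<in> U" and X: "smooth_on U X" and Y: "smooth_on U Y"
  shows "pd u (\<lambda>y. \<gamma> y (X y) (Y y)) x =
    \<gamma> x (pd u X x + chr \<gamma> x u (X x)) (Y x) + \<gamma> x (X x) (pd u Y x + chr \<gamma> x u (Y x))"
  by (simp add: field_pd[OF X Y x] compat[OF x] bilinear_ladd[OF bil[OF x]] bilinear_radd[OF bil[OF x]])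

text \<open>Metric compatibility moves the derivative of the Christoffel symbol out of the inner
  product and absorbs the quadratic terms. Curvature is thereby expressed through derivatives of
  scalar functions, the form used for skew-symmetry and for the Gauss equation.\<close>

lemma riem_inner:
  assumes x: "x \<in> U"
  shows "\<gamma> x (riem \<gamma> x u v w) z =
    pd u (\<lambda>y. \<gamma> y (chr \<gamma> y v w) z) x - \<gamma> x (chr \<gamma> x v w) (chr \<gamma> x u z)
    - (pd v (\<lambda>y. \<gamma> y (chr \<gamma> y u w) z) x - \<gamma> x (chr \<gamma> x u w) (chr \<gamma> x v z))"
proof -
  have xh: "x \<in> half_space" using hs_open_subset[OF hs] x by blast
  show ?thesis
    using compat_fields[OF x chr_smooth smooth_on_const, of u v w z]
      compat_fields[OF x chr_smooth smooth_on_const, of v u w z]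
    by (simp add: pd_const[OF xh] riem_def bilinear_ladd[OF bil[OF x]] bilinear_lsub[OF bil[OF x]])
qed

lemma riem_antisymm: "riem \<gamma> x u v w = - riem \<gamma> x v u w"
  by (simp add: riem_def)

text \<open>Adding the two sides in the form \<open>riem_inner\<close> leaves the commutator of
  second derivatives of the function \<open>\<gamma> y w z\<close>, which vanishes by
  \<open>pd_commute\<close>.\<close>

lemma riem_skew:
  assumes x: "x \<in> U"
  shows "\<gamma> x (riem \<gamma> x u v w) z = - \<gamma> x (riem \<gamma> x u v z) w"
proof -
  have eq: "pd u (\<lambda>y. \<gamma> y (chr \<gamma> y v w) z) x + pd u (\<lambda>y. \<gamma> y (chr \<gamma> y v z) w) x
      = pd u (pd v (\<lambda>y. \<gamma> y w z)) x" for u v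
  proof -
    have "pd u (\<lambda>y. \<gamma> y (chr \<gamma> y v w) z) x + pd u (\<lambda>y. \<gamma> y (chr \<gamma> y v z) w) x
      = pd u (\<lambda>y. \<gamma> y (chr \<gamma> y v w) z + \<gamma> y (chr \<gamma> y v z) w) x"
      by (rule pd_add[OF hs _ _ x, symmetric]) (intro bilinear_field_smooth[OF field] chr_smooth smooth_on_const)+
    also have "\<dots> = pd u (pd v (\<lambda>y. \<gamma> y w z)) x"
      by (rule pd_cong[OF hs x]) (use compat symm in auto)
    finally show ?thesis .
  qed
  show ?thesis
    using eq[of u v] eq[of v u] pd_commute[OF hs smooth x, of u v w z]
      symm[OF x, of "chr \<gamma> x v w" "chr \<gamma> x u z"] symm[OF x, of "chr \<gamma> x u w" "chr \<gamma> x v z"]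
    by (simp add: riem_inner[OF x])
qed

lemma linear_riem:
  assumes x: "x \<in> U"
  shows "linear (\<lambda>u. riem \<gamma> x u v w)" "linear (\<lambda>v. riem \<gamma> x u v w)" "linear (\<lambda>w. riem \<gamma> x u v w)"
proof -
  have l: "linear (\<lambda>u. chr \<gamma> x u v)" "linear (\<lambda>u. chr \<gamma> x v u)" for v
    by (rule bilinear_linear_left[OF chr_bil[OF x]], rule bilinear_linear_right[OF chr_bil[OF x]])
  note l2 = linear_compose[OF l(1) l(2), unfolded o_def] linear_compose[OF l(2) l(2), unfolded o_def]
  show 1: "linear (\<lambda>u. riem \<gamma> x u v w)" for v w
    unfolding riem_def
    by (intro linear_compose_add linear_compose_sub linear_pd_bilinear[OF hs chr_field x] linear_pd[OF hs chr_smooth x] l l2)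
  show "linear (\<lambda>v. riem \<gamma> x u v w)"
    using linear_compose_neg[OF 1[of u w]] by (simp add: riem_antisymm[of x _ u])
  show "linear (\<lambda>w. riem \<gamma> x u v w)"
    unfolding riem_def
    by (intro linear_compose_add linear_compose_sub linear_pd_bilinear[OF hs chr_field x] l2)
qed

lemma riem_smooth: "smooth_on U (\<lambda>x. riem \<gamma> x u v w)"
  unfolding riem_def
  by (intro smooth_on_add smooth_on_diff smooth_on_pd[OF hs chr_smooth] bilinear_field_smooth[OF chr_field]
      smooth_on_const chr_smooth)

lemma ric_integrand_field: "bilinear_field U (\<lambda>x e e'. \<gamma> x (riem \<gamma> x e v w) e')"
  unfolding bilinear_field_def
proof (intro conjI ballI allI)
  fix x assume x: "x \<in> U"
  show "bilinear (\<lambda>e e'. \<gamma> x (riem \<gamma> x e v w) e')"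
    unfolding bilinear_def
    using linear_compose[OF linear_riem(1)[OF x] bilinear_linear_left[OF bil[OF x]], unfolded o_def]
      bilinear_linear_right[OF bil[OF x]] by auto
qed (intro bilinear_field_smooth[OF field] riem_smooth smooth_on_const)

lemma ric_field: "bilinear_field U (ric \<gamma>)"
  unfolding bilinear_field_def
proof (intro conjI ballI allI)
  fix x assume x: "x \<in> U"
  note L = linear_compose[OF _ bilinear_linear_left[OF bil[OF x]], unfolded o_def]
  show "bilinear (ric \<gamma> x)"
    unfolding bilinear_def ric_def form_trace_def
    by (intro conjI allI linear_compose_sum ballI L linear_riem[OF x])
next
  fix v w show "smooth_on U (\<lambda>x. ric \<gamma> x v w)"
    unfolding ric_def by (rule form_trace_smooth[OF metric subspace_UNIV ric_integrand_field])
qed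

lemma scal_smooth: "smooth_on U (scal \<gamma>)"
  unfolding scal_def by (rule form_trace_smooth[OF metric subspace_UNIV ric_field])

end

text \<open>The codimension is left open, so that hypersurfaces and transition maps between charts
  are instances of the same locale.\<close>

locale isometric_immersion = S: coordinate_metric U \<gamma> + M: coordinate_metric V \<Gamma>
  for U :: "('b::euclidean_space \<times> real) set" and \<gamma>
    and V :: "('a::euclidean_space \<times> real) set" and \<Gamma> +
  fixes F :: "'b \<times> real \<Rightarrow> 'a \<times> real"
  assumes F: "smooth_on U F" and FV: "\<And>x. x \<in> U \<Longrightarrow> F x \<in> V"
    and iso: "\<And>x v w. x \<in> U \<Longrightarrow> \<gamma> x v w = \<Gamma> (F x) (pd v F x) (pd w F x)"
begin

text \<open>The Levi-Civita connection of \<open>\<Gamma>\<close> pulled back along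
  \<open>F\<close>, acting on vector fields along \<open>F\<close>.\<close>

definition nabla :: "'b \<times> real \<Rightarrow> ('b \<times> real \<Rightarrow> 'a \<times> real) \<Rightarrow> 'b \<times> real \<Rightarrow> 'a \<times> real" where
  "nabla u X x = pd u X x + chr \<Gamma> (F x) (pd u F x) (X x)"

lemmas dF_smooth = smooth_on_pd[OF S.hs F]
lemmas pull_metric = bilinear_field_compose[OF M.field F FV]
lemmas pull_chr = bilinear_field_compose[OF M.chr_field F FV]

lemma nabla_smooth: "smooth_on U X \<Longrightarrow> smooth_on U (nabla u X)"
  unfolding nabla_def by (intro smooth_on_add smooth_on_pd[OF S.hs] bilinear_field_smooth[OF pull_chr] dF_smooth)

lemma nabla_compat:
  assumes x: "x \<in> U" and X: "smooth_on U X" and Y: "smooth_on U Y"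
  shows "pd u (\<lambda>y. \<Gamma> (F y) (X y) (Y y)) x = \<Gamma> (F x) (nabla u X x) (Y x) + \<Gamma> (F x) (X x) (nabla u Y x)"
proof -
  note b = M.bil[OF FV[OF x]]
  have "pd u (\<lambda>y. \<Gamma> (F y) v w) x = pd (pd u F x) (\<lambda>z. \<Gamma> z v w) (F x)" for v w
    by (rule pd_compose[OF S.hs F M.hs M.smooth FV x])
  then show ?thesis
    by (simp add: bilinear_field_pd[OF S.hs pull_metric X Y x] M.compat[OF FV[OF x]] nabla_def
        bilinear_ladd[OF b] bilinear_radd[OF b])
qed

text \<open>The pulled-back connection is torsion-free: second derivatives of \<open>F\<close>
  commute and Christoffel symbols are symmetric.\<close>

lemma nabla_symm: "x \<in> U \<Longrightarrow> nabla u (pd v F) x = nabla v (pd u F) x"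
  by (simp add: nabla_def pd_commute[OF S.hs F, of x u v] M.chr_symm[OF FV, of x "pd u F x"])

text \<open>The tangential part of the ambient connection is the Levi-Civita connection of
  \<open>\<gamma>\<close>. Indeed \<open>?T\<close> is symmetric in its first two arguments and
  compatible with the metric, and the Koszul formula is derived from these two properties
  alone.\<close>

lemma nabla_chr:
  assumes x: "x \<in> U"
  shows "\<Gamma> (F x) (nabla u (pd v F) x) (pd w F x) = \<gamma> x (chr \<gamma> x u v) w"
proof -
  let ?T = "\<lambda>u v w. \<Gamma> (F x) (nabla u (pd v F) x) (pd w F x)"
  have eq: "pd u (\<lambda>y. \<gamma> y v w) x = ?T u v w + ?T u w v" for u v w
  proof -
    have "pd u (\<lambda>y. \<gamma> y v w) x = pd u (\<lambda>y. \<Gamma> (F y) (pd v F y) (pd w F y)) x"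
      by (rule pd_cong[OF S.hs x iso])
    also have "\<dots> = ?T u v w + ?T u w v"
      using nabla_compat[OF x dF_smooth[of v] dF_smooth[of w], of u]
        M.symm[OF FV[OF x], of "pd v F x" "nabla u (pd w F) x"] by simp
    finally show ?thesis .
  qed
  show ?thesis
    using S.chr_spec[OF x, of u v w]
    by (simp add: eq nabla_symm[OF x, of v u] nabla_symm[OF x, of w u] nabla_symm[OF x, of w v])
qed

text \<open>The curvature of the pulled-back connection is the ambient curvature on the image
  vectors. Second derivatives of \<open>X\<close> and of \<open>F\<close> drop out by symmetry; the
  remainder is the coordinate expression of \<open>riem\<close>.\<close>

lemma nabla_commutator:
  assumes x: "x \<in> U" and X: "smooth_on U X"
  shows "nabla u (nabla v X) x - nabla v (nabla u X) x = riem \<Gamma> (F x) (pd u F x) (pd v F x) (X x)"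
proof -
  let ?C = "chr \<Gamma> (F x)"
  note b = M.chr_bil[OF FV[OF x]]
  have C: "pd u (\<lambda>y. chr \<Gamma> (F y) v w) x = pd (pd u F x) (\<lambda>z. chr \<Gamma> z v w) (F x)" for u v w
    by (rule pd_compose[OF S.hs F M.hs M.chr_smooth FV x])
  have 1: "pd u (nabla v X) x = pd u (pd v X) x + (pd (pd u F x) (\<lambda>z. chr \<Gamma> z (pd v F x) (X x)) (F x)
      + ?C (pd u (pd v F) x) (X x) + ?C (pd v F x) (pd u X x))" for u v
  proof -
    have "pd u (nabla v X) x = pd u (\<lambda>x. pd v X x + chr \<Gamma> (F x) (pd v F x) (X x)) x"
      by (simp add: nabla_def[abs_def])
    also have "\<dots> = pd u (pd v X) x + pd u (\<lambda>x. chr \<Gamma> (F x) (pd v F x) (X x)) x"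
      by (rule pd_add[OF S.hs _ _ x]) (intro smooth_on_pd[OF S.hs X] bilinear_field_smooth[OF pull_chr] dF_smooth X)+
    finally show ?thesis by (simp add: bilinear_field_pd[OF S.hs pull_chr dF_smooth X x] C)
  qed
  show ?thesis
    unfolding nabla_def[of u "nabla v X"] nabla_def[of v "nabla u X"] 1
    unfolding nabla_def riem_def bilinear_radd[OF b] pd_commute[OF S.hs X x, of u v] pd_commute[OF S.hs F x, of u v]
    by (simp add: algebra_simps)
qed

text \<open>No normal vector is mentioned. Since \<open>chr\<close> is the tangential part of
  \<open>nabla\<close>, each bracketed difference is minus an inner product of two normal parts, so
  the equation is valid in every codimension.\<close>

lemma gauss:
  assumes x: "x \<in> U"
  shows "\<Gamma> (F x) (riem \<Gamma> (F x) (pd u F x) (pd v F x) (pd w F x)) (pd z F x) =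
    \<gamma> x (riem \<gamma> x u v w) z
    + (\<gamma> x (chr \<gamma> x v w) (chr \<gamma> x u z) - \<Gamma> (F x) (nabla v (pd w F) x) (nabla u (pd z F) x))
    - (\<gamma> x (chr \<gamma> x u w) (chr \<gamma> x v z) - \<Gamma> (F x) (nabla u (pd w F) x) (nabla v (pd z F) x))"
proof -
  have 1: "\<Gamma> (F x) (nabla u (nabla v (pd w F)) x) (pd z F x)
    = pd u (\<lambda>y. \<gamma> y (chr \<gamma> y v w) z) x - \<Gamma> (F x) (nabla v (pd w F) x) (nabla u (pd z F) x)" for u v
  proof -
    have "pd u (\<lambda>y. \<gamma> y (chr \<gamma> y v w) z) x = pd u (\<lambda>y. \<Gamma> (F y) (nabla v (pd w F) y) (pd z F y)) x"
      by (rule pd_cong[OF S.hs x]) (simp add: nabla_chr)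
    then show ?thesis using nabla_compat[OF x nabla_smooth[OF dF_smooth] dF_smooth, of u v w z] by simp
  qed
  show ?thesis
    unfolding nabla_commutator[OF x dF_smooth, symmetric] bilinear_lsub[OF M.bil[OF FV[OF x]]] 1
      S.riem_inner[OF x] by simp
qed

lemma linear_dF: "x \<in> U \<Longrightarrow> linear (\<lambda>v. pd v F x)"
  by (rule linear_pd[OF S.hs F])

end

context isometric_immersion
begin

lemma immersion_decompose:
  assumes x: "x \<in> U" and N: "\<Gamma> (F x) N N = 1" "\<And>v. \<Gamma> (F x) N (pd v F x) = 0"
    and sp: "span (insert N (range (\<lambda>v. pd v F x))) = UNIV"
  shows "\<exists>v. y = pd v F x + \<Gamma> (F x) N y *\<^sub>R N"
proof -
  note b = M.bil[OF FV[OF x]]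
  have ra: "span (range (\<lambda>v. pd v F x)) = range (\<lambda>v. pd v F x)"
    using linear_span_image[OF linear_dF[OF x], of UNIV] by simp
  have "y \<in> span (insert N (range (\<lambda>v. pd v F x)))" using sp by simp
  then obtain c v where y: "y - c *\<^sub>R N = pd v F x"
    using ra unfolding span_insert by auto
  then have y': "y = pd v F x + c *\<^sub>R N" by (simp add: algebra_simps)
  then have "\<Gamma> (F x) N y = c" by (simp add: bilinear_radd[OF b] bilinear_rmul[OF b] N)
  then show ?thesis using y' by (intro exI[of _ v]) simp
qed

text \<open>If the differential is onto, there is no normal part; then the correction terms of
  \<open>gauss\<close> cancel and curvature is invariant.\<close>

lemma nabla_tangential:
  assumes x: "x \<in> U" and sp: "range (\<lambda>v. pd v F x) = UNIV"
  shows "nabla u (pd v F) x = pd (chr \<gamma> x u v) F x"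
proof (rule M.eqI[OF FV[OF x]])
  fix y :: "'a \<times> real"
  obtain w where w: "y = pd w F x" using sp by blast
  show "\<Gamma> (F x) (nabla u (pd v F) x) y = \<Gamma> (F x) (pd (chr \<gamma> x u v) F x) y"
    unfolding w nabla_chr[OF x] iso[OF x] ..
qed

lemma gauss_isometry:
  assumes x: "x \<in> U" and sp: "range (\<lambda>v. pd v F x) = UNIV"
  shows "\<Gamma> (F x) (riem \<Gamma> (F x) (pd u F x) (pd v F x) (pd w F x)) (pd z F x) = \<gamma> x (riem \<gamma> x u v w) z"
  unfolding gauss[OF x] nabla_tangential[OF x sp] by (simp add: iso[OF x, symmetric])

lemma ric_isometry:
  assumes x: "x \<in> U" and sp: "range (\<lambda>v. pd v F x) = UNIV"
  shows "ric \<Gamma> (F x) (pd v F x) (pd w F x) = ric \<gamma> x v w"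
  unfolding ric_def
  using form_trace_isometry(1)[OF S.inner[OF x] M.inner[OF FV[OF x]] linear_dF[OF x] subspace_UNIV iso[OF x]
      bilinear_fieldD(1)[OF M.ric_integrand_field FV[OF x]], of "pd v F x" "pd w F x"]
  by (simp add: sp gauss_isometry[OF x sp])

lemma scal_isometry:
  assumes x: "x \<in> U" and sp: "range (\<lambda>v. pd v F x) = UNIV"
  shows "scal \<Gamma> (F x) = scal \<gamma> x"
  unfolding scal_def
  using form_trace_isometry(1)[OF S.inner[OF x] M.inner[OF FV[OF x]] linear_dF[OF x] subspace_UNIV iso[OF x]
      bilinear_fieldD(1)[OF M.ric_field FV[OF x]]]
  by (simp add: sp ric_isometry[OF x sp])

text \<open>The Gauss equation is traced twice over an orthonormal basis consisting of tangent
  vectors and the normal. The mixed terms containing \<open>N x\<close> occur in two places, which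
  produces \<open>2 * ric\<close> in the normal direction.\<close>

lemma scal_hypersurface:
  assumes x: "x \<in> U" and N: "smooth_on U N"
    and N1: "\<And>y. y \<in> U \<Longrightarrow> \<Gamma> (F y) (N y) (N y) = 1"
    and N0: "\<And>y v. y \<in> U \<Longrightarrow> \<Gamma> (F y) (N y) (pd v F y) = 0"
    and sp: "span (insert (N x) (range (\<lambda>v. pd v F x))) = UNIV"
    and h: "\<And>v w. h v w = \<Gamma> (F x) (nabla v N x) (pd w F x)"
  shows "scal \<Gamma> (F x) = scal \<gamma> x - (\<Sum>e\<in>onb (\<gamma> x) UNIV. h e e)\<^sup>2
     + (\<Sum>e\<in>onb (\<gamma> x) UNIV. \<Sum>e'\<in>onb (\<gamma> x) UNIV. (h e e')\<^sup>2) + 2 * ric \<Gamma> (F x) (N x) (N x)"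
proof -
  note y = FV[OF x]
  note b = M.bil[OF y]
  let ?T = "\<lambda>v. pd v F x" and ?E = "onb (\<gamma> x) UNIV" and ?R = "\<lambda>u v w z. \<Gamma> (F x) (riem \<Gamma> (F x) u v w) z"
  have xh: "x \<in> half_space" using hs_open_subset[OF S.hs] x by blast
  \<comment> \<open>Differentiating the orthogonality of \<open>N\<close> and the tangent vector
    \<open>pd w F\<close> identifies \<open>h\<close> with minus the normal component of
    \<open>nabla v (pd w F)\<close>.\<close>
  have hN: "h v w = - \<Gamma> (F x) (N x) (nabla v (pd w F) x)" for v w
  proof -
    have "pd v (\<lambda>y. \<Gamma> (F y) (N y) (pd w F y)) x = pd v (\<lambda>y. 0) x"
      by (rule pd_cong[OF S.hs x]) (simp add: N0)
    then show ?thesis using nabla_compat[OF x N dF_smooth, of v w] by (simp add: pd_const[OF xh] h)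
  qed
  have hsym: "h v w = h w v" for v w by (simp add: hN nabla_symm[OF x, of v])
  have dec: "nabla u (pd v F) x = ?T (chr \<gamma> x u v) - h u v *\<^sub>R N x" for u v
  proof -
    obtain a where a: "nabla u (pd v F) x = ?T a - h u v *\<^sub>R N x"
      using immersion_decompose[OF x N1[OF x] N0[OF x] sp, of "nabla u (pd v F) x"] by (auto simp: hN)
    have "a = chr \<gamma> x u v"
    proof (rule S.eqI[OF x])
      fix w
      show "\<gamma> x a w = \<gamma> x (chr \<gamma> x u v) w"
        using nabla_chr[OF x, of u v w]
        by (simp add: a iso[OF x] bilinear_lsub[OF b] bilinear_lmul[OF b] N0[OF x])
    qed
    then show ?thesis using a by simp
  qed
  have N0': "\<Gamma> (F x) (?T v) (N x) = 0" for v using N0[OF x] M.symm[OF y] by metis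
  have in_nab: "\<Gamma> (F x) (nabla u (pd v F) x) (nabla u' (pd v' F) x)
     = \<gamma> x (chr \<gamma> x u v) (chr \<gamma> x u' v') + h u v * h u' v'" for u v u' v'
    by (simp add: dec bilinear_lsub[OF b] bilinear_rsub[OF b] bilinear_lmul[OF b] bilinear_rmul[OF b]
        N0[OF x] N0' N1[OF x] iso[OF x])
  have R: "?R (?T u) (?T v) (?T w) (?T z) = \<gamma> x (riem \<gamma> x u v w) z - h v w * h u z + h u w * h v z" for u v w z
    unfolding gauss[OF x] in_nab by simp
  note tr = form_trace_isometry(2)[OF S.inner[OF x] M.inner[OF y] linear_dF[OF x] subspace_UNIV iso[OF x] _
      N1[OF x] N0[OF x] sp[symmetric]]
  note ric_bil = bilinear_fieldD(1)[OF M.ric_field y]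
  have ricT: "ric \<Gamma> (F x) v w = (\<Sum>e\<in>?E. ?R (?T e) v w (?T e)) + ?R (N x) v w (N x)" for v w
    unfolding ric_def
    using tr[OF bilinear_fieldD(1)[OF M.ric_integrand_field y], of v w] by (simp add: form_trace_def)
  \<comment> \<open>This term equals its own negative. Hence the Ricci curvature in the direction
    \<open>N x\<close> is a sum over tangent vectors only.\<close>
  have "?R (N x) (N x) (N x) (N x) = - ?R (N x) (N x) (N x) (N x)"
    by (subst M.riem_skew[OF y]) simp
  then have ricN: "ric \<Gamma> (F x) (N x) (N x) = (\<Sum>e\<in>?E. ?R (?T e) (N x) (N x) (?T e))"
    by (simp add: ricT)
  have skew: "?R (N x) (?T e) (?T e) (N x) = ?R (?T e) (N x) (N x) (?T e)" for e
  proof -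
    have "?R (N x) (?T e) (?T e) (N x) = - ?R (N x) (?T e) (N x) (?T e)" by (rule M.riem_skew[OF y])
    also have "\<dots> = ?R (?T e) (N x) (N x) (?T e)"
      by (subst M.riem_antisymm) (simp add: bilinear_lneg[OF b])
    finally show ?thesis .
  qed
  \<comment> \<open>One copy of the normal Ricci curvature is the trace entry of \<open>N x\<close>
    itself. The other collects the \<open>N x\<close> entries inside the Ricci curvatures of the
    tangent vectors, by \<open>skew\<close>.\<close>
  have "scal \<Gamma> (F x) = (\<Sum>e'\<in>?E. ric \<Gamma> (F x) (?T e') (?T e')) + ric \<Gamma> (F x) (N x) (N x)"
    using tr[OF ric_bil] by (simp add: scal_def form_trace_def)
  also have "(\<Sum>e'\<in>?E. ric \<Gamma> (F x) (?T e') (?T e'))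
     = (\<Sum>e'\<in>?E. \<Sum>e\<in>?E. \<gamma> x (riem \<gamma> x e e' e') e - h e' e' * h e e + (h e e')\<^sup>2) + ric \<Gamma> (F x) (N x) (N x)"
    unfolding ricT[of "?T _"] ricN R skew
    by (simp add: sum.distrib power2_eq_square hsym[of _ "_ :: 'b \<times> real"])
  also have "(\<Sum>e'\<in>?E. \<Sum>e\<in>?E. \<gamma> x (riem \<gamma> x e e' e') e - h e' e' * h e e + (h e e')\<^sup>2)
     = scal \<gamma> x - (\<Sum>e\<in>?E. h e e)\<^sup>2 + (\<Sum>e\<in>?E. \<Sum>e'\<in>?E. (h e e')\<^sup>2)"
    by (simp add: scal_def ric_def form_trace_def sum.distrib sum_subtractf power2_eq_square sum_product
        sum.swap[of "\<lambda>e' e. h e e' * h e e'"])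
  finally show ?thesis by simp
qed

end

section \<open>The boundary\<close>

text \<open>The parameter set \<open>T\<close> selects the kind of derivative: all reals for a
  direction tangent to the boundary, a right interval at 0 for one pointing inwards.\<close>

lemma boundary_line:
  assumes U: "hs_open U" and H: "smooth_on U H" and x: "x \<in> U" and T: "\<And>t. t \<in> T \<Longrightarrow> 0 \<le> snd x + t * snd v"
    and 0: "0 \<in> T"
  shows "((\<lambda>t. H (x + t *\<^sub>R v)) has_vector_derivative pd v H x) (at 0 within T)"
proof -
  have l: "((\<lambda>t. x + t *\<^sub>R v) has_derivative (\<lambda>t. t *\<^sub>R v)) (at 0 within T)"
    by (auto intro!: derivative_eq_intros)
  have "(H has_derivative (\<lambda>v. pd v H x)) (at (x + 0 *\<^sub>R v) within half_space)"
    using has_derivative_pd[OF U H x] by simp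
  then have "(H has_derivative (\<lambda>v. pd v H x)) (at (x + 0 *\<^sub>R v) within (\<lambda>t. x + t *\<^sub>R v) ` T)"
    by (rule has_derivative_subset) (use T in \<open>auto simp: half_space_def\<close>)
  from has_derivative_in_compose[OF l this]
  show ?thesis
    by (simp add: has_vector_derivative_def linear_cmul[OF linear_pd[OF U H x]])
qed

lemma boundary_line_near:
  assumes U: "hs_open U" and x: "x \<in> U"
  obtains e where "e > 0" "\<And>t. \<bar>t\<bar> < e \<Longrightarrow> 0 \<le> snd x + t * snd v \<Longrightarrow> x + t *\<^sub>R v \<in> U"
proof -
  obtain Q where Q: "open Q" "U = half_space \<inter> Q" using U openin_open by blast
  obtain d where d: "d > 0" "ball x d \<subseteq> Q" using Q x open_contains_ball by blast
  show thesis
  proof (rule that[of "d / (norm v + 1)"])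
    have n: "norm v + 1 > 0" by (simp add: add_nonneg_pos)
    then show "d / (norm v + 1) > 0" using d(1) by simp
    fix t assume t: "\<bar>t\<bar> < d / (norm v + 1)" "0 \<le> snd x + t * snd v"
    have "norm (t *\<^sub>R v) \<le> \<bar>t\<bar> * (norm v + 1)" by (simp add: algebra_simps)
    also have "\<dots> < d" using t(1) n by (simp add: pos_less_divide_eq)
    finally have "x + t *\<^sub>R v \<in> Q" using d(2) by (auto simp: dist_norm)
    then show "x + t *\<^sub>R v \<in> U" using t(2) by (simp add: Q(2) half_space_def)
  qed
qed

lemma pd_tangent_zero:
  assumes U: "hs_open U" and H: "smooth_on U H" and x: "x \<in> U" "snd x = 0" and v: "snd v = 0"
    and 0: "\<And>y. y \<in> U \<Longrightarrow> snd y = 0 \<Longrightarrow> H y = 0"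
  shows "pd v H x = 0"
proof -
  have d: "((\<lambda>t. H (x + t *\<^sub>R v)) has_vector_derivative pd v H x) (at 0)"
    using boundary_line[OF U H x(1), of UNIV v] x v by simp
  obtain e where e: "e > 0" "\<And>t. \<bar>t\<bar> < e \<Longrightarrow> x + t *\<^sub>R v \<in> U"
    using boundary_line_near[OF U x(1), of v] x v by auto
  have "((\<lambda>t. 0) has_vector_derivative pd v H x) (at (0::real))"
    by (rule has_vector_derivative_transform_within[OF d e(1)]) (use e 0 x v in \<open>auto simp: dist_norm\<close>)
  then show ?thesis using vector_derivative_unique_at has_vector_derivative_const by blast
qed

text \<open>\<open>H\<close> has a minimum at \<open>x\<close>, so its right derivatives along
  admissible directions are nonnegative. Off the boundary every direction is admissible, whence the
  disjunction.\<close>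

lemma pd_inward_nonneg:
  fixes H :: "'a::euclidean_space \<times> real \<Rightarrow> real"
  assumes U: "hs_open U" and H: "smooth_on U H" and x: "x \<in> U" "H x = 0" and v: "0 \<le> snd v \<or> 0 < snd x"
    and 0: "\<And>y. y \<in> U \<Longrightarrow> H y \<ge> 0"
  shows "pd v H x \<ge> 0"
proof -
  have x0: "0 \<le> snd x" using x(1) hs_open_subset[OF U] by (auto simp: half_space_def)
  obtain d where d: "d > 0" "\<And>t. t \<in> {0..d} \<Longrightarrow> 0 \<le> snd x + t * snd v"
  proof (cases "0 \<le> snd v")
    case True then show ?thesis using x0 by (intro that[of 1]) auto
  next
    case False
    \<comment> \<open>The line may be followed up to the parameter at which it reaches the
      boundary.\<close>
    have *: "0 \<le> snd x + t * snd v" if "t \<in> {0..snd x / (- snd v)}" for t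
    proof -
      have "- snd v > 0" using False by simp
      from iffD1[OF pos_le_divide_eq[OF this]] have "t * (- snd v) \<le> snd x"
        using that by (metis atLeastAtMost_iff)
      then show ?thesis by simp
    qed
    have "0 < snd x / (- snd v)" using v False by (simp add: divide_pos_neg)
    then show ?thesis using * by (rule that)
  qed
  have "((\<lambda>t. H (x + t *\<^sub>R v)) has_vector_derivative pd v H x) (at 0 within {0..d})"
    using d by (intro boundary_line[OF U H x(1)]) auto
  then have "((\<lambda>t. H (x + t *\<^sub>R v)) has_real_derivative pd v H x) (at_right 0)"
    unfolding has_real_derivative_iff_has_vector_derivative at_within_Icc_at_right[OF d(1)] .
  then have lim: "((\<lambda>t. H (x + t *\<^sub>R v) / t) \<longlongrightarrow> pd v H x) (at_right 0)"
    by (simp add: has_field_derivative_iff x(2))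
  obtain e where e: "e > 0" "\<And>t. \<bar>t\<bar> < e \<Longrightarrow> 0 \<le> snd x + t * snd v \<Longrightarrow> x + t *\<^sub>R v \<in> U"
    using boundary_line_near[OF U x(1), of v] by metis
  have "eventually (\<lambda>t. 0 \<le> H (x + t *\<^sub>R v) / t) (at_right 0)"
    unfolding eventually_at_right_field
    by (intro exI[of _ "min d e"]) (use e d 0 in auto)
  from tendsto_lowerbound[OF lim this] show ?thesis by simp
qed

text \<open>This and the next two are the coordinate counterparts of \<open>outward_normal\<close>,
  \<open>bdry_sff\<close> and \<open>bdry_mean_curvature\<close>. They make sense at all points of
  the chart, which allows derivatives to be taken on relatively open sets.\<close>

definition outn :: "'a::euclidean_space coord_metric \<Rightarrow> 'a \<times> real \<Rightarrow> 'a \<times> real" where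
  "outn \<gamma> x = (THE z. snd z < 0 \<and> \<gamma> x z z = 1 \<and> (\<forall>v. snd v = 0 \<longrightarrow> \<gamma> x z v = 0))"

definition bsff ::
  "'a::euclidean_space coord_metric \<Rightarrow> 'a \<times> real \<Rightarrow> 'a \<times> real \<Rightarrow> 'a \<times> real \<Rightarrow> real" where
  "bsff \<gamma> x v w = \<gamma> x (pd v (outn \<gamma>) x + chr \<gamma> x v (outn \<gamma> x)) w"

definition bmean :: "'a::euclidean_space coord_metric \<Rightarrow> 'a \<times> real \<Rightarrow> real" where
  "bmean \<gamma> x = form_trace (\<gamma> x) {v. snd v = 0} (bsff \<gamma> x)"

lemma linear_snd_pair: "linear (snd :: 'a::real_vector \<times> real \<Rightarrow> real)"
  by (simp add: linear_iff)

lemma subspace_tangent: "subspace {v :: 'a::real_vector \<times> real. snd v = 0}"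
  by (auto simp: subspace_def)

context coordinate_metric
begin

text \<open>The gradient of the last coordinate. The outward normal is its negative normalisation,
  an explicit formula from which smoothness follows.\<close>

definition zeta :: "'a \<times> real \<Rightarrow> 'a \<times> real" where
  "zeta x = (THE z. \<forall>u. \<gamma> x z u = snd u)"

lemma zeta: "x \<in> U \<Longrightarrow> \<gamma> x (zeta x) u = snd u"
  unfolding zeta_def by (rule theI'[OF riesz_ex1[OF inner linear_snd_pair], THEN spec])

lemma zeta_pos: "x \<in> U \<Longrightarrow> \<gamma> x (zeta x) (zeta x) > 0"
  using zeta[of x "(0, 1)"] bilinear_lzero[OF bil] inner_formD(3)[OF inner, of x "zeta x"] by fastforce

lemma outn_unique:
  assumes x: "x \<in> U" and z: "snd z < 0" "\<gamma> x z z = 1" "\<And>v. snd v = 0 \<Longrightarrow> \<gamma> x z v = 0"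
    and z': "snd z' < 0" "\<gamma> x z' z' = 1" "\<And>v. snd v = 0 \<Longrightarrow> \<gamma> x z' v = 0"
  shows "z = z'"
proof -
  note b = bil[OF x]
  \<comment> \<open>With this factor \<open>z - t *\<^sub>R z'\<close> has last coordinate 0. It is
    then orthogonal to both candidates, hence to itself.\<close>
  define t where "t = snd z / snd z'"
  have t: "t > 0" using z z' by (simp add: t_def divide_neg_neg)
  define w where "w = z - t *\<^sub>R z'"
  have "snd w = 0" using z' by (simp add: w_def t_def)
  then have "\<gamma> x w w = 0"
    using z(3)[of w] z'(3)[of w] by (simp add: w_def bilinear_lsub[OF b] bilinear_lmul[OF b])
  then have w: "z = t *\<^sub>R z'" using inner_formD(4)[OF inner[OF x]] by (simp add: w_def)
  then have "t * t = 1" using z(2) z'(2) by (simp add: bilinear_lmul[OF b] bilinear_rmul[OF b])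
  then have "t = 1" using t by (simp add: square_eq_1_iff)
  then show ?thesis using w by simp
qed

lemma outn_zeta:
  assumes x: "x \<in> U"
  shows "outn \<gamma> x = (- (1 / sqrt (\<gamma> x (zeta x) (zeta x)))) *\<^sub>R zeta x" (is "_ = ?z")
    and "snd (outn \<gamma> x) < 0" "\<gamma> x (outn \<gamma> x) (outn \<gamma> x) = 1" "\<And>v. snd v = 0 \<Longrightarrow> \<gamma> x (outn \<gamma> x) v = 0"
proof -
  note b = bil[OF x]
  note p = zeta_pos[OF x]
  have s: "snd (zeta x) = \<gamma> x (zeta x) (zeta x)" using zeta[OF x] by simp
  define r where "r = sqrt (\<gamma> x (zeta x) (zeta x))"
  have r: "r > 0" "\<gamma> x (zeta x) (zeta x) = r * r" using p by (simp_all add: r_def)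
  let ?c = "- (1 / sqrt (\<gamma> x (zeta x) (zeta x)))"
  have c: "?c = - (1 / r)" by (simp add: r_def)
  have z1: "snd ?z < 0" unfolding c snd_scaleR s r(2) using r(1) by simp
  have z2: "\<gamma> x ?z ?z = 1"
    unfolding c bilinear_lmul[OF b] bilinear_rmul[OF b] r(2) using r(1) by simp
  have z3: "\<gamma> x ?z v = 0" if "snd v = 0" for v
    unfolding bilinear_lmul[OF b] zeta[OF x] that by simp
  show eq: "outn \<gamma> x = ?z"
    unfolding outn_def
  proof (rule the_equality)
    show "snd ?z < 0 \<and> \<gamma> x ?z ?z = 1 \<and> (\<forall>v. snd v = 0 \<longrightarrow> \<gamma> x ?z v = 0)"
      using z1 z2 z3 by blast
    fix z' assume "snd z' < 0 \<and> \<gamma> x z' z' = 1 \<and> (\<forall>v. snd v = 0 \<longrightarrow> \<gamma> x z' v = 0)"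
    then show "z' = ?z" using outn_unique[OF x _ _ _ z1 z2 z3] by blast
  qed
  show "snd (outn \<gamma> x) < 0" "\<gamma> x (outn \<gamma> x) (outn \<gamma> x) = 1" "\<And>v. snd v = 0 \<Longrightarrow> \<gamma> x (outn \<gamma> x) v = 0"
    unfolding eq by (fact z1, fact z2, fact z3)
qed

lemma outn_smooth: "smooth_on U (outn \<gamma>)"
proof (rule smooth_on_cong)
  have z: "smooth_on U zeta"
    by (rule riesz_smooth[OF metric smooth_on_const zeta])
  have ne: "sqrt (\<gamma> x (zeta x) (zeta x)) \<noteq> 0" if "x \<in> U" for x using zeta_pos[OF that] by simp
  show "smooth_on U (\<lambda>x. (- (1 / sqrt (\<gamma> x (zeta x) (zeta x)))) *\<^sub>R zeta x)"
    by (intro smooth_on_scaleR smooth_on_minus smooth_on_divide smooth_on_const smooth_on_sqrt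
        bilinear_field_smooth[OF field] z zeta_pos ne)
qed (simp add: outn_zeta(1))

lemma bsff_field: "bilinear_field U (bsff \<gamma>)"
  unfolding bilinear_field_def
proof (intro conjI ballI allI)
  fix x assume x: "x \<in> U"
  have "linear (\<lambda>v. pd v (outn \<gamma>) x + chr \<gamma> x v (outn \<gamma> x))"
    by (intro linear_compose_add linear_pd[OF hs outn_smooth x] bilinear_linear_left[OF chr_bil[OF x]])
  then show "bilinear (bsff \<gamma> x)"
    unfolding bilinear_def bsff_def
    using linear_compose[OF _ bilinear_linear_left[OF bil[OF x]], unfolded o_def]
      bilinear_linear_right[OF bil[OF x]] by auto
next
  fix v w show "smooth_on U (\<lambda>x. bsff \<gamma> x v w)"
    unfolding bsff_def
    by (intro bilinear_field_smooth[OF field] smooth_on_add smooth_on_pd[OF hs outn_smooth]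
        bilinear_field_smooth[OF chr_field] smooth_on_const outn_smooth)
qed

lemma bmean_smooth: "smooth_on U (bmean \<gamma>)"
  unfolding bmean_def by (rule form_trace_smooth[OF metric subspace_tangent bsff_field])

text \<open>Subtracting a multiple of the outward normal makes \<open>v\<close> tangent to the
  boundary; orthogonality forces that multiple to be zero. It will show that the normal of a free
  boundary hypersurface is tangent to the ambient boundary.\<close>

lemma outn_orthogonal:
  assumes x: "x \<in> U" and n: "\<gamma> x v (outn \<gamma> x) = 0"
  shows "snd v = 0"
proof -
  note b = bil[OF x] and o = outn_zeta(2-)[OF x]
  define w where "w = v - (snd v / snd (outn \<gamma> x)) *\<^sub>R outn \<gamma> x"
  have "snd w = 0" using o(1) by (simp add: w_def)
  then have "\<gamma> x (outn \<gamma> x) w = 0" by (rule o(3))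
  then have "snd v / snd (outn \<gamma> x) = 0"
    using n symm[OF x, of v "outn \<gamma> x"] o(2) by (simp add: w_def bilinear_rsub[OF b] bilinear_rmul[OF b])
  then show ?thesis using o(1) by simp
qed

end

text \<open>\<open>outn_tangent\<close> is the coordinate form of meeting the boundary orthogonally:
  the ambient outward normal is tangent to the image. It is automatic when the differential is
  onto.\<close>

locale boundary_immersion = isometric_immersion U \<gamma> V \<Gamma> F
  for U :: "('b::euclidean_space \<times> real) set" and \<gamma>
    and V :: "('a::euclidean_space \<times> real) set" and \<Gamma> and F +
  assumes bdry: "\<And>x. x \<in> U \<Longrightarrow> snd x = 0 \<Longrightarrow> snd (F x) = 0"
    and outn_tangent: "\<And>x. x \<in> U \<Longrightarrow> snd x = 0 \<Longrightarrow> outn \<Gamma> (F x) \<in> range (\<lambda>v. pd v F x)"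
begin

lemma snd_F_smooth: "smooth_on U (\<lambda>x. snd (F x))"
  by (rule smooth_on_bounded_linear[OF bounded_linear_snd F])

lemma pd_snd_F: "x \<in> U \<Longrightarrow> pd v (\<lambda>x. snd (F x)) x = snd (pd v F x)"
  by (rule pd_bounded_linear[OF S.hs bounded_linear_snd F])

lemma tangent_image: "x \<in> U \<Longrightarrow> snd x = 0 \<Longrightarrow> snd v = 0 \<Longrightarrow> snd (pd v F x) = 0"
  using pd_tangent_zero[OF S.hs snd_F_smooth _ _ _ bdry] pd_snd_F by metis

lemma inward_image:
  assumes "x \<in> U" "snd x = 0" "0 \<le> snd v"
  shows "0 \<le> snd (pd v F x)"
proof -
  have "0 \<le> snd (F y)" if "y \<in> U" for y
    using FV[OF that] hs_open_subset[OF M.hs] by (auto simp: half_space_def)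
  from pd_inward_nonneg[OF S.hs snd_F_smooth assms(1) _ disjI1[OF assms(3)] this] show ?thesis
    using pd_snd_F bdry assms by simp
qed

text \<open>The preimage \<open>a\<close> of the ambient outward normal has unit length and is
  orthogonal to the boundary by isometry. It points outwards because \<open>F\<close> maps inward
  vectors to vectors that do not point outwards. These properties characterise
  \<open>outn\<close>.\<close>

lemma outn_image:
  assumes x: "x \<in> U" "snd x = 0"
  shows "pd (outn \<gamma> x) F x = outn \<Gamma> (F x)"
proof -
  note o = M.outn_zeta(2-)[OF FV[OF x(1)]]
  obtain a where a: "outn \<Gamma> (F x) = pd a F x" using outn_tangent[OF x] by blast
  have "snd a < 0" using inward_image[OF x, of a] o(1) a by (metis linorder_not_less)
  moreover have "\<gamma> x a a = 1" using o(2) iso[OF x(1), of a a] a by simp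
  moreover have "\<gamma> x a v = 0" if "snd v = 0" for v
    using o(3)[OF tangent_image[OF x that]] iso[OF x(1), of a v] a by simp
  ultimately have "outn \<gamma> x = a"
    using S.outn_unique[OF x(1), of "outn \<gamma> x" a] S.outn_zeta(2-)[OF x(1)] by blast
  then show ?thesis using a by simp
qed

text \<open>Both normals correspond under the differential, and the tangential part of the ambient
  connection is intrinsic, so both second fundamental forms agree.\<close>

lemma bsff_image:
  assumes x: "x \<in> U" "snd x = 0" and v: "snd v = 0"
  shows "bsff \<Gamma> (F x) (pd v F x) (pd w F x) = bsff \<gamma> x v w"
proof -
  note b = M.bil[OF FV[OF x(1)]]
  define X where "X y = pd (outn \<gamma> y) F y" for y
  note lf = linear_field_pd_map[OF S.hs F]
  have X: "smooth_on U X" unfolding X_def by (rule linear_field_smooth[OF lf S.outn_smooth])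
  have Z: "smooth_on U (\<lambda>y. outn \<Gamma> (F y))" by (rule smooth_on_compose[OF M.outn_smooth F FV])
  have X1: "pd v X x = pd v (pd (outn \<gamma> x) F) x + pd (pd v (outn \<gamma>) x) F x"
    unfolding X_def by (rule linear_field_pd[OF S.hs lf S.outn_smooth x(1)])
  \<comment> \<open>\<open>X\<close> equals the ambient outward normal only along the boundary, so
    their derivatives can be identified only in the tangent direction \<open>v\<close>.\<close>
  have "pd v (\<lambda>y. X y - outn \<Gamma> (F y)) x = 0"
    by (rule pd_tangent_zero[OF S.hs smooth_on_diff[OF X Z] x v]) (simp add: X_def outn_image)
  then have X2: "pd v X x = pd (pd v F x) (outn \<Gamma>) (F x)"
    by (simp add: pd_diff[OF S.hs X Z x(1)] pd_compose[OF S.hs F M.hs M.outn_smooth FV x(1)])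
  have "nabla v X x = nabla v (pd (outn \<gamma> x) F) x + pd (pd v (outn \<gamma>) x) F x"
    unfolding nabla_def X1 by (simp add: X_def)
  then have "\<Gamma> (F x) (nabla v X x) (pd w F x) = bsff \<gamma> x v w"
    by (simp add: bilinear_ladd[OF b] nabla_chr[OF x(1)] iso[OF x(1), symmetric] bsff_def
        bilinear_ladd[OF S.bil[OF x(1)]])
  then show ?thesis
    by (simp add: nabla_def X2 bsff_def X_def outn_image[OF x])
qed

lemma tangent_iff:
  assumes x: "x \<in> U" "snd x = 0"
  shows "snd (pd v F x) = 0 \<longleftrightarrow> snd v = 0"
proof -
  let ?a = "outn \<gamma> x"
  have a: "snd ?a < 0" "snd (pd ?a F x) < 0"
    using S.outn_zeta(2)[OF x(1)] M.outn_zeta(2)[OF FV[OF x(1)]] outn_image[OF x] by auto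
  \<comment> \<open>Chosen so that \<open>v - c *\<^sub>R ?a\<close> is tangent to the boundary; its
    image is tangent too, and the last coordinates of \<open>pd v F x\<close> and of
    \<open>v\<close> vanish together.\<close>
  define c where "c = snd v / snd ?a"
  have "snd (pd (v - c *\<^sub>R ?a) F x) = 0" by (rule tangent_image[OF x]) (use a in \<open>simp add: c_def\<close>)
  then have "snd (pd v F x) = c * snd (pd ?a F x)"
    by (simp add: linear_diff[OF linear_dF[OF x(1)]] linear_cmul[OF linear_dF[OF x(1)]])
  then show ?thesis using a by (simp add: c_def)
qed

lemma form_trace_bsff_cong:
  assumes x: "x \<in> U" "snd x = 0"
  shows "form_trace (\<gamma> x) {v. snd v = 0} (\<lambda>v w. bsff \<Gamma> (F x) (pd v F x) (pd w F x)) = bmean \<gamma> x"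
  unfolding bmean_def form_trace_def
proof (rule sum.cong[OF refl])
  fix e assume "e \<in> onb (\<gamma> x) {v. snd v = 0}"
  then have "snd e = 0"
    using onb_orthonormal_basis[OF S.inner[OF x(1)] subspace_tangent] by (auto simp: orthonormal_basis_def)
  then show "bsff \<Gamma> (F x) (pd e F x) (pd e F x) = bsff \<gamma> x e e" by (rule bsff_image[OF x])
qed

lemma bmean_isometry:
  assumes x: "x \<in> U" "snd x = 0" and sp: "range (\<lambda>v. pd v F x) = UNIV"
  shows "bmean \<Gamma> (F x) = bmean \<gamma> x"
proof -
  have "(\<lambda>v. pd v F x) ` {v. snd v = 0} = {v. snd v = 0}"
  proof (intro antisym subsetI)
    fix y :: "'a \<times> real" assume y: "y \<in> {v. snd v = 0}"
    obtain v where "y = pd v F x" using sp by blast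
    then show "y \<in> (\<lambda>v. pd v F x) ` {v. snd v = 0}" using y tangent_iff[OF x, of v] by simp
  qed (auto simp: tangent_iff[OF x])
  then show ?thesis
    using form_trace_isometry(1)[OF S.inner[OF x(1)] M.inner[OF FV[OF x(1)]] linear_dF[OF x(1)] subspace_tangent
        iso[OF x(1)] bilinear_fieldD(1)[OF M.bsff_field FV[OF x(1)]]] form_trace_bsff_cong[OF x]
    by (simp add: bmean_def)
qed

text \<open>The tangent space of the ambient boundary is the orthogonal sum of the image of the
  tangent space of the inner boundary and the line through \<open>N\<close>. The normal line
  contributes the extra term.\<close>

lemma bmean_hypersurface:
  assumes x: "x \<in> U" "snd x = 0"
    and N: "\<Gamma> (F x) N N = 1" "\<And>v. \<Gamma> (F x) N (pd v F x) = 0"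
    and sp: "span (insert N (range (\<lambda>v. pd v F x))) = UNIV" and sN: "snd N = 0"
  shows "bmean \<Gamma> (F x) = bmean \<gamma> x + bsff \<Gamma> (F x) N N"
proof -
  let ?T = "(\<lambda>v. pd v F x) ` {v. snd v = 0}"
  have "{v. snd v = 0} = span (insert N ?T)"
  proof (intro antisym subsetI)
    fix y :: "'a \<times> real" assume y: "y \<in> {v. snd v = 0}"
    obtain v c where v: "y = pd v F x + c *\<^sub>R N"
      using immersion_decompose[OF x(1) N sp] by blast
    then have "snd (pd v F x) = 0" using y sN by simp
    then have "pd v F x \<in> span (insert N ?T)" by (auto simp: tangent_iff[OF x] intro!: span_base)
    moreover have "c *\<^sub>R N \<in> span (insert N ?T)" by (intro span_scale span_base insertI1)
    ultimately show "y \<in> span (insert N ?T)" unfolding v by (rule span_add)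
  next
    fix y assume "y \<in> span (insert N ?T)"
    moreover have "span (insert N ?T) \<subseteq> {v. snd v = 0}"
      by (rule span_minimal[OF _ subspace_tangent]) (auto simp: sN tangent_iff[OF x])
    ultimately show "y \<in> {v. snd v = 0}" by blast
  qed
  from form_trace_isometry(2)[OF S.inner[OF x(1)] M.inner[OF FV[OF x(1)]] linear_dF[OF x(1)] subspace_tangent
        iso[OF x(1)] bilinear_fieldD(1)[OF M.bsff_field FV[OF x(1)]] N this]
  show ?thesis using form_trace_bsff_cong[OF x] by (simp add: bmean_def)
qed

end

section \<open>Charts\<close>

lemma chart_at_in:
  assumes "smooth_atlas A"
  shows "chart_at A p \<in> A" "p \<in> cdom (chart_at A p)"
proof -
  have "p \<in> (\<Union>c\<in>A. cdom c)" using assms by (simp add: smooth_atlas_def)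
  then have "\<exists>c. c \<in> A \<and> p \<in> cdom c" by blast
  from someI_ex[OF this] show "chart_at A p \<in> A" "p \<in> cdom (chart_at A p)"
    by (auto simp: chart_at_def)
qed

locale atlas =
  fixes A :: "('p::{t2_space,second_countable_topology}, 'a::euclidean_space \<times> real) chart set"
  assumes atlas: "smooth_atlas A"
begin

lemmas chart_at = chart_at_in[OF atlas]

lemma chart:
  assumes "c \<in> A"
  shows "open (cdom c)" "hs_open (cmap c ` cdom c)"
    "homeomorphism (cdom c) (cmap c ` cdom c) (cmap c) (cinv c)"
  using assms atlas by (auto simp: smooth_atlas_def)

lemma cinv_cmap [simp]: "c \<in> A \<Longrightarrow> p \<in> cdom c \<Longrightarrow> cinv c (cmap c p) = p"
  using chart(3) by (auto simp: homeomorphism_def)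

lemma cinv_in: "c \<in> A \<Longrightarrow> x \<in> cmap c ` cdom c \<Longrightarrow> cinv c x \<in> cdom c"
  using chart(3) by (auto simp: homeomorphism_def)

lemma cmap_cinv [simp]: "c \<in> A \<Longrightarrow> x \<in> cmap c ` cdom c \<Longrightarrow> cmap c (cinv c x) = x"
  using chart(3) by (auto simp: homeomorphism_def)

lemma continuous_cmap: "c \<in> A \<Longrightarrow> continuous_on (cdom c) (cmap c)"
  using chart(3) by (auto simp: homeomorphism_def)

lemma hs_open_chart:
  assumes c: "c \<in> A" and W: "open W"
  shows "hs_open (cmap c ` (cdom c \<inter> W))"
proof -
  have "openin (top_of_set (cmap c ` cdom c)) (cmap c ` (cdom c \<inter> W))"
    by (rule homeomorphism_imp_open_map[OF chart(3)[OF c]]) (use W in \<open>auto simp: openin_open\<close>)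
  then show ?thesis using chart(2)[OF c] openin_trans by blast
qed

text \<open>\<open>cderiv\<close> differentiates within the chart image, \<open>pd\<close> within
  the whole half-space. Both agree because the image is relatively open.\<close>

lemma cderiv_pd:
  assumes c: "c \<in> A" and p: "p \<in> cdom c"
  shows "cderiv c F p v = pd v (\<lambda>x. F (cinv c x)) (cmap c p)"
  using hs_open_at_within[OF chart(2)[OF c], of "cmap c p"] p by (simp add: cderiv_def pd_def o_def)

lemma cmap_half_space: "c \<in> A \<Longrightarrow> p \<in> cdom c \<Longrightarrow> 0 \<le> snd (cmap c p)"
  using hs_open_subset[OF chart(2), of c] unfolding half_space_def by blast

lemma smooth_transition:
  "c \<in> A \<Longrightarrow> d \<in> A \<Longrightarrow> smooth_on (cmap c ` (cdom c \<inter> cdom d)) (\<lambda>x. cmap d (cinv c x))"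
  using atlas by (auto simp: smooth_atlas_def smooth_fun_def o_def)

lemma smooth_fun_chart: "smooth_fun A W F \<Longrightarrow> c \<in> A \<Longrightarrow> smooth_on (cmap c ` (cdom c \<inter> W)) (\<lambda>x. F (cinv c x))"
  by (auto simp: smooth_fun_def o_def)

lemma continuous_on_chartI:
  assumes "c \<in> A" "open W" "continuous_on (cmap c ` (cdom c \<inter> W)) H" "\<And>p. p \<in> cdom c \<inter> W \<Longrightarrow> F p = H (cmap c p)"
  shows "continuous_on (cdom c \<inter> W) F"
proof -
  have "continuous_on (cdom c \<inter> W) (\<lambda>p. H (cmap c p))"
    by (rule continuous_on_compose2[OF assms(3) continuous_on_subset[OF continuous_cmap[OF assms(1)]]]) auto
  then show ?thesis by (rule continuous_on_eq) (simp add: assms(4))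
qed

lemma continuous_on_local:
  fixes B :: "'p set" and F :: "'p \<Rightarrow> 'v::topological_space"
  assumes "\<And>p. \<exists>W. open W \<and> p \<in> W \<and> continuous_on (B \<inter> W) F"
  shows "continuous_on B F"
  unfolding continuous_on_eq_continuous_within
proof
  fix p assume p: "p \<in> B"
  obtain W where W: "open W" "p \<in> W" "continuous_on (B \<inter> W) F" using assms by blast
  then have "continuous (at p within B \<inter> W) F" using p by (simp add: continuous_on_eq_continuous_within)
  moreover have "at p within B \<inter> W = at p within B"
    by (rule at_within_nhd[OF W(2,1)]) auto
  ultimately show "continuous (at p within B) F" by simp
qed

text \<open>A quantity computed in \<open>chart_at A p\<close> may switch charts from point to
  point. Once it has the same expression in every chart, continuity near \<open>p\<close> can be
  checked in a single chart.\<close>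

lemma continuous_on_chartsI:
  fixes F :: "'p \<Rightarrow> 'v::topological_space"
  assumes H: "\<And>c. c \<in> A \<Longrightarrow> continuous_on (cmap c ` cdom c) (H c)"
    and F: "\<And>c p. c \<in> A \<Longrightarrow> p \<in> cdom c \<Longrightarrow> p \<in> B \<Longrightarrow> F p = H c (cmap c p)"
  shows "continuous_on B F"
proof (rule continuous_on_local)
  fix p
  let ?c = "chart_at A p"
  note c = chart_at[of p]
  have "continuous_on (cdom ?c \<inter> UNIV) (\<lambda>p. H ?c (cmap ?c p))"
    by (rule continuous_on_chartI[OF c(1) open_UNIV, of "H ?c"]) (simp_all add: H[OF c(1)])
  then have "continuous_on (B \<inter> cdom ?c) (\<lambda>p. H ?c (cmap ?c p))"
    by (rule continuous_on_subset) auto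
  then have "continuous_on (B \<inter> cdom ?c) F"
    by (rule continuous_on_eq) (simp add: F[OF c(1)])
  then show "\<exists>W. open W \<and> p \<in> W \<and> continuous_on (B \<inter> W) F"
    using c chart(1) by blast
qed

text \<open>Regularity of \<open>H\<close> is required only near \<open>p\<close>, since it is
  applied to coordinates of the ambient manifold, which are controlled only on the preimage of a
  chart.\<close>

lemma cderiv_chain:
  assumes c: "c \<in> A" "d \<in> A" "p \<in> cdom c" "p \<in> cdom d" and W: "open W" "p \<in> W"
    and H: "smooth_on (cmap d ` (cdom d \<inter> W)) (\<lambda>x. H (cinv d x) :: 'v::real_normed_vector)"
  shows "cderiv c H p v = cderiv d H p (cderiv c (cmap d) p v)"
proof -
  let ?U = "cmap c ` (cdom c \<inter> (cdom d \<inter> W))"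
  have hsU: "hs_open ?U" by (rule hs_open_chart[OF c(1)]) (use chart(1)[OF c(2)] W in auto)
  have x: "cmap c p \<in> ?U" using c W by auto
  have sm: "smooth_on ?U (\<lambda>x. cmap d (cinv c x))"
    by (rule smooth_on_subset[OF smooth_transition[OF c(1,2)]]) auto
  have "pd v (\<lambda>x. H (cinv c x)) (cmap c p) = pd v (\<lambda>x. (\<lambda>y. H (cinv d y)) (cmap d (cinv c x))) (cmap c p)"
    by (rule pd_cong[OF hsU x]) (use c in auto)
  also have "\<dots> = pd (pd v (\<lambda>x. cmap d (cinv c x)) (cmap c p)) (\<lambda>y. H (cinv d y)) (cmap d (cinv c (cmap c p)))"
    by (rule pd_compose[OF hsU sm hs_open_chart[OF c(2) W(1)] H _ x]) (use c in auto)
  finally show ?thesis using c by (simp add: cderiv_pd)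
qed

lemma cderiv_cmap_self:
  assumes c: "c \<in> A" "p \<in> cdom c"
  shows "cderiv c (cmap c) p v = v"
proof -
  have x: "cmap c p \<in> cmap c ` cdom c" using c by auto
  have "pd v (\<lambda>x. cmap c (cinv c x)) (cmap c p) = pd v (\<lambda>x. x) (cmap c p)"
    by (rule pd_cong[OF chart(2)[OF c(1)] x]) (use c in auto)
  also have "\<dots> = v"
    by (rule pd_unique[OF _ has_derivative_ident]) (use x hs_open_subset[OF chart(2)[OF c(1)]] in auto)
  finally show ?thesis using c by (simp add: cderiv_pd)
qed

lemma cderiv_transition_inverse:
  assumes c: "c \<in> A" "d \<in> A" "p \<in> cdom c" "p \<in> cdom d"
  shows "cderiv d (cmap c) p (cderiv c (cmap d) p v) = v"
proof -
  have "cderiv c (cmap c) p v = cderiv d (cmap c) p (cderiv c (cmap d) p v)"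
    by (rule cderiv_chain[OF c chart(1)[OF c(1)] c(3) smooth_transition[OF c(2,1)]])
  then show ?thesis using cderiv_cmap_self[OF c(1,3)] by simp
qed

lemma range_transition:
  assumes "c \<in> A" "d \<in> A" "p \<in> cdom c" "p \<in> cdom d"
  shows "range (cderiv c (cmap d) p) = UNIV"
  using cderiv_transition_inverse[OF assms(2,1,4,3)] by (metis surjI)

text \<open>The last coordinate vanishing at an interior point of another chart would have a minimum there,
  so the transition map would not have full rank.\<close>

lemma bdry_chart_imp:
  assumes c: "c \<in> A" "d \<in> A" "p \<in> cdom c" "p \<in> cdom d" and 0: "snd (cmap c p) = 0"
  shows "snd (cmap d p) = 0"
proof (rule ccontr)
  assume "snd (cmap d p) \<noteq> 0"
  then have pos: "0 < snd (cmap d p)" using cmap_half_space[OF c(2,4)] by simp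
  let ?U = "cmap d ` (cdom d \<inter> cdom c)" and ?H = "\<lambda>x. snd (cmap c (cinv d x))"
  have hs: "hs_open ?U" by (rule hs_open_chart[OF c(2) chart(1)[OF c(1)]])
  have H: "smooth_on ?U ?H" by (rule smooth_on_bounded_linear[OF bounded_linear_snd smooth_transition[OF c(2,1)]])
  have x: "cmap d p \<in> ?U" using c by auto
  have nonneg: "0 \<le> pd v ?H (cmap d p)" for v
    by (rule pd_inward_nonneg[OF hs H x]) (use c 0 pos in \<open>auto intro!: cmap_half_space\<close>)
  have zero: "pd v ?H (cmap d p) = 0" for v
    using nonneg[of v] nonneg[of "- v"] linear_neg[OF linear_pd[OF hs H x], of v] by simp
  have "snd (cderiv d (cmap c) p v) = 0" for v
    using zero[of v] pd_bounded_linear[OF hs bounded_linear_snd smooth_transition[OF c(2,1)] x, of v]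
    by (simp add: cderiv_pd[OF c(2,4)])
  moreover obtain v where "cderiv d (cmap c) p v = (0, 1)"
    using range_transition[OF c(2,1,4,3)] by (metis surjE)
  ultimately show False by (metis snd_conv zero_neq_one)
qed

lemma bdry_chart: "c \<in> A \<Longrightarrow> p \<in> cdom c \<Longrightarrow> p \<in> bdry A \<longleftrightarrow> snd (cmap c p) = 0"
  unfolding bdry_def using bdry_chart_imp by blast

lemma closed_bdry: "closed (bdry A)"
proof -
  have "open (- bdry A)"
  proof (rule Topological_Spaces.openI)
    fix p assume p: "p \<in> - bdry A"
    let ?c = "chart_at A p"
    note c = chart_at[of p]
    have "continuous_on (cdom ?c) (\<lambda>q. snd (cmap ?c q))"
      by (intro continuous_on_snd continuous_cmap c)
    moreover have "open (- {0 :: real})" by auto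
    ultimately have "open (cdom ?c \<inter> (\<lambda>q. snd (cmap ?c q)) -` (- {0}))"
      using continuous_on_open_vimage[OF chart(1)[OF c(1)]] by (metis Int_commute)
    moreover have "cdom ?c \<inter> (\<lambda>q. snd (cmap ?c q)) -` (- {0}) \<subseteq> - bdry A"
      using bdry_chart[OF c(1)] by auto
    moreover have "p \<in> cdom ?c \<inter> (\<lambda>q. snd (cmap ?c q)) -` (- {0})"
      using bdry_chart[OF c] p c(2) by auto
    ultimately show "\<exists>T. open T \<and> p \<in> T \<and> T \<subseteq> - bdry A" by blast
  qed
  then show ?thesis by (simp add: closed_def)
qed

end

section \<open>Curvature of a Riemannian atlas in terms of coordinate expressions\<close>

lemma coordinate_metric_subset:
  "coordinate_metric U \<gamma> \<Longrightarrow> hs_open U' \<Longrightarrow> U' \<subseteq> U \<Longrightarrow> coordinate_metric U' \<gamma>"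
  unfolding coordinate_metric_def metric_on_def bilinear_field_def by (blast intro: smooth_on_subset)

locale riemannian_atlas = atlas A
  for A :: "('p::{t2_space,second_countable_topology}, 'a::euclidean_space \<times> real) chart set" +
  fixes G :: "('p, 'a \<times> real) metric"
  assumes riemannian: "riemannian_metric A G"
begin

abbreviation Gc :: "('p, 'a \<times> real) chart \<Rightarrow> 'a \<times> real \<Rightarrow> 'a \<times> real \<Rightarrow> 'a \<times> real \<Rightarrow> real" where
  "Gc c \<equiv> \<lambda>x. G c (cinv c x)"

lemma coordinate: "c \<in> A \<Longrightarrow> coordinate_metric (cmap c ` cdom c) (Gc c)"
proof -
  assume c: "c \<in> A"
  have i: "inner_form (G c p)" if "p \<in> cdom c" for p
    using riemannian c that unfolding riemannian_metric_def inner_form_def by blast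
  have "smooth_on (cmap c ` cdom c) (\<lambda>x. Gc c x v w)" for v w
  proof -
    have "smooth_fun A (cdom c) (\<lambda>p. G c p v w)" using riemannian c unfolding riemannian_metric_def by blast
    from smooth_fun_chart[OF this c] show ?thesis by simp
  qed
  then show ?thesis
    using i inner_formD(1)[OF i] c cinv_in[OF c] chart(2)[OF c]
    by (auto simp: coordinate_metric_def metric_on_def bilinear_field_def)
qed

lemma christoffel_chr:
  assumes c: "c \<in> A" "p \<in> cdom c"
  shows "christoffel G c p v w = chr (Gc c) (cmap c p) v w"
  using c by (simp add: christoffel_def chr_def cderiv_pd)

lemma cderiv_christoffel:
  assumes c: "c \<in> A" "p \<in> cdom c"
  shows "cderiv c (\<lambda>q. christoffel G c q v w) p u = pd u (\<lambda>x. chr (Gc c) x v w) (cmap c p)"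
  unfolding cderiv_pd[OF c]
  by (rule pd_cong[OF chart(2)[OF c(1)]]) (use c cinv_in[OF c(1)] in \<open>auto simp: christoffel_chr\<close>)

lemma riemann_riem:
  assumes c: "c \<in> A" "p \<in> cdom c"
  shows "riemann G c p u v w = riem (Gc c) (cmap c p) u v w"
  using c by (simp add: riemann_def riem_def cderiv_christoffel christoffel_chr)

lemma ricci_ric:
  assumes c: "c \<in> A" "p \<in> cdom c"
  shows "ricci G c p = ric (Gc c) (cmap c p)"
  using c by (simp add: fun_eq_iff ricci_def ric_def form_trace_def riemann_riem)

lemma outward_normal_outn:
  assumes c: "c \<in> A" "p \<in> cdom c"
  shows "outward_normal G c p = outn (Gc c) (cmap c p)"
  using c by (simp add: outward_normal_def outn_def)

lemma bdry_sff_bsff: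
  assumes c: "c \<in> A" "p \<in> cdom c"
  shows "bdry_sff G c p v w = bsff (Gc c) (cmap c p) v w"
proof -
  have "cderiv c (outward_normal G c) p v = pd v (outn (Gc c)) (cmap c p)"
    unfolding cderiv_pd[OF c]
    by (rule pd_cong[OF chart(2)[OF c(1)]]) (use c cinv_in[OF c(1)] in \<open>auto simp: outward_normal_outn\<close>)
  then show ?thesis using c by (simp add: bdry_sff_def bsff_def christoffel_chr outward_normal_outn)
qed

end

section \<open>Isometric maps between Riemannian atlases\<close>

locale isometric_map = S: riemannian_atlas S g + M: riemannian_atlas A G
  for S :: "('q::{t2_space,second_countable_topology}, 'b::euclidean_space \<times> real) chart set" and g
    and A :: "('p::{t2_space,second_countable_topology}, 'a::euclidean_space \<times> real) chart set" and G +
  fixes f :: "'q \<Rightarrow> 'p"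
  assumes cont: "continuous_on UNIV f"
    and smooth: "\<And>d. d \<in> A \<Longrightarrow> smooth_fun S (f -` cdom d) (cmap d \<circ> f)"
    and induced: "induced_metric S A G f g"
begin

abbreviation fc :: "('q, 'b \<times> real) chart \<Rightarrow> ('p, 'a \<times> real) chart \<Rightarrow> 'b \<times> real \<Rightarrow> 'a \<times> real" where
  "fc c d \<equiv> \<lambda>x. cmap d (f (cinv c x))"

lemma open_preimage: "d \<in> A \<Longrightarrow> open (f -` cdom d)"
  using cont M.chart(1) by (simp add: continuous_on_open_vimage)

lemma cderiv_fc:
  assumes "c \<in> S" "p \<in> cdom c"
  shows "cderiv c (cmap d \<circ> f) p = (\<lambda>v. pd v (fc c d) (cmap c p))"
  using assms by (simp add: fun_eq_iff S.cderiv_pd)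

lemma immersion_coordinates:
  assumes c: "c \<in> S" "d \<in> A"
  shows "isometric_immersion (cmap c ` (cdom c \<inter> f -` cdom d)) (S.Gc c) (cmap d ` cdom d) (M.Gc d) (fc c d)"
proof (intro isometric_immersion.intro isometric_immersion_axioms.intro)
  let ?U = "cmap c ` (cdom c \<inter> f -` cdom d)"
  show "coordinate_metric ?U (S.Gc c)"
    by (rule coordinate_metric_subset[OF S.coordinate[OF c(1)] S.hs_open_chart[OF c(1) open_preimage[OF c(2)]]]) auto
  show "coordinate_metric (cmap d ` cdom d) (M.Gc d)" by (rule M.coordinate[OF c(2)])
  show "smooth_on ?U (fc c d)" using S.smooth_fun_chart[OF smooth[OF c(2)] c(1)] by simp
  show "fc c d x \<in> cmap d ` cdom d" if "x \<in> ?U" for x using that c by auto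
  show "S.Gc c x v w = M.Gc d (fc c d x) (pd v (fc c d) x) (pd w (fc c d) x)" if x: "x \<in> ?U" for x v w
  proof -
    obtain p where p: "p \<in> cdom c" "f p \<in> cdom d" "x = cmap c p" using x by blast
    then have "g c p v w = G d (f p) (cderiv c (cmap d \<circ> f) p v) (cderiv c (cmap d \<circ> f) p w)"
      using induced c unfolding induced_metric_def by blast
    then show ?thesis using p c by (simp add: cderiv_fc)
  qed
qed

end

section \<open>Chart independence and continuity of curvature and gradient norm\<close>

context riemannian_atlas
begin

lemma isometric_map_id: "isometric_map A G A G (\<lambda>p. p)"
proof (intro isometric_map.intro isometric_map_axioms.intro)
  show "riemannian_atlas A G" "riemannian_atlas A G" by unfold_locales
  show "continuous_on UNIV (\<lambda>p::'p. p)" by simp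
  show "smooth_fun A ((\<lambda>p. p) -` cdom d) (cmap d \<circ> (\<lambda>p. p))" if "d \<in> A" for d
    using atlas that by (simp add: smooth_atlas_def o_def)
  show "induced_metric A A G (\<lambda>p. p) G"
    using riemannian by (simp add: riemannian_metric_def induced_metric_def o_def)
qed

lemma transition_isometry:
  assumes c: "c \<in> A" "d \<in> A"
  shows "isometric_immersion (cmap c ` (cdom c \<inter> cdom d)) (Gc c) (cmap d ` cdom d) (Gc d) (\<lambda>x. cmap d (cinv c x))"
  using isometric_map.immersion_coordinates[OF isometric_map_id c] by simp

lemma range_transition_pd:
  assumes c: "c \<in> A" "d \<in> A" "p \<in> cdom c" "p \<in> cdom d"
  shows "range (\<lambda>v. pd v (\<lambda>x. cmap d (cinv c x)) (cmap c p)) = UNIV"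
proof -
  have "(\<lambda>v. pd v (\<lambda>x. cmap d (cinv c x)) (cmap c p)) = cderiv c (cmap d) p"
    by (rule ext) (simp only: cderiv_pd[OF c(1,3)])
  with range_transition[OF c] show ?thesis by (simp only:)
qed

lemma scalar_curvature_chart:
  assumes c: "c \<in> A" "p \<in> cdom c"
  shows "scalar_curvature A G p = scal (Gc c) (cmap c p)"
proof -
  let ?d = "chart_at A p"
  note d = chart_at[of p]
  have "scalar_curvature A G p = scal (Gc ?d) (cmap ?d p)"
    using d by (simp add: scalar_curvature_def Let_def scal_def form_trace_def ricci_ric)
  also have "\<dots> = scal (Gc c) (cmap c p)"
    using isometric_immersion.scal_isometry[OF transition_isometry[OF c(1) d(1)] _ range_transition_pd[OF c(1) d(1) c(2) d(2)]]
      c d by auto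
  finally show ?thesis .
qed

lemma ricci_chart:
  assumes c: "c \<in> A" "d \<in> A" "p \<in> cdom c" "p \<in> cdom d"
  shows "ricci G d p (cderiv c (cmap d) p v) (cderiv c (cmap d) p w) = ricci G c p v w"
  using isometric_immersion.ric_isometry[OF transition_isometry[OF c(1,2)] _ range_transition_pd[OF c], of v w] c
  by (simp add: ricci_ric cderiv_pd)

text \<open>Transition maps preserve the boundary by \<open>bdry_chart_imp\<close>, and their
  differentials are onto, so the outward normal lies in the image.\<close>

lemma transition_boundary:
  assumes c: "c \<in> A" "d \<in> A"
  shows "boundary_immersion (cmap c ` (cdom c \<inter> cdom d)) (Gc c) (cmap d ` cdom d) (Gc d) (\<lambda>x. cmap d (cinv c x))"
proof (intro boundary_immersion.intro boundary_immersion_axioms.intro transition_isometry[OF c])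
  fix x assume "x \<in> cmap c ` (cdom c \<inter> cdom d)" and 0: "snd x = 0"
  then obtain p where p: "p \<in> cdom c" "p \<in> cdom d" "x = cmap c p" by auto
  show "snd (cmap d (cinv c x)) = 0" using bdry_chart_imp[OF c p(1,2)] 0 p c by simp
  show "outn (Gc d) (cmap d (cinv c x)) \<in> range (\<lambda>v. pd v (\<lambda>x. cmap d (cinv c x)) x)"
    using range_transition_pd[OF c p(1,2)] p(3) by simp
qed

lemma bdry_mean_curvature_chart:
  assumes c: "c \<in> A" "p \<in> cdom c" and p: "p \<in> bdry A"
  shows "bdry_mean_curvature A G p = bmean (Gc c) (cmap c p)"
proof -
  let ?d = "chart_at A p"
  note d = chart_at[of p]
  have "bdry_mean_curvature A G p = bmean (Gc ?d) (cmap ?d p)"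
    using d by (simp add: bdry_mean_curvature_def Let_def bmean_def form_trace_def bdry_sff_bsff)
  also have "\<dots> = bmean (Gc c) (cmap c p)"
    using boundary_immersion.bmean_isometry[OF transition_boundary[OF c(1) d(1)] _ _
        range_transition_pd[OF c(1) d(1) c(2) d(2)]] c d bdry_chart[OF c] p by auto
  finally show ?thesis .
qed

lemma continuous_scalar_curvature: "continuous_on UNIV (scalar_curvature A G)"
  by (rule continuous_on_chartsI[where H = "\<lambda>c. scal (Gc c)", OF _ scalar_curvature_chart])
    (rule smooth_on_imp_continuous_on[OF coordinate_metric.scal_smooth[OF coordinate]])

lemma continuous_bdry_mean_curvature: "continuous_on (bdry A) (bdry_mean_curvature A G)"
  by (rule continuous_on_chartsI[where H = "\<lambda>c. bmean (Gc c)", OF _ bdry_mean_curvature_chart])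
    (rule smooth_on_imp_continuous_on[OF coordinate_metric.bmean_smooth[OF coordinate]])

lemma continuous_smooth_fun:
  assumes "smooth_fun A UNIV \<phi>"
  shows "continuous_on UNIV \<phi>"
proof (rule continuous_on_chartsI)
  show "continuous_on (cmap c ` cdom c) (\<lambda>x. \<phi> (cinv c x))" if "c \<in> A" for c
    using smooth_on_imp_continuous_on[OF smooth_fun_chart[OF assms that]] by simp
qed simp

text \<open>The tensor square of the differential of \<open>\<phi>\<close>. Its trace is the squared
  gradient norm, which makes continuity and nonnegativity instances of facts about traces.\<close>

definition dform :: "('p \<Rightarrow> real) \<Rightarrow> ('p, 'a \<times> real) chart \<Rightarrow> 'a \<times> real \<Rightarrow> 'a \<times> real \<Rightarrow> 'a \<times> real \<Rightarrow> real" where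
  "dform \<phi> c x v w = pd v (\<lambda>x. \<phi> (cinv c x)) x * pd w (\<lambda>x. \<phi> (cinv c x)) x"

lemma dform_field:
  assumes \<phi>: "smooth_fun A UNIV \<phi>" and c: "c \<in> A"
  shows "bilinear_field (cmap c ` cdom c) (dform \<phi> c)"
proof -
  note hs = chart(2)[OF c]
  have sm: "smooth_on (cmap c ` cdom c) (\<lambda>x. \<phi> (cinv c x))" using smooth_fun_chart[OF \<phi> c] by simp
  have "bilinear (dform \<phi> c x)" if x: "x \<in> cmap c ` cdom c" for x
    unfolding bilinear_def dform_def using linear_pd[OF hs sm x]
    by (auto simp: linear_iff algebra_simps)
  moreover have "smooth_on (cmap c ` cdom c) (\<lambda>x. dform \<phi> c x v w)" for v w
    unfolding dform_def by (intro smooth_on_mult smooth_on_pd[OF hs sm])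
  ultimately show ?thesis by (simp add: bilinear_field_def)
qed

lemma grad_norm_sq_chart:
  assumes \<phi>: "smooth_fun A UNIV \<phi>" and c: "c \<in> A" "p \<in> cdom c"
  shows "grad_norm_sq A G \<phi> p = form_trace (Gc c (cmap c p)) UNIV (dform \<phi> c (cmap c p))"
proof -
  let ?d = "chart_at A p"
  note d = chart_at[of p]
  interpret D: coordinate_metric "cmap ?d ` cdom ?d" "Gc ?d" by (rule coordinate[OF d(1)])
  interpret C: coordinate_metric "cmap c ` cdom c" "Gc c" by (rule coordinate[OF c(1)])
  have x: "cmap ?d p \<in> cmap ?d ` cdom ?d" and xc: "cmap c p \<in> cmap c ` cdom c" using d c by auto
  have smd: "smooth_on (cmap ?d ` (cdom ?d \<inter> UNIV)) (\<lambda>x. \<phi> (cinv ?d x))" by (rule smooth_fun_chart[OF \<phi> d(1)])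
  let ?l = "\<lambda>u. pd u (\<lambda>x. \<phi> (cinv ?d x)) (cmap ?d p)" and ?b = "G ?d p"
  have b: "inner_form ?b" using D.inner[OF x] d by simp
  have l: "linear ?l" by (rule linear_pd[OF chart(2)[OF d(1)] _ x]) (use smd in simp)
  define z where "z = grad G ?d \<phi> p"
  have z: "?b z u = ?l u" for u
    unfolding z_def grad_def cderiv_pd[OF d] by (rule theI'[OF riesz_ex1[OF b l], THEN spec])
  \<comment> \<open>Parseval: the squared norm of the gradient is the sum of squares of its
    components, and these are derivatives of \<open>\<phi>\<close> along the basis.\<close>
  have "?b z z = ?b z (\<Sum>e\<in>onb ?b UNIV. ?b z e *\<^sub>R e)"
    by (rule arg_cong[OF orthonormal_basis_expand[OF b onb_orthonormal_basis[OF b subspace_UNIV] UNIV_I]])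
  also have "\<dots> = (\<Sum>e\<in>onb ?b UNIV. ?b z e * ?b z e)"
    unfolding linear_sum[OF bilinear_linear_right[OF inner_formD(1)[OF b]]] bilinear_rmul[OF inner_formD(1)[OF b]]
    by simp
  finally have "?b z z = (\<Sum>e\<in>onb ?b UNIV. ?b z e * ?b z e)" .
  then have "grad_norm_sq A G \<phi> p = form_trace (Gc ?d (cmap ?d p)) UNIV (dform \<phi> ?d (cmap ?d p))"
    using d by (simp add: grad_norm_sq_def Let_def z_def[symmetric] form_trace_def dform_def z)
  also have "\<dots> = form_trace (Gc c (cmap c p)) UNIV (dform \<phi> c (cmap c p))"
  proof -
    let ?T = "\<lambda>v. cderiv c (cmap ?d) p v"
    interpret I: isometric_immersion "cmap c ` (cdom c \<inter> cdom ?d)" "Gc c" "cmap ?d ` cdom ?d" "Gc ?d" "\<lambda>x. cmap ?d (cinv c x)"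
      by (rule transition_isometry[OF c(1) d(1)])
    have xi: "cmap c p \<in> cmap c ` (cdom c \<inter> cdom ?d)" using c d by auto
    have T: "linear ?T" using I.linear_dF[OF xi] by (simp add: cderiv_pd[OF c])
    have iso: "Gc c (cmap c p) v w = Gc ?d (cmap ?d p) (?T v) (?T w)" for v w
      using I.iso[OF xi, of v w] c by (simp add: cderiv_pd[OF c])
    have "dform \<phi> ?d (cmap ?d p) (?T v) (?T w) = dform \<phi> c (cmap c p) v w" for v w
      using cderiv_chain[OF c(1) d(1) c(2) d(2) open_UNIV UNIV_I smd, of v]
        cderiv_chain[OF c(1) d(1) c(2) d(2) open_UNIV UNIV_I smd, of w]
      by (simp add: dform_def cderiv_pd[OF c, of \<phi>] cderiv_pd[OF d, of \<phi>])
    then show ?thesis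
      using form_trace_isometry(1)[OF C.inner[OF xc] D.inner[OF x] T subspace_UNIV iso
          bilinear_fieldD(1)[OF dform_field[OF \<phi> d(1)] x]] range_transition[OF c(1) d(1) c(2) d(2)]
      by simp
  qed
  finally show ?thesis .
qed

lemma continuous_grad_norm_sq:
  assumes \<phi>: "smooth_fun A UNIV \<phi>"
  shows "continuous_on UNIV (grad_norm_sq A G \<phi>)"
proof (rule continuous_on_chartsI[where H = "\<lambda>c x. form_trace (Gc c x) UNIV (dform \<phi> c x)", OF _ grad_norm_sq_chart[OF \<phi>]])
  fix c assume c: "c \<in> A"
  show "continuous_on (cmap c ` cdom c) (\<lambda>x. form_trace (Gc c x) UNIV (dform \<phi> c x))"
    by (intro smooth_on_imp_continuous_on form_trace_smooth subspace_UNIV dform_field[OF \<phi> c]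
        coordinate_metric.metric[OF coordinate[OF c]])
qed

lemma grad_norm_sq_nonneg:
  assumes \<phi>: "smooth_fun A UNIV \<phi>"
  shows "0 \<le> grad_norm_sq A G \<phi> p"
  unfolding grad_norm_sq_chart[OF \<phi> chart_at] form_trace_def dform_def by (intro sum_nonneg) simp

end

text \<open>\<open>g\<close> is constrained only by the formula of the induced metric. That it is
  smooth, positive definite and compatible with chart changes is derived from the immersion and the
  ambient metric.\<close>

lemma induced_metric_riemannian:
  fixes S :: "('q::{t2_space,second_countable_topology}, 'b::euclidean_space \<times> real) chart set"
    and A :: "('p::{t2_space,second_countable_topology}, 'a::euclidean_space \<times> real) chart set"
  assumes "smooth_atlas A" "riemannian_metric A G" "smooth_atlas S" and imm: "immersion S A f"
    and ind: "induced_metric S A G f g"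
  shows "riemannian_metric S g"
proof -
  interpret S: atlas S by unfold_locales fact
  interpret M: riemannian_atlas A G by unfold_locales fact+
  have cont: "continuous_on UNIV f" and sm: "\<And>d. d \<in> A \<Longrightarrow> smooth_fun S (f -` cdom d) (cmap d \<circ> f)"
    and inj: "\<And>c d p. c \<in> S \<Longrightarrow> d \<in> A \<Longrightarrow> p \<in> cdom c \<Longrightarrow> f p \<in> cdom d \<Longrightarrow> inj (cderiv c (cmap d \<circ> f) p)"
    using imm by (auto simp: immersion_def)
  have op: "open (f -` cdom d)" if "d \<in> A" for d
    using cont M.chart(1)[OF that] by (simp add: continuous_on_open_vimage)
  define fc where "fc c d x = cmap d (f (cinv c x))" for c :: "('q, 'b \<times> real) chart" and d :: "('p, 'a \<times> real) chart" and x
  have cd: "cderiv c (cmap d \<circ> f) p v = pd v (fc c d) (cmap c p)" if "c \<in> S" "p \<in> cdom c" for c d p v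
    using that by (simp add: S.cderiv_pd fc_def[abs_def])
  have ind': "g c p v w = G d (f p) (cderiv c (cmap d \<circ> f) p v) (cderiv c (cmap d \<circ> f) p w)"
    if "c \<in> S" "d \<in> A" "p \<in> cdom c" "f p \<in> cdom d" for c d p v w
    using ind that unfolding induced_metric_def by blast
  let ?U = "\<lambda>c d. cmap c ` (cdom c \<inter> f -` cdom d)"
  have hs: "hs_open (?U c d)" if "c \<in> S" "d \<in> A" for c d by (rule S.hs_open_chart[OF that(1) op[OF that(2)]])
  have fsm: "smooth_on (?U c d) (fc c d)" if "c \<in> S" "d \<in> A" for c d
    using S.smooth_fun_chart[OF sm[OF that(2)] that(1)] by (simp add: fc_def[abs_def])
  have gsm: "smooth_on (?U c d) (\<lambda>x. g c (cinv c x) v w)" if c: "c \<in> S" "d \<in> A" for c d v w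
  proof (rule smooth_on_cong)
    interpret C: coordinate_metric "cmap d ` cdom d" "M.Gc d" by (rule M.coordinate[OF c(2)])
    have V: "fc c d x \<in> cmap d ` cdom d" if "x \<in> ?U c d" for x using that c by (auto simp: fc_def)
    show "smooth_on (?U c d) (\<lambda>x. M.Gc d (fc c d x) (pd v (fc c d) x) (pd w (fc c d) x))"
      by (intro bilinear_field_smooth[OF bilinear_field_compose[OF C.field fsm[OF c] V]] smooth_on_pd[OF hs[OF c] fsm[OF c]])
    fix x assume "x \<in> ?U c d"
    then obtain p where p: "p \<in> cdom c" "f p \<in> cdom d" "x = cmap c p" by blast
    then show "M.Gc d (fc c d x) (pd v (fc c d) x) (pd w (fc c d) x) = g c (cinv c x) v w"
      using ind'[OF c p(1,2), of v w] c by (simp add: cd fc_def)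
  qed
  have inner: "inner_form (g c p)" if c: "c \<in> S" and p: "p \<in> cdom c" for c p
  proof -
    let ?d = "chart_at A (f p)"
    note d = M.chart_at[of "f p"]
    let ?T = "cderiv c (cmap ?d \<circ> f) p"
    have i: "inner_form (G ?d (f p))"
      using metric_onD(2)[OF coordinate_metric.metric[OF M.coordinate[OF d(1)]], of "cmap ?d (f p)"] d by simp
    have x: "cmap c p \<in> ?U c ?d" using p d by auto
    have "?T = (\<lambda>v. pd v (fc c ?d) (cmap c p))" by (rule ext) (rule cd[OF c p])
    then have T: "linear ?T" using linear_pd[OF hs[OF c d(1)] fsm[OF c d(1)] x] by (simp only:)
    have g: "g c p v w = G ?d (f p) (?T v) (?T w)" for v w by (rule ind'[OF c d(1) p d(2)])
    have "bilinear (g c p)"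
      unfolding bilinear_def g
      using linear_compose[OF T bilinear_linear_left[OF inner_formD(1)[OF i]]]
        linear_compose[OF T bilinear_linear_right[OF inner_formD(1)[OF i]]] by (simp add: o_def)
    moreover have "g c p v w = g c p w v" for v w unfolding g by (rule inner_formD(2)[OF i])
    moreover have "0 < g c p v v" if "v \<noteq> 0" for v
    proof -
      \<comment> \<open>Injectivity of the differential is what makes the induced form
        definite.\<close>
      have "?T v \<noteq> ?T 0" using inj[OF c d(1) p d(2)] that by (metis injD)
      then show ?thesis unfolding g using inner_formD(3)[OF i] linear_0[OF T] by simp
    qed
    ultimately show ?thesis by (simp add: inner_form_def)
  qed
  have smooth: "smooth_fun S (cdom c) (\<lambda>p. g c p v w)" if c: "c \<in> S" for c v w
    unfolding smooth_fun_def o_def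
  proof (intro ballI smooth_on_local)
    fix c' x assume c': "c' \<in> S" and "x \<in> cmap c' ` (cdom c' \<inter> cdom c)"
    then obtain p where p: "p \<in> cdom c'" "p \<in> cdom c" "x = cmap c' p" by blast
    let ?d = "chart_at A (f p)"
    note d = M.chart_at[of "f p"]
    \<comment> \<open>Smoothness of \<open>g c\<close> was shown in its own chart. In the chart
      \<open>c'\<close> it follows near \<open>p\<close> by composition with the transition map, on
      the points that \<open>f\<close> sends into the ambient chart \<open>?d\<close>.\<close>
    define V where "V = cmap c' ` (cdom c' \<inter> (cdom c \<inter> f -` cdom ?d))"
    have "hs_open V"
      unfolding V_def by (rule S.hs_open_chart[OF c']) (use S.chart(1)[OF c] op[OF d(1)] in auto)
    then obtain Q where Q: "open Q" "V = half_space \<inter> Q" unfolding openin_open by blast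
    have "x \<in> V" unfolding V_def using p d by auto
    then have "x \<in> Q" using Q by auto
    have tr: "smooth_on V (\<lambda>x. cmap c (cinv c' x))"
      by (rule smooth_on_subset[OF S.smooth_transition[OF c' c]]) (auto simp: V_def)
    have V: "cmap c (cinv c' x) \<in> ?U c ?d" "cinv c (cmap c (cinv c' x)) = cinv c' x" if "x \<in> V" for x
      using that c c' by (auto simp: V_def)
    have "smooth_on V (\<lambda>x. g c (cinv c' x) v w)"
      by (rule smooth_on_cong[OF smooth_on_compose[OF gsm[OF c d(1), of v w] tr V(1)]]) (simp_all add: V(2))
    moreover have "cmap c' ` (cdom c' \<inter> cdom c) \<inter> Q \<subseteq> V"
      using hs_open_subset[OF S.chart(2)[OF c']] unfolding Q(2) by blast
    ultimately show "\<exists>W. open W \<and> x \<in> W \<and> smooth_on (cmap c' ` (cdom c' \<inter> cdom c) \<inter> W) (\<lambda>x. g c (cinv c' x) v w)"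
      using Q(1) \<open>x \<in> Q\<close> by (blast intro: smooth_on_subset)
  qed
  have trans: "g c p v w = g c' p (cderiv c (cmap c') p v) (cderiv c (cmap c') p w)"
    if c: "c \<in> S" "c' \<in> S" "p \<in> cdom c" "p \<in> cdom c'" for c c' p v w
  proof -
    let ?d = "chart_at A (f p)"
    note d = M.chart_at[of "f p"]
    have "cderiv c (cmap ?d \<circ> f) p v = cderiv c' (cmap ?d \<circ> f) p (cderiv c (cmap c') p v)" for v
      by (rule S.cderiv_chain[OF c op[OF d(1)]]) (use d fsm[OF c(2) d(1)] in \<open>auto simp: fc_def[abs_def]\<close>)
    then show ?thesis unfolding ind'[OF c(1) d(1) c(3) d(2)] ind'[OF c(2) d(1) c(4) d(2)] by simp
  qed
  show ?thesis
    unfolding riemannian_metric_def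
  proof (intro conjI ballI allI impI)
    fix c p v w assume cp: "c \<in> S" "p \<in> cdom c"
    show "bilinear (g c p)" "g c p v w = g c p w v" "v \<noteq> 0 \<Longrightarrow> 0 < g c p v v"
      using inner_formD(1-3)[OF inner[OF cp]] by blast+
  next
    fix c c' p v w assume "c \<in> S" "c' \<in> S" "p \<in> cdom c \<inter> cdom c'"
    then show "g c p v w = g c' p (cderiv c (cmap c') p v) (cderiv c (cmap c') p w)"
      by (intro trans) auto
  qed (rule smooth)
qed

section \<open>Two-sided hypersurfaces: traced Gauss equation and splitting of the boundary mean
  curvature\<close>

locale hypersurface = isometric_map S g A G f
  for S :: "('q::{t2_space,second_countable_topology}, 'b::euclidean_space \<times> real) chart set" and g
    and A :: "('p::{t2_space,second_countable_topology}, 'a::euclidean_space \<times> real) chart set" and G and f +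
  fixes N :: "('p, 'a \<times> real) chart \<Rightarrow> 'q \<Rightarrow> 'a \<times> real"
  assumes normal: "unit_normal_field S A G f N"
    and codim: "DIM('a) = DIM('b) + 1"
begin

lemma normal_smooth: "d \<in> A \<Longrightarrow> smooth_fun S (f -` cdom d) (N d)"
  and normal_chart: "d \<in> A \<Longrightarrow> d' \<in> A \<Longrightarrow> f p \<in> cdom d \<Longrightarrow> f p \<in> cdom d' \<Longrightarrow> N d' p = cderiv d (cmap d') (f p) (N d p)"
  and normal_unit: "d \<in> A \<Longrightarrow> f p \<in> cdom d \<Longrightarrow> G d (f p) (N d p) (N d p) = 1"
  and normal_orth: "c \<in> S \<Longrightarrow> d \<in> A \<Longrightarrow> p \<in> cdom c \<Longrightarrow> f p \<in> cdom d \<Longrightarrow>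
    G d (f p) (N d p) (cderiv c (cmap d \<circ> f) p v) = 0"
  using normal unfolding unit_normal_field_def by blast+

definition Nc where "Nc c d x = N d (cinv c x)"

context
  fixes c d
  assumes c: "c \<in> S" and d: "d \<in> A"
begin

interpretation I: isometric_immersion "cmap c ` (cdom c \<inter> f -` cdom d)" "S.Gc c" "cmap d ` cdom d" "M.Gc d" "fc c d"
  by (rule immersion_coordinates[OF c d])

lemma Nc_smooth: "smooth_on (cmap c ` (cdom c \<inter> f -` cdom d)) (Nc c d)"
  using S.smooth_fun_chart[OF normal_smooth[OF d] c] by (simp add: Nc_def[abs_def])

lemma Nc_normal:
  assumes x: "x \<in> cmap c ` (cdom c \<inter> f -` cdom d)"
  shows "M.Gc d (fc c d x) (Nc c d x) (Nc c d x) = 1" "M.Gc d (fc c d x) (Nc c d x) (pd v (fc c d) x) = 0"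
    "span (insert (Nc c d x) (range (\<lambda>v. pd v (fc c d) x))) = UNIV"
proof -
  obtain p where p: "p \<in> cdom c" "f p \<in> cdom d" "x = cmap c p" using x by blast
  show 1: "M.Gc d (fc c d x) (Nc c d x) (Nc c d x) = 1"
    using normal_unit[OF d p(2)] p c d by (simp add: Nc_def)
  show 2: "M.Gc d (fc c d x) (Nc c d x) (pd v (fc c d) x) = 0" for v
    using normal_orth[OF c d p(1,2), of v] p c d by (simp add: Nc_def cderiv_fc)
  let ?T = "\<lambda>v. pd v (fc c d) x"
  have T: "linear ?T" by (rule I.linear_dF[OF x])
  have "inj ?T"
    unfolding linear_injective_0[OF T]
  proof (intro allI impI)
    fix v assume "?T v = 0"
    then have "S.Gc c x v v = 0" using I.iso[OF x, of v v] bilinear_lzero[OF I.M.bil[OF I.FV[OF x]]] by simp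
    then show "v = 0" using inner_formD(4)[OF I.S.inner[OF x]] by simp
  qed
  \<comment> \<open>Dimension count: the differential is injective, so its range has dimension
    \<open>DIM('b) + 1\<close>. The normal lies outside the range and adds one, which by
    \<open>codim\<close> fills the ambient space.\<close>
  then have "dim (range ?T) = DIM('b) + 1" using dim_image_eq[OF T, of UNIV] by simp
  moreover have "Nc c d x \<notin> span (range ?T)"
  proof
    assume "Nc c d x \<in> span (range ?T)"
    also have "span (range ?T) = range ?T" using linear_span_image[OF T, of UNIV] by simp
    finally obtain v where "Nc c d x = ?T v" by blast
    then show False using 1 2[of v] by simp
  qed
  ultimately have "dim (insert (Nc c d x) (range ?T)) = DIM('a \<times> real)"
    using codim by (simp add: dim_insert)
  then show "span (insert (Nc c d x) (range ?T)) = UNIV" by (simp only: dim_eq_full)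
qed

lemma sff_nabla:
  assumes p: "p \<in> cdom c" "f p \<in> cdom d"
  shows "sff G f N c d p v w =
    M.Gc d (fc c d (cmap c p)) (I.nabla v (Nc c d) (cmap c p)) (pd w (fc c d) (cmap c p))"
proof -
  have "cderiv c (N d) p v = pd v (Nc c d) (cmap c p)" using c p by (simp add: S.cderiv_pd Nc_def[abs_def])
  then show ?thesis
    using c d p by (simp add: sff_def cderiv_fc I.nabla_def M.christoffel_chr Nc_def)
qed

lemma traced_gauss_chart:
  assumes p: "p \<in> cdom c" "f p \<in> cdom d"
  shows "scalar_curvature A G (f p) = scalar_curvature S g p
    - (\<Sum>e\<in>onb (g c p) UNIV. sff G f N c d p e e)\<^sup>2
    + (\<Sum>e\<in>onb (g c p) UNIV. \<Sum>e'\<in>onb (g c p) UNIV. (sff G f N c d p e e')\<^sup>2)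
    + 2 * ricci G d (f p) (N d p) (N d p)"
proof -
  have x: "cmap c p \<in> cmap c ` (cdom c \<inter> f -` cdom d)" using p by auto
  from I.scal_hypersurface[OF x Nc_smooth Nc_normal(1,2) Nc_normal(3)[OF x] sff_nabla[OF p]]
  show ?thesis
    using c d p by (simp add: S.scalar_curvature_chart M.scalar_curvature_chart Nc_def M.ricci_ric)
qed

text \<open>The definition uses the chart selected at \<open>f p\<close>. The transformation rules
  of \<open>N\<close> and of the Ricci tensor permit a fixed ambient chart, as needed for
  continuity.\<close>

lemma ricci_normal_chart:
  assumes p: "f p \<in> cdom d"
  shows "ricci_normal A G f N p = ricci G d (f p) (N d p) (N d p)"
  using normal_chart[OF d M.chart_at(1) p M.chart_at(2)] M.ricci_chart[OF d M.chart_at(1) p M.chart_at(2)]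
  by (simp add: ricci_normal_def Let_def)

lemma continuous_ricci_normal_chart: "continuous_on (cdom c \<inter> f -` cdom d) (ricci_normal A G f N)"
proof (rule S.continuous_on_chartI[OF c open_preimage[OF d]])
  show "continuous_on (cmap c ` (cdom c \<inter> f -` cdom d)) (\<lambda>x. ric (M.Gc d) (fc c d x) (Nc c d x) (Nc c d x))"
    by (intro smooth_on_imp_continuous_on bilinear_field_smooth[OF bilinear_field_compose[OF I.M.ric_field I.F I.FV]] Nc_smooth)
  show "ricci_normal A G f N p = ric (M.Gc d) (fc c d (cmap c p)) (Nc c d (cmap c p)) (Nc c d (cmap c p))"
    if p: "p \<in> cdom c \<inter> f -` cdom d" for p
    using p c d by (simp add: ricci_normal_chart M.ricci_ric Nc_def)
qed

end

lemma continuous_ricci_normal: "continuous_on UNIV (ricci_normal A G f N)"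
proof (rule S.continuous_on_local)
  fix p
  show "\<exists>W. open W \<and> p \<in> W \<and> continuous_on (UNIV \<inter> W) (ricci_normal A G f N)"
    using continuous_ricci_normal_chart[OF S.chart_at(1)[of p] M.chart_at(1)[of "f p"]]
      S.chart_at[of p] M.chart_at[of "f p"] S.chart(1)[OF S.chart_at(1)[of p]] open_preimage[OF M.chart_at(1)[of "f p"]]
    by (intro exI[of _ "cdom (chart_at S p) \<inter> f -` cdom (chart_at A (f p))"]) auto
qed

lemma traced_gauss:
  "scalar_curvature A G (f p) = scalar_curvature S g p - (mean_curvature S A G f g N p)\<^sup>2
    + sff_norm_sq S A G f g N p + 2 * ricci_normal A G f N p"
  using traced_gauss_chart[OF S.chart_at(1) M.chart_at(1) S.chart_at(2) M.chart_at(2)]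
  by (simp add: mean_curvature_def sff_norm_sq_def ricci_normal_def Let_def)

lemma sff_norm_sq_nonneg: "0 \<le> sff_norm_sq S A G f g N p"
  unfolding sff_norm_sq_def Let_def by (intro sum_nonneg) simp

text \<open>Orthogonality of the two normals is used twice: it makes the ambient outward normal
  tangent to the hypersurface, as \<open>boundary_immersion\<close> demands, and it makes
  \<open>N\<close> tangent to the ambient boundary.\<close>

lemma bdry_mean_curvature_free_boundary:
  assumes bd: "f ` bdry S \<subseteq> bdry A" and free: "free_boundary S A G f N" and p: "p \<in> bdry S"
  shows "bdry_mean_curvature A G (f p) = bdry_mean_curvature S g p + bdry_sff_normal A G f N p"
proof -
  let ?c = "chart_at S p" and ?d = "chart_at A (f p)"
  note c = S.chart_at[of p] and d = M.chart_at[of "f p"]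
  let ?U = "cmap ?c ` (cdom ?c \<inter> f -` cdom ?d)"
  interpret I: isometric_immersion ?U "S.Gc ?c" "cmap ?d ` cdom ?d" "M.Gc ?d" "fc ?c ?d"
    by (rule immersion_coordinates[OF c(1) d(1)])
  have orth: "M.Gc ?d (fc ?c ?d x) (Nc ?c ?d x) (outn (M.Gc ?d) (fc ?c ?d x)) = 0"
    if x: "x \<in> ?U" "snd x = 0" for x
  proof -
    obtain q where q: "q \<in> cdom ?c" "f q \<in> cdom ?d" "x = cmap ?c q" using x(1) by blast
    then have "q \<in> bdry S" using S.bdry_chart[OF c(1) q(1)] x(2) by simp
    then have "G ?d (f q) (N ?d q) (outward_normal G ?d (f q)) = 0"
      using free d(1) q(2) unfolding free_boundary_def by blast
    then show ?thesis using q c d by (simp add: Nc_def M.outward_normal_outn)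
  qed
  interpret B: boundary_immersion ?U "S.Gc ?c" "cmap ?d ` cdom ?d" "M.Gc ?d" "fc ?c ?d"
  proof
    fix x assume x: "x \<in> ?U" "snd x = 0"
    obtain q where q: "q \<in> cdom ?c" "f q \<in> cdom ?d" "x = cmap ?c q" using x(1) by blast
    then have "f q \<in> bdry A" using S.bdry_chart[OF c(1) q(1)] x(2) bd by auto
    then show "snd (fc ?c ?d x) = 0" using M.bdry_chart[OF d(1) q(2)] q c by simp
    show "outn (M.Gc ?d) (fc ?c ?d x) \<in> range (\<lambda>v. pd v (fc ?c ?d) x)"
      using I.immersion_decompose[OF x(1) Nc_normal[OF c(1) d(1) x(1)], of "outn (M.Gc ?d) (fc ?c ?d x)"]
      by (auto simp: orth[OF x])
  qed
  have x: "cmap ?c p \<in> ?U" "snd (cmap ?c p) = 0" using c d S.bdry_chart[OF c] p by auto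
  have "snd (Nc ?c ?d (cmap ?c p)) = 0"
    by (rule I.M.outn_orthogonal[OF I.FV[OF x(1)] orth[OF x]])
  from B.bmean_hypersurface[OF x Nc_normal[OF c(1) d(1) x(1)] this]
  show ?thesis
    using c d p bd by (auto simp: M.bdry_mean_curvature_chart S.bdry_mean_curvature_chart bdry_sff_normal_def Let_def
        M.bdry_sff_bsff Nc_def)
qed

end

section \<open>Finiteness of the volume measures\<close>

lemma sets_glue_measure [measurable_cong, simp]: "sets (glue_measure A m) = sets borel"
  using sets.sigma_sets_eq[of borel] by (simp add: glue_measure_def sets_measure_of_conv)

lemma space_glue_measure [simp]: "space (glue_measure A m) = UNIV"
  by (simp add: glue_measure_def space_measure_of_conv)

text \<open>\<open>measure_of\<close> assigns 0 unless the given set function is a measure on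
  measurable sets. Either way the infimum is an upper bound, and each admissible covering bounds the
  infimum.\<close>

lemma emeasure_glue_measure_le:
  fixes c :: "nat \<Rightarrow> ('p::topological_space, 'e) chart"
  assumes "\<And>k. c k \<in> A" "\<And>k. B k \<in> sets borel" "\<And>k. B k \<subseteq> cdom (c k)" "E \<subseteq> (\<Union>k. B k)"
  shows "emeasure (glue_measure A m) E \<le> (\<Sum>k. m (c k) (B k))"
proof -
  let ?\<mu> = "\<lambda>E. INF (c, B) \<in> {(c, B). (\<forall>k::nat. c k \<in> A \<and> B k \<in> sets borel \<and> B k \<subseteq> cdom (c k)) \<and>
                              E \<subseteq> (\<Union>k. B k)}. \<Sum>k. m (c k) (B k)"
  have "emeasure (glue_measure A m) E \<le> ?\<mu> E"
    unfolding glue_measure_def emeasure_measure_of_conv by simp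
  also have "\<dots> \<le> (\<Sum>k. m (c k) (B k))"
    by (rule INF_lower2[of "(c, B)"]) (use assms in auto)
  finally show ?thesis .
qed

text \<open>Compactness leaves finitely many pieces of finite content, whose sum bounds the total
  mass.\<close>

lemma finite_glue_measure:
  fixes A :: "('p::topological_space, 'e) chart set"
  assumes comp: "compact (UNIV :: 'p set)" and empty: "\<And>c. m c {} = 0"
    and nb: "\<And>p. \<exists>c\<in>A. \<exists>B. open B \<and> p \<in> B \<and> B \<subseteq> cdom c \<and> m c B < \<infinity>"
  shows "finite_measure (glue_measure A m)"
proof
  obtain c B where cB: "\<And>p. c p \<in> A" "\<And>p. open (B p)" "\<And>p. p \<in> B p" "\<And>p. B p \<subseteq> cdom (c p)"
    "\<And>p. m (c p) (B p) < \<infinity>"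
    using nb by metis
  obtain P where P: "finite P" "UNIV \<subseteq> (\<Union>p\<in>P. B p)"
    by (rule compactE_image[OF comp, of UNIV B]) (use cB in auto)
  obtain xs where xs: "set xs = P" using finite_list[OF P(1)] by blast
  \<comment> \<open>Coverings are indexed by all naturals, so the finite list is continued with a
    dummy chart and empty pieces, which have content 0.\<close>
  define q where "q k = xs ! (if k < length xs then k else 0)" for k
  define B' where "B' k = (if k < length xs then B (q k) else {})" for k
  have "emeasure (glue_measure A m) UNIV \<le> (\<Sum>k. m (c (q k)) (B' k))"
  proof (rule emeasure_glue_measure_le)
    show "UNIV \<subseteq> (\<Union>k. B' k)"
    proof
      fix p :: 'p
      obtain p' where "p' \<in> set xs" "p \<in> B p'" using P(2) xs by blast
      then obtain k where "k < length xs" "p \<in> B (xs ! k)" by (metis in_set_conv_nth)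
      then show "p \<in> (\<Union>k. B' k)" by (intro UN_I[of k]) (auto simp: B'_def q_def)
    qed
  qed (use cB in \<open>auto simp: B'_def\<close>)
  also have "\<dots> = (\<Sum>k<length xs. m (c (q k)) (B' k))"
    by (rule suminf_finite) (auto simp: B'_def empty)
  also have "\<dots> < \<infinity>"
    by (simp add: B'_def) (use cB(5) in \<open>simp add: less_top[symmetric]\<close>)
  finally show "emeasure (glue_measure A m) (space (glue_measure A m)) \<noteq> \<infinity>" by simp
qed

lemma continuous_on_gram_det:
  assumes "bilinear_field U \<gamma>"
  shows "continuous_on U (\<lambda>x. sqrt (gram_det (\<gamma> x) B))"
  unfolding gram_det_def
  by (intro continuous_intros smooth_on_imp_continuous_on bilinear_fieldD(2)[OF assms])

context riemannian_atlas
begin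

text \<open>A small closed coordinate ball meets the half-space in a compact subset of the chart
  image, on which the density is bounded. \<open>E\<close> is free: all basis vectors for the
  volume, those tangent to the boundary for the boundary volume.\<close>

lemma chart_neighbourhood:
  assumes c: "c \<in> A" "p \<in> cdom c"
  obtains r M B where "open B" "p \<in> B" "B \<subseteq> cdom c" "cmap c ` B \<subseteq> cball (cmap c p) r"
    "\<And>y. y \<in> cmap c ` B \<Longrightarrow> sqrt (gram_det (Gc c y) E) \<le> M"
proof -
  let ?d = "\<lambda>y. sqrt (gram_det (Gc c y) E)"
  obtain Q where Q: "open Q" "cmap c ` cdom c = half_space \<inter> Q"
    using chart(2)[OF c(1)] unfolding openin_open by blast
  then have "cmap c p \<in> Q" using c by auto
  then obtain r where r: "r > 0" "cball (cmap c p) r \<subseteq> Q" using Q(1) open_contains_cball by blast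
  let ?K = "cball (cmap c p) r \<inter> half_space" and ?B = "cdom c \<inter> cmap c -` ball (cmap c p) r"
  have "closed (half_space :: ('a \<times> real) set)"
    unfolding half_space_def by (intro closed_Collect_le continuous_intros)
  then have "compact ?K" by (intro compact_Int_closed compact_cball)
  moreover have "continuous_on ?K ?d"
    by (rule continuous_on_subset[OF continuous_on_gram_det])
      (use Q r metric_onD(1)[OF coordinate_metric.metric[OF coordinate[OF c(1)]]] in blast)+
  ultimately have "bounded (?d ` ?K)" by (intro compact_imp_bounded compact_continuous_image)
  then obtain M where M: "\<forall>y\<in>?d ` ?K. \<bar>y\<bar> \<le> M" by (auto simp: bounded_real)
  have B: "cmap c ` ?B \<subseteq> ?K" using hs_open_subset[OF chart(2)[OF c(1)]] by auto
  show thesis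
  proof (rule that[of ?B r M])
    show "open ?B"
      using continuous_on_open_vimage[OF chart(1)[OF c(1)]] continuous_cmap[OF c(1)] by (metis Int_commute open_ball)
    fix y assume "y \<in> cmap c ` ?B"
    then have "\<bar>?d y\<bar> \<le> M" using B M by blast
    then show "?d y \<le> M" by simp
  qed (use c r B in auto)
qed

lemma chart_volume_finite: "\<exists>c\<in>A. \<exists>B. open B \<and> p \<in> B \<and> B \<subseteq> cdom c \<and> chart_volume G c B < \<infinity>"
proof -
  let ?c = "chart_at A p"
  note c = chart_at[of p]
  obtain r M B where B: "open B" "p \<in> B" "B \<subseteq> cdom ?c" "cmap ?c ` B \<subseteq> cball (cmap ?c p) r"
    "\<And>y. y \<in> cmap ?c ` B \<Longrightarrow> sqrt (gram_det (Gc ?c y) Basis) \<le> M"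
    by (rule chart_neighbourhood[OF c, of Basis]) blast
  have "chart_volume G ?c B \<le> (\<integral>\<^sup>+x. ennreal M * indicator (cball (cmap ?c p) r) x \<partial>lborel)"
    unfolding chart_volume_def
  proof (rule nn_integral_mono)
    fix x
    show "ennreal (sqrt (gram_det (Gc ?c x) Basis)) * indicator (cmap ?c ` B) x
      \<le> ennreal M * indicator (cball (cmap ?c p) r) x"
      using subsetD[OF B(4), of x] B(5)[of x] by (cases "x \<in> cmap ?c ` B") (simp_all add: ennreal_leI)
  qed
  also have "\<dots> = ennreal M * emeasure lborel (cball (cmap ?c p) r)"
    by (rule nn_integral_cmult_indicator) simp
  also have "\<dots> < \<infinity>"
    using emeasure_compact_finite[OF compact_cball, of "cmap ?c p" r] by (simp add: ennreal_mult_less_top)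
  finally show ?thesis using B c by blast
qed

lemma chart_bdry_volume_finite: "\<exists>c\<in>A. \<exists>B. open B \<and> p \<in> B \<and> B \<subseteq> cdom c \<and> chart_bdry_volume G c B < \<infinity>"
proof -
  let ?c = "chart_at A p" and ?E = "(\<lambda>b. (b, 0)) ` Basis :: ('a \<times> real) set"
  note c = chart_at[of p]
  obtain r M B where B: "open B" "p \<in> B" "B \<subseteq> cdom ?c" "cmap ?c ` B \<subseteq> cball (cmap ?c p) r"
    "\<And>y. y \<in> cmap ?c ` B \<Longrightarrow> sqrt (gram_det (Gc ?c y) ?E) \<le> M"
    by (rule chart_neighbourhood[OF c, of ?E]) blast
  let ?K = "cball (fst (cmap ?c p)) r"
  have sub: "y \<in> ?K" if "(y, 0) \<in> cmap ?c ` B" for y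
  proof -
    have "dist (cmap ?c p) (y, 0) \<le> r" using that B(4) by auto
    then show ?thesis using dist_fst_le[of "cmap ?c p" "(y, 0)"] by simp
  qed
  have "chart_bdry_volume G ?c B \<le> (\<integral>\<^sup>+y. ennreal M * indicator ?K y \<partial>lborel)"
    unfolding chart_bdry_volume_def
  proof (rule nn_integral_mono)
    fix y :: 'a
    show "ennreal (sqrt (gram_det (Gc ?c (y, 0)) ?E)) * indicator {y. (y, 0) \<in> cmap ?c ` B} y
      \<le> ennreal M * indicator ?K y"
      using sub[of y] B(5)[of "(y, 0)"] by (cases "(y, 0) \<in> cmap ?c ` B") (simp_all add: ennreal_leI)
  qed
  also have "\<dots> = ennreal M * emeasure lborel ?K"
    by (rule nn_integral_cmult_indicator) simp
  also have "\<dots> < \<infinity>"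
    using emeasure_compact_finite[OF compact_cball, of "fst (cmap ?c p)" r] by (simp add: ennreal_mult_less_top)
  finally show ?thesis using B c by blast
qed

lemma finite_volume_measure: "compact (UNIV :: 'p set) \<Longrightarrow> finite_measure (volume_measure A G)"
  unfolding volume_measure_def
  by (rule finite_glue_measure[OF _ _ chart_volume_finite]) (simp_all add: chart_volume_def)

lemma finite_bdry_measure: "compact (UNIV :: 'p set) \<Longrightarrow> finite_measure (bdry_measure A G)"
  unfolding bdry_measure_def
  by (rule finite_glue_measure[OF _ _ chart_bdry_volume_finite]) (simp_all add: chart_bdry_volume_def)

end

section \<open>Integral inequalities\<close>

lemma set_integrable_continuous_compact:
  fixes h :: "'p::topological_space \<Rightarrow> real"
  assumes M: "finite_measure M" "sets M = sets borel" and B: "compact B" "closed B" and h: "continuous_on B h"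
  shows "set_integrable M B h"
proof -
  interpret finite_measure M by fact
  have "bounded (h ` B)" by (intro compact_imp_bounded compact_continuous_image h B)
  then obtain C where C: "\<And>x. x \<in> B \<Longrightarrow> \<bar>h x\<bar> \<le> C" by (auto simp: bounded_real)
  have "(\<lambda>x. indicator B x *\<^sub>R h x) \<in> borel_measurable borel"
    by (rule borel_measurable_continuous_on_indicator[OF _ h]) (use B in auto)
  then have "(\<lambda>x. indicator B x *\<^sub>R h x) \<in> borel_measurable M"
    using measurable_cong_sets[OF M(2) refl] by blast
  moreover have "norm (indicator B x *\<^sub>R h x) \<le> \<bar>C\<bar>" for x
    using C[of x] by (cases "x \<in> B") auto
  ultimately show ?thesis
    unfolding set_integrable_def by (intro integrable_const_bound[OF AE_I2])
qed

text \<open>Hoelder's inequality against the constant 1, obtained by integrating an affine upper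
  bound of \<open>w powr \<theta>\<close>. The optimal one is the tangent at the mean value of
  \<open>w\<close>; the bound \<open>\<delta>\<close> keeps this mean positive.\<close>

lemma set_integral_powr_le:
  fixes w :: "'p \<Rightarrow> real"
  assumes M: "finite_measure M" and B: "B \<in> sets M" and \<theta>: "0 < \<theta>" "\<theta> < 1"
    and w: "set_integrable M B w" and w\<theta>: "set_integrable M B (\<lambda>x. w x powr \<theta>)"
    and \<delta>: "0 < \<delta>" "\<And>x. x \<in> B \<Longrightarrow> \<delta> \<le> w x"
  shows "(LINT x:B|M. w x powr \<theta>) \<le> (LINT x:B|M. w x) powr \<theta> * measure M B powr (1 - \<theta>)"
proof -
  interpret finite_measure M by fact
  let ?V = "measure M B" and ?a = "LINT x:B|M. w x"
  have const: "set_integrable M B (\<lambda>x. c)" for c :: real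
    unfolding set_integrable_def using B
    by (intro integrable_scaleR_left integrable_real_indicator) (auto simp: less_top[symmetric])
  have iconst: "(LINT x:B|M. c) = c * ?V" for c :: real
    using B by (simp add: set_lebesgue_integral_def)
  have affine: "(LINT x:B|M. w x powr \<theta>) \<le> c * ?a + d * ?V"
    if "\<And>x. x \<in> B \<Longrightarrow> w x powr \<theta> \<le> c * w x + d" for c d
  proof -
    have "(LINT x:B|M. w x powr \<theta>) \<le> (LINT x:B|M. c * w x + d)"
      by (intro set_integral_mono w\<theta> set_integral_add set_integrable_mult_right w const that)
    also have "\<dots> = c * ?a + d * ?V"
      by (simp add: set_integral_add set_integrable_mult_right[OF w] const iconst)
    finally show ?thesis .
  qed
  have a: "\<delta> * ?V \<le> ?a"
    using set_integral_mono[OF const w \<delta>(2)] by (simp add: iconst)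
  show ?thesis
  proof (cases "?V = 0")
    case True
    have "?a = 0"
    proof -
      have "AE x in M. indicator B x *\<^sub>R w x = 0"
        using True B by (intro AE_I[of _ _ B]) (auto simp: emeasure_eq_measure indicator_def)
      then show ?thesis unfolding set_lebesgue_integral_def by (rule integral_eq_zero_AE)
    qed
    \<comment> \<open>On a null set there is no mean value to use. A crude affine bound suffices,
      because both integrals in it vanish.\<close>
    moreover have "w x powr \<theta> \<le> 1 * w x + 1" if "x \<in> B" for x
    proof -
      have "w x > 0" using \<delta> that by force
      then have "w x powr \<theta> * 1 powr (1 - \<theta>) \<le> \<theta> * w x + (1 - \<theta>) * 1"
        using \<theta> by (intro Youngs_inequality_0) auto
      also have "\<dots> \<le> 1 * w x + 1" using \<theta> \<open>w x > 0\<close> by (intro add_mono mult_right_mono) auto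
      finally show ?thesis by simp
    qed
    ultimately show ?thesis using affine[of 1 1] True by simp
  next
    case False
    then have V: "?V > 0" by (simp add: zero_less_measure_iff less_le)
    then have a0: "?a > 0" using a \<delta>(1) by (smt (verit) mult_pos_pos)
    \<comment> \<open>Young's inequality with the mean value of \<open>w\<close> as second factor\<close>
    define y where "y = ?a / ?V"
    have y: "y > 0" using V a0 by (simp add: y_def)
    have "w x powr \<theta> \<le> (\<theta> * y powr (\<theta> - 1)) * w x + (1 - \<theta>) * y powr \<theta>" if "x \<in> B" for x
    proof -
      have "w x > 0" using \<delta> that by force
      then have "w x powr \<theta> * y powr (1 - \<theta>) \<le> \<theta> * w x + (1 - \<theta>) * y"
        using \<theta> y by (intro Youngs_inequality_0) auto
      then have "w x powr \<theta> * y powr (1 - \<theta>) * y powr (\<theta> - 1) \<le> (\<theta> * w x + (1 - \<theta>) * y) * y powr (\<theta> - 1)"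
        by (rule mult_right_mono) simp
      also have "w x powr \<theta> * y powr (1 - \<theta>) * y powr (\<theta> - 1) = w x powr \<theta>"
        using y by (simp add: mult.assoc powr_add[symmetric])
      also have "(\<theta> * w x + (1 - \<theta>) * y) * y powr (\<theta> - 1)
          = (\<theta> * y powr (\<theta> - 1)) * w x + (1 - \<theta>) * (y * y powr (\<theta> - 1))"
        by (simp add: algebra_simps)
      also have "y * y powr (\<theta> - 1) = y powr \<theta>"
        using y by (simp add: powr_mult_base)
      finally show ?thesis .
    qed
    from affine[OF this] have "(LINT x:B|M. w x powr \<theta>) \<le> \<theta> * y powr (\<theta> - 1) * ?a + (1 - \<theta>) * y powr \<theta> * ?V" .
    \<comment> \<open>Since \<open>?a\<close> is the mean times the measure, both summands are
      multiples of \<open>y powr \<theta> * ?V\<close>, with weights \<open>\<theta>\<close> and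
      \<open>1 - \<theta>\<close>.\<close>
    also have "y powr (\<theta> - 1) * ?a = y powr \<theta> * ?V"
    proof -
      have "y powr (\<theta> - 1) * ?a = y powr (\<theta> - 1) * y * ?V" using V by (simp add: y_def)
      also have "y powr (\<theta> - 1) * y = y powr \<theta>" using y by (simp add: powr_mult_base mult.commute)
      finally show ?thesis .
    qed
    then have "\<theta> * y powr (\<theta> - 1) * ?a + (1 - \<theta>) * y powr \<theta> * ?V = y powr \<theta> * ?V"
      by (simp add: mult.assoc) (simp add: algebra_simps)
    also have "y powr \<theta> * ?V = ?a powr \<theta> * ?V powr (1 - \<theta>)"
      using V a0 by (simp add: y_def powr_divide powr_diff)
    finally show ?thesis .
  qed
qed

text \<open>Hoelder's inequality for \<open>\<phi> powr (2 / \<theta>)\<close>, whose power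
  \<open>\<theta>\<close> is the square of \<open>\<phi>\<close>. The minimum of
  \<open>\<phi>\<close> on the compact set yields the positive lower bound; the empty set, having no
  minimum, is treated apart.\<close>

lemma set_integral_square_le:
  fixes \<phi> :: "'p::topological_space \<Rightarrow> real"
  assumes M: "finite_measure M" "sets M = sets borel" and B: "compact B" "closed B"
    and \<phi>: "continuous_on B \<phi>" "\<And>x. x \<in> B \<Longrightarrow> \<phi> x > 0" and \<theta>: "0 < \<theta>" "\<theta> < 1"
  shows "(LINT x:B|M. (\<phi> x)\<^sup>2) \<le> (LINT x:B|M. \<phi> x powr (2 / \<theta>)) powr \<theta> * measure M B powr (1 - \<theta>)"
proof (cases "B = {}")
  case False
  obtain x0 where x0: "x0 \<in> B" "\<And>x. x \<in> B \<Longrightarrow> \<phi> x0 \<le> \<phi> x"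
    using continuous_attains_inf[OF B(1) False \<phi>(1)] by blast
  have eq: "(\<phi> x powr (2 / \<theta>)) powr \<theta> = (\<phi> x)\<^sup>2" if "x \<in> B" for x
    using \<phi>(2)[OF that] \<theta> by (simp add: powr_powr powr_numeral)
  have ne: "\<phi> x \<noteq> 0" if "x \<in> B" for x using \<phi>(2)[OF that] by simp
  have cont: "continuous_on B (\<lambda>x. \<phi> x powr (2 / \<theta>))"
    by (intro continuous_on_powr continuous_on_const \<phi>(1)) (use ne in auto)
  have cont2: "continuous_on B (\<lambda>x. (\<phi> x powr (2 / \<theta>)) powr \<theta>)"
    by (rule continuous_on_eq[OF continuous_on_power[OF \<phi>(1), of 2]]) (simp add: eq)
  have sB: "B \<in> sets M" using M(2) B by auto
  have "(LINT x:B|M. (\<phi> x)\<^sup>2) = (LINT x:B|M. (\<phi> x powr (2 / \<theta>)) powr \<theta>)"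
    by (rule set_lebesgue_integral_cong[OF sB]) (simp add: eq)
  also have "\<dots> \<le> (LINT x:B|M. \<phi> x powr (2 / \<theta>)) powr \<theta> * measure M B powr (1 - \<theta>)"
  proof (rule set_integral_powr_le[OF M(1) sB \<theta> _ _ ])
    show "\<phi> x0 powr (2 / \<theta>) > 0" using \<phi>(2)[OF x0(1)] by simp
    show "\<phi> x0 powr (2 / \<theta>) \<le> \<phi> x powr (2 / \<theta>)" if "x \<in> B" for x
      using \<phi>(2)[OF x0(1)] x0(2)[OF that] \<theta> by (intro powr_mono2) auto
  qed (intro set_integrable_continuous_compact M B cont cont2)+
  finally show ?thesis .
qed (simp add: set_lebesgue_integral_def)

text \<open>The bound on \<open>q\<close> keeps the infimum above minus infinity and
  \<open>\<sigma> < 0\<close> keeps it and \<open>\<sigma>\<close> below plus infinity, so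
  everything happens in the reals, where division by the negative \<open>k * r\<close> reverses both
  inequalities. The factor \<open>k\<close> is 1 for the volume and 2 for the boundary.\<close>

lemma ereal_bounds_of_INF:
  fixes q :: "'i \<Rightarrow> real" and k r V :: real
  assumes r: "r < 0" and k: "k > 0" and I: "I \<noteq> {}" and q: "\<And>i. i \<in> I \<Longrightarrow> k * r * V \<le> q i"
    and \<sigma>: "(INF i\<in>I. ereal (q i)) \<le> \<sigma>" "\<sigma> < 0"
  shows "ereal (1 / k) * ((INF i\<in>I. ereal (q i)) / ereal r) \<le> ereal V"
    "ereal (1 / k) * (\<sigma> / ereal r) \<le> ereal (1 / k) * ((INF i\<in>I. ereal (q i)) / ereal r)"
proof -
  have C: "ereal (k * r * V) \<le> (INF i\<in>I. ereal (q i))" using q by (intro INF_greatest) simp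
  then obtain c where c: "(INF i\<in>I. ereal (q i)) = ereal c"
    using \<sigma> by (cases "INF i\<in>I. ereal (q i)") auto
  obtain s where s: "\<sigma> = ereal s" using \<sigma> c by (cases \<sigma>) auto
  have kr: "k * r < 0" using r k by (rule mult_pos_neg[rotated])
  have "k * r * V \<le> c" "c \<le> s" using C \<sigma> by (simp_all add: c s)
  then have "c / (k * r) \<le> V" "s / (k * r) \<le> c / (k * r)"
    using kr by (simp add: neg_divide_le_eq[OF kr] mult.commute, intro divide_right_mono_neg) auto
  moreover have "ereal (1 / k) * (ereal a / ereal r) = ereal (a / (k * r))" for a
    using r k by (simp add: ereal_divide)
  ultimately show "ereal (1 / k) * ((INF i\<in>I. ereal (q i)) / ereal r) \<le> ereal V"
    "ereal (1 / k) * (\<sigma> / ereal r) \<le> ereal (1 / k) * ((INF i\<in>I. ereal (q i)) / ereal r)"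
    by (simp_all add: c s)
qed

text \<open>A vanishing denominator is harmless: division by 0 yields 0, and the left-hand side is
  nonpositive.\<close>

lemma quotient_lower_bound:
  fixes E a D r :: real
  assumes "r * (a * D) \<le> E" "r \<le> 0" "0 \<le> a" "0 \<le> D"
  shows "r * D \<le> E / a"
proof (cases "a = 0")
  case True then show ?thesis using assms by (simp add: mult_nonpos_nonneg)
next
  case False then show ?thesis using assms by (simp add: field_simps)
qed

section \<open>From stability to lower bounds of the Yamabe quotients\<close>

context hypersurface
begin

context
  fixes n :: nat
  assumes n: "n \<ge> 4"
    and proper: "f ` bdry S \<subseteq> bdry A" and compact: "compact (UNIV :: 'q set)"
    and minimal: "minimal S A G f g N" and free: "free_boundary S A G f N"
    and stable: "stable_hypersurface S A G f g N"
begin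

lemma traced_gauss_minimal:
  "scalar_curvature A G (f p) = scalar_curvature S g p + sff_norm_sq S A G f g N p + 2 * ricci_normal A G f N p"
  using traced_gauss[of p] minimal by (simp add: minimal_def)

lemma compact_bdry: "compact (bdry S)"
  using compact_Int_closed[OF compact S.closed_bdry] by simp

lemma integrable_volume: "continuous_on UNIV h \<Longrightarrow> integrable (volume_measure S g) h" for h :: "'q \<Rightarrow> real"
  using set_integrable_continuous_compact[OF S.finite_volume_measure[OF compact] _ compact closed_UNIV, of h]
  by (simp add: volume_measure_def set_integrable_def)

lemma set_integrable_bdry: "continuous_on (bdry S) h \<Longrightarrow> set_integrable (bdry_measure S g) (bdry S) h" for h :: "'q \<Rightarrow> real"
  using set_integrable_continuous_compact[OF S.finite_bdry_measure[OF compact] _ compact_bdry S.closed_bdry, of h]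
  by (simp add: bdry_measure_def)

lemma continuous_ambient_scalar: "continuous_on UNIV (\<lambda>p. scalar_curvature A G (f p))"
  by (rule continuous_on_compose2[OF M.continuous_scalar_curvature cont]) simp

lemma continuous_ambient_mean: "continuous_on (bdry S) (\<lambda>p. bdry_mean_curvature A G (f p))"
  by (rule continuous_on_compose2[OF M.continuous_bdry_mean_curvature continuous_on_subset[OF cont] proper]) simp

lemma energy_lower_bound:
  assumes \<phi>: "smooth_fun S UNIV \<phi>"
  shows "(LINT p|volume_measure S g. scalar_curvature A G (f p) * (\<phi> p)\<^sup>2)
     + 2 * (LINT p:bdry S|bdry_measure S g. bdry_mean_curvature A G (f p) * (\<phi> p)\<^sup>2)
     \<le> yamabe_energy n S g \<phi>"
proof -
  let ?V = "volume_measure S g" and ?B = "bdry_measure S g"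
  let ?R = "\<lambda>p. scalar_curvature A G (f p)" and ?H = "\<lambda>p. bdry_mean_curvature A G (f p)"
  let ?a = "4 * (real n - 2) / (real n - 3)"
  let ?I1 = "\<lambda>p. ?a * grad_norm_sq S g \<phi> p + scalar_curvature S g p * (\<phi> p)\<^sup>2"
  let ?I2 = "\<lambda>p. grad_norm_sq S g \<phi> p - (ricci_normal A G f N p + sff_norm_sq S A G f g N p) * (\<phi> p)\<^sup>2"
  note c\<phi> = S.continuous_smooth_fun[OF \<phi>]
  have c\<phi>B: "continuous_on (bdry S) \<phi>" by (rule continuous_on_subset[OF c\<phi>]) simp
  \<comment> \<open>Continuity of the squared second fundamental form is obtained by solving the
    traced Gauss equation for it, all other terms being known to be continuous.\<close>
  have "continuous_on UNIV (\<lambda>p. scalar_curvature A G (f p) - scalar_curvature S g p - 2 * ricci_normal A G f N p)"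
    by (intro continuous_intros continuous_ambient_scalar S.continuous_scalar_curvature continuous_ricci_normal)
  then have ch: "continuous_on UNIV (sff_norm_sq S A G f g N)"
    by (rule continuous_on_eq) (simp add: traced_gauss_minimal)
  \<comment> \<open>Likewise the boundary term of the stability inequality is a difference of two
    continuous mean curvatures.\<close>
  have "continuous_on (bdry S) (\<lambda>p. ?H p - bdry_mean_curvature S g p)"
    by (intro continuous_intros continuous_ambient_mean S.continuous_bdry_mean_curvature)
  then have cPi: "continuous_on (bdry S) (bdry_sff_normal A G f N)"
    by (rule continuous_on_eq) (simp add: bdry_mean_curvature_free_boundary[OF proper free])
  have i1: "integrable ?V ?I1" and i2: "integrable ?V ?I2" and iR: "integrable ?V (\<lambda>p. ?R p * (\<phi> p)\<^sup>2)"
    by (intro integrable_volume continuous_intros c\<phi> S.continuous_grad_norm_sq[OF \<phi>] S.continuous_scalar_curvature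
        continuous_ricci_normal ch continuous_ambient_scalar)+
  have iK: "set_integrable ?B (bdry S) (\<lambda>p. bdry_mean_curvature S g p * (\<phi> p)\<^sup>2)"
    and iPi: "set_integrable ?B (bdry S) (\<lambda>p. bdry_sff_normal A G f N p * (\<phi> p)\<^sup>2)"
    by (intro set_integrable_bdry continuous_intros c\<phi>B cPi S.continuous_bdry_mean_curvature)+
  have a: "?a \<ge> 2" using n by (simp add: field_simps)
  have "2 * ?I2 p + ?R p * (\<phi> p)\<^sup>2 \<le> ?I1 p" for p
  proof -
    \<comment> \<open>The surplus given away: the part of the gradient term beyond coefficient 2,
      and the squared second fundamental form.\<close>
    have "0 \<le> (?a - 2) * grad_norm_sq S g \<phi> p + sff_norm_sq S A G f g N p * (\<phi> p)\<^sup>2"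
      using a S.grad_norm_sq_nonneg[OF \<phi>] sff_norm_sq_nonneg by (intro add_nonneg_nonneg mult_nonneg_nonneg) auto
    also have "\<dots> = ?I1 p - (2 * ?I2 p + ?R p * (\<phi> p)\<^sup>2)"
      unfolding traced_gauss_minimal by algebra
    finally show ?thesis by simp
  qed
  then have "(LINT p|?V. 2 * ?I2 p + ?R p * (\<phi> p)\<^sup>2) \<le> (LINT p|?V. ?I1 p)"
    by (intro integral_mono i1 Bochner_Integration.integrable_add integrable_mult_right i2 iR)
  then have 1: "2 * (LINT p|?V. ?I2 p) + (LINT p|?V. ?R p * (\<phi> p)\<^sup>2) \<le> (LINT p|?V. ?I1 p)"
    unfolding Bochner_Integration.integral_add[OF integrable_mult_right[OF i2] iR] integral_mult_right_zero .
  have "(LINT p:bdry S|?B. ?H p * (\<phi> p)\<^sup>2)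
    = (LINT p:bdry S|?B. bdry_mean_curvature S g p * (\<phi> p)\<^sup>2 + bdry_sff_normal A G f N p * (\<phi> p)\<^sup>2)"
    using S.closed_bdry by (intro set_lebesgue_integral_cong)
      (auto simp: bdry_measure_def bdry_mean_curvature_free_boundary[OF proper free] distrib_right)
  then have 2: "(LINT p:bdry S|?B. ?H p * (\<phi> p)\<^sup>2) = (LINT p:bdry S|?B. bdry_mean_curvature S g p * (\<phi> p)\<^sup>2)
      + (LINT p:bdry S|?B. bdry_sff_normal A G f N p * (\<phi> p)\<^sup>2)"
    using set_integral_add(2)[OF iK iPi] by simp
  have "0 \<le> (LINT p|?V. ?I2 p) - (LINT p:bdry S|?B. bdry_sff_normal A G f N p * (\<phi> p)\<^sup>2)"
    using stable \<phi> by (simp add: stable_hypersurface_def)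
  then show ?thesis using 1 2 unfolding yamabe_energy_def by simp
qed

lemma quotient_10_lower_bound:
  assumes \<phi>: "smooth_fun S UNIV \<phi>" "\<And>p. 0 < \<phi> p"
    and H: "\<And>p. p \<in> bdry A \<Longrightarrow> 0 \<le> bdry_mean_curvature A G p"
    and r: "\<And>p. r \<le> scalar_curvature A G p" "r < 0"
  shows "r * measure (volume_measure S g) UNIV powr (2 / (real n - 1)) \<le> yamabe_quotient_10 n S g \<phi>"
proof -
  let ?V = "volume_measure S g" and ?\<theta> = "(real n - 3) / (real n - 1)"
  let ?w = "LINT p|?V. \<phi> p powr (2 * (real n - 1) / (real n - 3))"
  note c\<phi> = S.continuous_smooth_fun[OF \<phi>(1)]
  \<comment> \<open>\<open>?\<theta>\<close> is the exponent in the denominator of the quotient.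
    Then \<open>2 / ?\<theta>\<close> is the critical exponent under its integral and
    \<open>1 - ?\<theta>\<close> the exponent of the volume in the claim.\<close>
  have exps: "2 / ?\<theta> = 2 * (real n - 1) / (real n - 3)" "1 - ?\<theta> = 2 / (real n - 1)" "0 < ?\<theta>" "?\<theta> < 1"
    using n by (auto simp: field_simps)
  have "(LINT p:UNIV|?V. (\<phi> p)\<^sup>2) \<le> (LINT p:UNIV|?V. \<phi> p powr (2 / ?\<theta>)) powr ?\<theta> * measure ?V UNIV powr (1 - ?\<theta>)"
    by (rule set_integral_square_le[OF S.finite_volume_measure[OF compact] _ compact closed_UNIV c\<phi> \<phi>(2) exps(3,4)])
      (simp add: volume_measure_def)
  then have h: "(LINT p|?V. (\<phi> p)\<^sup>2) \<le> ?w powr ?\<theta> * measure ?V UNIV powr (2 / (real n - 1))"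
    unfolding exps(1,2) by (simp add: set_lebesgue_integral_def)
  \<comment> \<open>Here \<open>r < 0\<close> reverses Hoelder's upper bound into a lower bound for
    the curvature term.\<close>
  have "r * (?w powr ?\<theta> * measure ?V UNIV powr (2 / (real n - 1))) \<le> r * (LINT p|?V. (\<phi> p)\<^sup>2)"
    using h r(2) by (intro mult_left_mono_neg) auto
  also have "\<dots> = (LINT p|?V. r * (\<phi> p)\<^sup>2)" by simp
  also have "\<dots> \<le> (LINT p|?V. scalar_curvature A G (f p) * (\<phi> p)\<^sup>2)"
    by (intro integral_mono integrable_volume continuous_intros c\<phi> continuous_ambient_scalar mult_right_mono r) simp
  also have "\<dots> \<le> (LINT p|?V. scalar_curvature A G (f p) * (\<phi> p)\<^sup>2)
     + 2 * (LINT p:bdry S|bdry_measure S g. bdry_mean_curvature A G (f p) * (\<phi> p)\<^sup>2)"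
    using H proper unfolding set_lebesgue_integral_def
    by (intro add_increasing2 mult_nonneg_nonneg Bochner_Integration.integral_nonneg) (auto simp: indicator_def)
  also have "\<dots> \<le> yamabe_energy n S g \<phi>" by (rule energy_lower_bound[OF \<phi>(1)])
  finally show ?thesis
    unfolding yamabe_quotient_10_def by (rule quotient_lower_bound) (use r in auto)
qed

lemma quotient_01_lower_bound:
  assumes \<phi>: "smooth_fun S UNIV \<phi>" "\<And>p. 0 < \<phi> p"
    and R: "\<And>p. 0 \<le> scalar_curvature A G p"
    and r: "\<And>p. p \<in> bdry A \<Longrightarrow> r \<le> bdry_mean_curvature A G p" "r < 0"
  shows "2 * r * measure (bdry_measure S g) (bdry S) powr (1 / (real n - 2)) \<le> yamabe_quotient_01 n S g \<phi>"
proof -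
  let ?B = "bdry_measure S g" and ?\<theta> = "(real n - 3) / (real n - 2)"
  let ?w = "LINT p:bdry S|?B. \<phi> p powr (2 * (real n - 2) / (real n - 3))"
  have c\<phi>: "continuous_on (bdry S) \<phi>" by (rule continuous_on_subset[OF S.continuous_smooth_fun[OF \<phi>(1)]]) simp
  \<comment> \<open>As for the volume, with the critical exponent of the boundary;
    \<open>1 - ?\<theta>\<close> is now the exponent of the boundary area.\<close>
  have exps: "2 / ?\<theta> = 2 * (real n - 2) / (real n - 3)" "1 - ?\<theta> = 1 / (real n - 2)" "0 < ?\<theta>" "?\<theta> < 1"
    using n by (auto simp: field_simps)
  have h: "(LINT p:bdry S|?B. (\<phi> p)\<^sup>2) \<le> ?w powr ?\<theta> * measure ?B (bdry S) powr (1 / (real n - 2))"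
    using set_integral_square_le[OF S.finite_bdry_measure[OF compact] _ compact_bdry S.closed_bdry c\<phi> \<phi>(2) exps(3,4)]
    unfolding exps(1,2) by (simp add: bdry_measure_def)
  have "2 * r * (?w powr ?\<theta> * measure ?B (bdry S) powr (1 / (real n - 2))) \<le> 2 * r * (LINT p:bdry S|?B. (\<phi> p)\<^sup>2)"
    using h r(2) by (intro mult_left_mono_neg) auto
  also have "\<dots> = 2 * (LINT p:bdry S|?B. r * (\<phi> p)\<^sup>2)" by simp
  also have "\<dots> \<le> 2 * (LINT p:bdry S|?B. bdry_mean_curvature A G (f p) * (\<phi> p)\<^sup>2)"
    using r(1) proper
    by (intro mult_left_mono set_integral_mono set_integrable_bdry continuous_intros c\<phi> continuous_ambient_mean
        mult_right_mono) auto
  also have "\<dots> \<le> (LINT p|volume_measure S g. scalar_curvature A G (f p) * (\<phi> p)\<^sup>2)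
     + 2 * (LINT p:bdry S|?B. bdry_mean_curvature A G (f p) * (\<phi> p)\<^sup>2)"
    using R by (intro add_increasing Bochner_Integration.integral_nonneg mult_nonneg_nonneg) auto
  also have "\<dots> \<le> yamabe_energy n S g \<phi>" by (rule energy_lower_bound[OF \<phi>(1)])
  finally show ?thesis
    unfolding yamabe_quotient_01_def by (rule quotient_lower_bound) (use r in auto)
qed

end

end

theorem theorem1:
  fixes n :: nat
    and A :: "('p::{t2_space,second_countable_topology}, 'a::euclidean_space \<times> real) chart set"
    and G :: "('p, 'a \<times> real) metric"
    and S :: "('q::{t2_space,second_countable_topology}, 'b::euclidean_space \<times> real) chart set"
    and g :: "('q, 'b \<times> real) metric"
    and f :: "'q \<Rightarrow> 'p"
    and N :: "('p, 'a \<times> real) chart \<Rightarrow> 'q \<Rightarrow> 'a \<times> real"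
  defines "infR \<equiv> (INF p. ereal (scalar_curvature A G p))"
    and "infH \<equiv> (INF p\<in>bdry A. ereal (bdry_mean_curvature A G p))"
    and "vol \<equiv> measure (volume_measure S g) UNIV"
    and "area \<equiv> measure (bdry_measure S g) (bdry S)"
  assumes "n \<ge> 4" and "DIM('a \<times> real) = n" and "DIM('b \<times> real) = n - 1"
    and "smooth_atlas A" and "riemannian_metric A G" and "bdry A \<noteq> {}"
    and "smooth_atlas S" and "compact (UNIV :: 'q set)" and "bdry S \<noteq> {}"
    and "properly_immersed S A f" and "induced_metric S A G f g"
    and "unit_normal_field S A G f N"
    and "minimal S A G f g N" and "free_boundary S A G f N" and "stable_hypersurface S A G f g N"
  shows "((\<forall>p\<in>bdry A. bdry_mean_curvature A G p \<ge> 0) \<and> infR \<noteq> -\<infinity> \<and> infR < 0 \<and>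
            yamabe_invariant_10 n S < 0 \<longrightarrow>
          ereal (vol powr (2 / (real n - 1))) \<ge> yamabe_constant_10 n S g / infR \<and>
          yamabe_constant_10 n S g / infR \<ge> yamabe_invariant_10 n S / infR)
       \<and> ((\<forall>p. scalar_curvature A G p \<ge> 0) \<and> infH \<noteq> -\<infinity> \<and> infH < 0 \<and>
            yamabe_invariant_01 n S < 0 \<longrightarrow>
          ereal (area powr (1 / (real n - 2))) \<ge> 1 / 2 * (yamabe_constant_01 n S g / infH) \<and>
          1 / 2 * (yamabe_constant_01 n S g / infH) \<ge> 1 / 2 * (yamabe_invariant_01 n S / infH))"
proof -
  have imm: "immersion S A f" and proper: "f ` bdry S \<subseteq> bdry A"
    using \<open>properly_immersed S A f\<close> by (auto simp: properly_immersed_def)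
  have riem: "riemannian_metric S g"
    by (rule induced_metric_riemannian[OF \<open>smooth_atlas A\<close> \<open>riemannian_metric A G\<close> \<open>smooth_atlas S\<close> imm
          \<open>induced_metric S A G f g\<close>])
  interpret hypersurface S g A G f N
  proof
    show "continuous_on UNIV f" "\<And>d. d \<in> A \<Longrightarrow> smooth_fun S (f -` cdom d) (cmap d \<circ> f)"
      using imm by (auto simp: immersion_def)
    show "DIM('a) = DIM('b) + 1"
      using \<open>DIM('a \<times> real) = n\<close> \<open>DIM('b \<times> real) = n - 1\<close> \<open>n \<ge> 4\<close> by simp
  qed (fact assms riem)+
  note hyps = \<open>n \<ge> 4\<close> proper \<open>compact UNIV\<close> \<open>minimal S A G f g N\<close> \<open>free_boundary S A G f N\<close>
    \<open>stable_hypersurface S A G f g N\<close>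
  let ?I = "{\<phi>. smooth_fun S UNIV \<phi> \<and> (\<forall>p. 0 < \<phi> p)} :: ('q \<Rightarrow> real) set"
  \<comment> \<open>A constant test function shows that the infimum defining the Yamabe constants is
    not over an empty family.\<close>
  have "(\<lambda>p. 1) \<in> ?I" by (simp add: smooth_fun_def o_def smooth_on_const)
  then have I: "?I \<noteq> {}" by blast
  show ?thesis
  proof (intro conjI[of "_ \<longrightarrow> _"] impI, goal_cases)
    case 1
    then obtain r where r: "infR = ereal r" "r < 0" by (cases infR) auto
    have R: "r \<le> scalar_curvature A G p" for p
      using INF_lower[of p UNIV "\<lambda>p. ereal (scalar_curvature A G p)"] r(1) by (simp add: infR_def)
    \<comment> \<open>The induced metric is Riemannian, hence a competitor in the supremum.\<close>
    have "yamabe_constant_10 n S g \<le> yamabe_invariant_10 n S"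
      unfolding yamabe_invariant_10_def by (rule SUP_upper) (simp add: riem)
    from ereal_bounds_of_INF[OF r(2) zero_less_one I _ this[unfolded yamabe_constant_10_def],
        of "vol powr (2 / (real n - 1))"]
    show ?case
      using quotient_10_lower_bound[OF hyps _ _ _ R r(2)] 1
      by (simp add: yamabe_constant_10_def vol_def r(1) one_ereal_def[symmetric])
  next
    case 2
    then obtain r where r: "infH = ereal r" "r < 0" by (cases infH) auto
    have H: "r \<le> bdry_mean_curvature A G p" if "p \<in> bdry A" for p
      using INF_lower[OF that, of "\<lambda>p. ereal (bdry_mean_curvature A G p)"] r(1) by (simp add: infH_def)
    have half: "1 / 2 = ereal (1 / 2)" by (simp add: one_ereal_def)
    have "yamabe_constant_01 n S g \<le> yamabe_invariant_01 n S"
      unfolding yamabe_invariant_01_def by (rule SUP_upper) (simp add: riem)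
    \<comment> \<open>The factor \<open>k\<close> is 2 here, from the coefficient of the boundary
      integral in the energy; it becomes the factor one half of the claim.\<close>
    from ereal_bounds_of_INF[OF r(2) zero_less_numeral[of "num.Bit0 num.One"] I _ this[unfolded yamabe_constant_01_def],
        of "area powr (1 / (real n - 2))"]
    show ?case
      unfolding half using quotient_01_lower_bound[OF hyps _ _ _ H r(2)] 2
      by (simp add: yamabe_constant_01_def area_def r(1))
  qed
qed

end
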